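(* Let $G=\{g_1=e,g_2,\ldots,g_n\}$ be a finite group of order $n$, let $a_g\in\mathfrak{A}$ for $g\in G$, where $\mathfrak{A}$ is an algebra of continuous functions on the contour $\Gamma$ as described in the context, and let $$A(t)=\bigl(a_{g_ig_j^{-1}}(t)\bigr)_{i,j=1}^n$$ be an invertible matrix function. Then the Wiener--Hopf factorization problem for $A(t)$ is explicitly reduced to the $s$ problems for the $n_k\times n_k$ matrix functions $$\lambda_k(t)=\sum_{g\in G}a_g(t)\varphi_k(g),\qquad k=1,\ldots,s,$$ where $\varphi_k(g)$ are the matrices of the irreducible representations of $G$. Each partial index of $\lambda_k(t)$ is a partial index of $A(t)$ of multiplicity $n_k$. If $G'$ is the commutator subgroup of $G$, then $A(t)$ has $[G:G']$ partial indices that can be found explicitly. Here $[G:G']$ is the index of $G'$ in $G$.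
   Context: $\Gamma$ is a simple smooth closed contour in $\mathbb{C}$ bounding the domain $D_+$, with $0\in D_+$, and $D_-$ is the complement of $D_+\cup\Gamma$ in $\overline{\mathbb{C}}=\mathbb{C}\cup\{\infty\}$. A (right) Wiener--Hopf factorization of a continuous invertible $m\times m$ matrix function $B(t)$ on $\Gamma$ is a representation $B(t)=B_-(t)d(t)B_+(t)$, $t\in\Gamma$, where $B_\pm(t)$ are continuous and invertible matrix functions on $\Gamma$ that admit analytic continuation into $D_\pm$, the continuations being invertible there, and $d(t)=\mathrm{diag}[t^{\rho_1},\ldots,t^{\rho_m}]$; the integers $\rho_1,\ldots,\rho_m$ are called the (right) partial indices of $B(t)$. $\mathfrak{A}$ is an algebra of continuous functions on $\Gamma$ such that any invertible element $\lambda(t)\in\mathfrak{A}$ admits the Wiener--Hopf factorization $\lambda(t)=\lambda^-(t)t^{\rho}\lambda^+(t)$ with $\rho=\mathrm{ind}_\Gamma\lambda(t)$, and any invertible matrix function with entries from $\mathfrak{A}$ admits a matrix Wiener--Hopf factorization. $s$ is the number of conjugacy classes of $G$; $\{\Phi_1,\ldots,\Phi_s\}$ is a set of pairwise inequivalent irreducible unitary representations of $G$, with degrees $n_1,\ldots,n_s$; $\varphi_k(g)$ is the $n_k\times n_k$ matrix of the operator $\Phi_k(g)$ with respect to a fixed orthonormal basis of the representation space of $\Phi_k$. *)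

theory Defs
  imports
    "HOL-Complex_Analysis.Complex_Analysis"
    "HOL-Algebra.Algebra"
    "Jordan_Normal_Form.Matrix"
    "Jordan_Normal_Form.Schur_Decomposition"
    "Jordan_Normal_Form.VS_Connect"
begin

section \<open>The contour\<close>

text \<open>A simple smooth closed contour, traversed counterclockwise. It is given by a regular
  \<open>C\<^sup>1\<close> parametrization \<open>\<gamma>\<close> on \<open>[0,1]\<close> whose tangent also closes up. The contour as a point set is
  \<^term>\<open>path_image \<gamma>\<close>; \<open>D\<^sub>+\<close> is \<^term>\<open>inside (path_image \<gamma>)\<close>, and \<open>D\<^sub>-\<close> is
  \<^term>\<open>outside (path_image \<gamma>)\<close> together with the point at infinity.\<close>

definition smooth_contour :: "(real \<Rightarrow> complex) \<Rightarrow> bool" where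
  "smooth_contour \<gamma> \<longleftrightarrow>
     simple_path \<gamma> \<and> pathfinish \<gamma> = pathstart \<gamma> \<and>
     (\<exists>D. continuous_on {0..1} D \<and> D 0 = D 1 \<and>
        (\<forall>x\<in>{0..1}. (\<gamma> has_vector_derivative D x) (at x within {0..1}) \<and> D x \<noteq> 0)) \<and>
     (\<forall>z\<in>inside (path_image \<gamma>). winding_number \<gamma> z = 1)"

text \<open>The Cauchy index along the contour of a continuous function without zeros on it, i.e. the
  increment of its argument divided by \<open>2\<pi>\<close>. For such functions \<^const>\<open>winding_number\<close> (a complex
  number) is an integer; elsewhere the value is irrelevant.\<close>

definition contour_index :: "(real \<Rightarrow> complex) \<Rightarrow> (complex \<Rightarrow> complex) \<Rightarrow> int" where
  "contour_index \<gamma> f = (THE r. of_int r = winding_number (f \<circ> \<gamma>) 0)"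

section \<open>Wiener--Hopf factorization\<close>

text \<open>Functions on the contour \<open>\<Gamma>\<close> are total functions of which only the values on \<open>\<Gamma>\<close> matter. The
  matrices have entries indexed from \<open>0\<close>.\<close>

definition plus_factor :: "complex set \<Rightarrow> nat \<Rightarrow> (complex \<Rightarrow> complex mat) \<Rightarrow> bool" where
  "plus_factor \<Gamma> m B \<longleftrightarrow>
     (\<exists>F. (\<forall>t\<in>\<Gamma>. F t = B t) \<and>
        (\<forall>z\<in>\<Gamma> \<union> inside \<Gamma>. F z \<in> carrier_mat m m \<and> invertible_mat (F z)) \<and>
        (\<forall>i<m. \<forall>j<m. continuous_on (\<Gamma> \<union> inside \<Gamma>) (\<lambda>z. F z $$ (i, j)) \<and>
                      (\<lambda>z. F z $$ (i, j)) holomorphic_on inside \<Gamma>))"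

text \<open>In the next definition \<open>L\<close> is the value of the continuation at infinity, and analyticity at
  infinity is analyticity at \<open>0\<close> in the coordinate \<open>w = 1/z\<close>.\<close>

definition minus_factor :: "complex set \<Rightarrow> nat \<Rightarrow> (complex \<Rightarrow> complex mat) \<Rightarrow> bool" where
  "minus_factor \<Gamma> m B \<longleftrightarrow>
     (\<exists>F L. (\<forall>t\<in>\<Gamma>. F t = B t) \<and>
        (\<forall>z\<in>\<Gamma> \<union> outside \<Gamma>. F z \<in> carrier_mat m m \<and> invertible_mat (F z)) \<and>
        L \<in> carrier_mat m m \<and> invertible_mat L \<and>
        (\<forall>i<m. \<forall>j<m. continuous_on (\<Gamma> \<union> outside \<Gamma>) (\<lambda>z. F z $$ (i, j)) \<and>
                      (\<lambda>z. F z $$ (i, j)) holomorphic_on outside \<Gamma> \<and>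
                      (\<lambda>w. if w = 0 then L $$ (i, j) else F (inverse w) $$ (i, j))
                        analytic_on {0}))"

definition wh_factorization ::
  "complex set \<Rightarrow> nat \<Rightarrow> (complex \<Rightarrow> complex mat) \<Rightarrow>
   (complex \<Rightarrow> complex mat) \<Rightarrow> int list \<Rightarrow> (complex \<Rightarrow> complex mat) \<Rightarrow> bool" where
  "wh_factorization \<Gamma> m B Bm \<rho> Bp \<longleftrightarrow>
     minus_factor \<Gamma> m Bm \<and> plus_factor \<Gamma> m Bp \<and> length \<rho> = m \<and>
     (\<forall>t\<in>\<Gamma>. B t = Bm t * mat_diag m (\<lambda>i. t powi (\<rho> ! i)) * Bp t)"

definition partial_indices ::
  "complex set \<Rightarrow> nat \<Rightarrow> (complex \<Rightarrow> complex mat) \<Rightarrow> int list \<Rightarrow> bool" where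
  "partial_indices \<Gamma> m B \<rho> \<longleftrightarrow> (\<exists>Bm Bp. wh_factorization \<Gamma> m B Bm \<rho> Bp)"

definition invertible_on :: "complex set \<Rightarrow> nat \<Rightarrow> (complex \<Rightarrow> complex mat) \<Rightarrow> bool" where
  "invertible_on \<Gamma> m B \<longleftrightarrow> (\<forall>t\<in>\<Gamma>. B t \<in> carrier_mat m m \<and> invertible_mat (B t))"

definition entries_in :: "(complex \<Rightarrow> complex) set \<Rightarrow> nat \<Rightarrow> (complex \<Rightarrow> complex mat) \<Rightarrow> bool" where
  "entries_in \<AA> m B \<longleftrightarrow> (\<forall>i<m. \<forall>j<m. (\<lambda>t. B t $$ (i, j)) \<in> \<AA>)"

text \<open>Invertibility of a scalar element is meant in the algebra \<open>\<AA>\<close> (which is unital); invertibility of a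
  matrix function is meant pointwise on the contour, so no inverse-closedness of \<open>\<AA>\<close> is assumed.\<close>

definition wh_algebra :: "(real \<Rightarrow> complex) \<Rightarrow> (complex \<Rightarrow> complex) set \<Rightarrow> bool" where
  "wh_algebra \<gamma> \<AA> \<longleftrightarrow>
     (\<forall>f\<in>\<AA>. continuous_on (path_image \<gamma>) f) \<and>
     (\<lambda>_. 1) \<in> \<AA> \<and>
     (\<forall>f\<in>\<AA>. \<forall>h\<in>\<AA>. (\<lambda>t. f t + h t) \<in> \<AA> \<and> (\<lambda>t. f t * h t) \<in> \<AA>) \<and>
     (\<forall>c. \<forall>f\<in>\<AA>. (\<lambda>t. c * f t) \<in> \<AA>) \<and>
     (\<forall>f\<in>\<AA>. (\<exists>h\<in>\<AA>. \<forall>t\<in>path_image \<gamma>. f t * h t = 1) \<longrightarrow>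
        partial_indices (path_image \<gamma>) 1 (\<lambda>t. mat 1 1 (\<lambda>_. f t)) [contour_index \<gamma> f]) \<and>
     (\<forall>m B. 0 < m \<longrightarrow> entries_in \<AA> m B \<longrightarrow> invertible_on (path_image \<gamma>) m B \<longrightarrow>
        (\<exists>\<rho>. partial_indices (path_image \<gamma>) m B \<rho>))"

section \<open>Unitary matrix representations of a finite group\<close>

definition unitary_mat :: "nat \<Rightarrow> complex mat \<Rightarrow> bool" where
  "unitary_mat d U \<longleftrightarrow>
     U \<in> carrier_mat d d \<and> U * mat_adjoint U = 1\<^sub>m d \<and> mat_adjoint U * U = 1\<^sub>m d"

text \<open>A unitary representation is given by its matrices in an orthonormal basis, so that the
  representation space is \<open>\<complex>\<^sup>d\<close>. That the unit element acts as the identity follows from unitarity and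
  multiplicativity.\<close>

definition unitary_rep :: "('g, 'b) monoid_scheme \<Rightarrow> nat \<Rightarrow> ('g \<Rightarrow> complex mat) \<Rightarrow> bool" where
  "unitary_rep G d \<phi> \<longleftrightarrow>
     (\<forall>x\<in>carrier G. unitary_mat d (\<phi> x)) \<and>
     (\<forall>x\<in>carrier G. \<forall>y\<in>carrier G. \<phi> (x \<otimes>\<^bsub>G\<^esub> y) = \<phi> x * \<phi> y)"

definition irreducible_rep :: "('g, 'b) monoid_scheme \<Rightarrow> nat \<Rightarrow> ('g \<Rightarrow> complex mat) \<Rightarrow> bool" where
  "irreducible_rep G d \<phi> \<longleftrightarrow> 0 < d \<and>
     (\<forall>W. VectorSpace.subspace class_ring W (module_vec TYPE(complex) d) \<longrightarrow>
        (\<forall>x\<in>carrier G. \<forall>v\<in>W. \<phi> x *\<^sub>v v \<in> W) \<longrightarrow> W = {0\<^sub>v d} \<or> W = carrier_vec d)"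

definition equivalent_reps ::
  "('g, 'b) monoid_scheme \<Rightarrow> nat \<Rightarrow> ('g \<Rightarrow> complex mat) \<Rightarrow> nat \<Rightarrow> ('g \<Rightarrow> complex mat) \<Rightarrow> bool" where
  "equivalent_reps G d \<phi> d' \<psi> \<longleftrightarrow> d = d' \<and>
     (\<exists>P\<in>carrier_mat d d. invertible_mat P \<and> (\<forall>x\<in>carrier G. P * \<phi> x = \<psi> x * P))"

definition conjugacy_classes :: "('g, 'b) monoid_scheme \<Rightarrow> 'g set set" where
  "conjugacy_classes G = orbits G (carrier G) (\<lambda>h x. h \<otimes>\<^bsub>G\<^esub> x \<otimes>\<^bsub>G\<^esub> inv\<^bsub>G\<^esub> h)"

definition irreducible_system ::
  "('g, 'b) monoid_scheme \<Rightarrow> nat \<Rightarrow> (nat \<Rightarrow> nat) \<Rightarrow> (nat \<Rightarrow> 'g \<Rightarrow> complex mat) \<Rightarrow> bool" where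
  "irreducible_system G s d \<phi> \<longleftrightarrow>
     s = card (conjugacy_classes G) \<and>
     (\<forall>k<s. unitary_rep G (d k) (\<phi> k) \<and> irreducible_rep G (d k) (\<phi> k)) \<and>
     (\<forall>j<s. \<forall>k<s. j \<noteq> k \<longrightarrow> \<not> equivalent_reps G (d j) (\<phi> j) (d k) (\<phi> k))"

section \<open>Group matrices and their block diagonalization\<close>

definition group_matrix ::
  "('g, 'b) monoid_scheme \<Rightarrow> nat \<Rightarrow> (nat \<Rightarrow> 'g) \<Rightarrow> ('g \<Rightarrow> complex \<Rightarrow> complex) \<Rightarrow>
   complex \<Rightarrow> complex mat" where
  "group_matrix G n g a t = mat n n (\<lambda>(i, j). a (g i \<otimes>\<^bsub>G\<^esub> inv\<^bsub>G\<^esub> (g j)) t)"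

definition symbol ::
  "('g, 'b) monoid_scheme \<Rightarrow> nat \<Rightarrow> ('g \<Rightarrow> complex mat) \<Rightarrow> ('g \<Rightarrow> complex \<Rightarrow> complex) \<Rightarrow>
   complex \<Rightarrow> complex mat" where
  "symbol G d \<phi> a t = mat d d (\<lambda>(p, q). \<Sum>x\<in>carrier G. a x t * \<phi> x $$ (p, q))"

text \<open>The Fourier matrix of the group. Its columns are indexed by the group elements and its rows by
  the matrix coefficients \<open>(k, q, p)\<close> of the representations, in lexicographic order. Thus the rows
  with fixed \<open>k\<close> and \<open>q\<close> are consecutive and carry the \<open>q\<close>-th of the \<open>d k\<close> copies of the \<open>k\<close>-th
  representation in the left regular representation. By Schur orthogonality the factor
  \<open>sqrt (d k / n)\<close> makes the matrix unitary; there are \<open>n\<close> rows because the squares of the degrees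
  add up to the order of the group.\<close>

definition coefficient_list :: "nat \<Rightarrow> (nat \<Rightarrow> nat) \<Rightarrow> (nat \<times> nat \<times> nat) list" where
  "coefficient_list s d = [(k, q, p). k \<leftarrow> [0..<s], q \<leftarrow> [0..<d k], p \<leftarrow> [0..<d k]]"

definition fourier_matrix ::
  "nat \<Rightarrow> (nat \<Rightarrow> 'g) \<Rightarrow> nat \<Rightarrow> (nat \<Rightarrow> nat) \<Rightarrow> (nat \<Rightarrow> 'g \<Rightarrow> complex mat) \<Rightarrow> complex mat" where
  "fourier_matrix n g s d \<phi> =
     mat (length (coefficient_list s d)) n
       (\<lambda>(r, c). case coefficient_list s d ! r of (k, q, p) \<Rightarrow>
          complex_of_real (sqrt (real (d k) / real n)) * \<phi> k (g c) $$ (p, q))"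

text \<open>For each \<open>k\<close>, the block \<open>M k\<close> (respectively the list \<open>\<rho> k\<close>) is repeated \<open>d k\<close> times.\<close>

definition repeated_blocks :: "nat \<Rightarrow> (nat \<Rightarrow> nat) \<Rightarrow> (nat \<Rightarrow> complex mat) \<Rightarrow> complex mat" where
  "repeated_blocks s d M = diag_block_mat (concat (map (\<lambda>k. replicate (d k) (M k)) [0..<s]))"

definition repeated_indices :: "nat \<Rightarrow> (nat \<Rightarrow> nat) \<Rightarrow> (nat \<Rightarrow> int list) \<Rightarrow> int list" where
  "repeated_indices s d \<rho> = concat (map (\<lambda>k. concat (replicate (d k) (\<rho> k))) [0..<s])"

end

theory Submission
  imports Defs "Jordan_Normal_Form.Spectral_Radius"
begin

text \<open>\<open>irreducible_system\<close> only says that there are as many inequivalent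
  representations as conjugacy classes; that every irreducible representation is equivalent to one
  of them is not assumed. Completeness is drawn from squareness alone, twice: a square matrix with
  orthonormal rows has orthonormal columns. This is applied first to the weighted character table,
  then to \<open>F\<close>.

  The definition of a minus factor treats infinity as a separate point. All exterior functions are
  moved to the coordinate \<open>w = 1/z\<close>, in which the closed exterior becomes a compact
  plane set with connected complement, just like the closed interior. One calculus
  (\<open>regular_mat\<close>) then serves both factors, and one topological fact yields the
  logarithms on both sides.

  Its boundary integrals are bounded by oscillation instead, and the Lipschitz property enters by
  limiting the number of such cells.\<close>

text \<open>By Schur orthogonality the matrix coefficients of the \<open>s\<close> given representations, suitably normalized,
  are the rows of a matrix \<open>F\<close> with orthonormal rows. Their number is the order of the group:
  the \<open>s\<close> characters are orthonormal class functions, hence a basis of the class functions, and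
  expanding the indicator function of the unit element in them gives \<open>\<Sum> d\<^sub>k\<^sup>2 = n\<close>. So \<open>F\<close> is unitary,
  it conjugates the group matrix into the direct sum of \<open>d\<^sub>k\<close> copies of each symbol \<open>\<Lambda>\<^sub>k\<close>, and
  factorizations of the symbols assemble to one of the group matrix.

  Partial indices are unique up to order: two factorizations give matrix functions, analytic inside
  and outside, that are glued along the contour by powers of \<open>t\<close>, and Liouville's theorem makes enough
  entries vanish. Gluing requires that the contour is removable for continuous functions, which holds
  because it is a Lipschitz curve. For a representation of degree one the index is the winding number of
  the symbol, since the factors have continuous logarithms on the closed domains. Such representations
  are the ones trivial on the commutator subgroup, and summing the character relation over that
  subgroup counts them.\<close>

section \<open>Complex matrices\<close>

lemma mat_adjoint_conv:
  fixes A :: "complex mat"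
  shows "mat_adjoint A = mat (dim_col A) (dim_row A) (\<lambda>(i, j). cnj (A $$ (j, i)))"
  by (rule eq_matI) (auto simp: mat_adjoint_def mat_of_rows_def)

lemma mat_adjoint_carrier: "A \<in> carrier_mat n m \<Longrightarrow> mat_adjoint (A :: complex mat) \<in> carrier_mat m n"
  by (auto simp: mat_adjoint_conv)

lemma index_mult_mat_sum:
  assumes "A \<in> carrier_mat n m" "B \<in> carrier_mat m l" "i < n" "j < l"
  shows "(A * B) $$ (i, j) = (\<Sum>k<m. A $$ (i, k) * B $$ (k, j))"
  using assms by (auto simp: scalar_prod_def atLeast0LessThan intro!: sum.cong)

text \<open>The two equations behind \<open>invertible_mat\<close> carry identity matrices of a
  priori different sizes; comparing column numbers forces both sizes to be \<open>n\<close>.\<close>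

lemma invertible_mat_iff_inverse:
  assumes "A \<in> carrier_mat n n"
  shows "invertible_mat A \<longleftrightarrow> (\<exists>B\<in>carrier_mat n n. A * B = 1\<^sub>m n \<and> B * A = 1\<^sub>m n)"
proof
  assume "invertible_mat A"
  then obtain B where B: "A * B = 1\<^sub>m n" "B * A = 1\<^sub>m (dim_row B)"
    using assms by (auto simp: invertible_mat_def inverts_mat_def)
  have "dim_col B = n" using arg_cong[OF B(1), of dim_col] by simp
  moreover have "dim_row B = n" using arg_cong[OF B(2), of dim_col] assms by simp
  ultimately show "\<exists>B\<in>carrier_mat n n. A * B = 1\<^sub>m n \<and> B * A = 1\<^sub>m n"
    using B by (intro bexI[of _ B]) auto
qed (use assms in \<open>auto simp: invertible_mat_def inverts_mat_def\<close>)

text \<open>Turns invertibility of products and of block matrices into nonvanishing of products of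
  complex numbers.\<close>

lemma invertible_mat_iff_det:
  assumes A: "(A :: complex mat) \<in> carrier_mat n n"
  shows "invertible_mat A \<longleftrightarrow> Determinant.det A \<noteq> 0"
proof
  assume "invertible_mat A"
  then obtain B where "B \<in> carrier_mat n n" "A * B = 1\<^sub>m n"
    using invertible_mat_iff_inverse[OF A] by blast
  then have "Determinant.det A * Determinant.det B = 1"
    using det_mult[OF A, of B] by simp
  then show "Determinant.det A \<noteq> 0" by auto
next
  assume nz: "Determinant.det A \<noteq> 0"
  let ?B = "inverse (Determinant.det A) \<cdot>\<^sub>m adj_mat A"
  have "?B \<in> carrier_mat n n" "A * ?B = 1\<^sub>m n" "?B * A = 1\<^sub>m n"
    using adj_mat[OF A] A nz
    by (auto simp: mult_smult_distrib[OF A] mult_smult_assoc_mat[of _ n n _ n] intro!: eq_matI)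
  then show "invertible_mat A"
    using invertible_mat_iff_inverse[OF A] by blast
qed

lemma invertible_mat_mult:
  assumes "(A :: complex mat) \<in> carrier_mat n n" "B \<in> carrier_mat n n"
    and "invertible_mat A" "invertible_mat B"
  shows "invertible_mat (A * B)"
  using assms by (simp add: invertible_mat_iff_det[of _ n] det_mult[of _ n])

lemma mult_mat_vec_unit_index:
  assumes "A \<in> carrier_mat n m" "i < n" "j < m"
  shows "vec_index (A *\<^sub>v unit_vec m j) i = (A :: complex mat) $$ (i, j)"
  using assms by (simp add: scalar_prod_def sum.delta if_distrib cong: if_cong)

lemma mat_eqI_mult_vec:
  assumes "(A :: complex mat) \<in> carrier_mat n m" "B \<in> carrier_mat n m"
    and "\<And>v. v \<in> carrier_vec m \<Longrightarrow> A *\<^sub>v v = B *\<^sub>v v"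
  shows "A = B"
proof (rule eq_matI)
  fix i j assume "i < dim_row B" "j < dim_col B"
  then show "A $$ (i, j) = B $$ (i, j)"
    using assms(3)[of "unit_vec m j"] mult_mat_vec_unit_index[OF assms(1), of i j]
      mult_mat_vec_unit_index[OF assms(2), of i j] assms(2) by simp
qed (use assms in auto)

lemma mult_mat_zero_vec:
  "A \<in> carrier_mat n m \<Longrightarrow> A *\<^sub>v 0\<^sub>v m = (0\<^sub>v n :: complex vec)"
  by (intro eq_vecI) auto

lemma subspace_module_vecI:
  assumes "W \<subseteq> carrier_vec d" "0\<^sub>v d \<in> W"
    and "\<And>v w. v \<in> W \<Longrightarrow> w \<in> W \<Longrightarrow> v + w \<in> W"
    and "\<And>c v. v \<in> W \<Longrightarrow> c \<cdot>\<^sub>v v \<in> W"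
  shows "VectorSpace.subspace class_ring W (module_vec TYPE(complex) d)"
  unfolding VectorSpace.subspace_def LinearCombinations.submodule_def
  using assms vec_vs vec_module by (auto simp: module_vec_simps)

section \<open>Schur's lemma and the orthogonality relations\<close>

lemma unitary_rep_carrier:
  "unitary_rep G d \<phi> \<Longrightarrow> x \<in> carrier G \<Longrightarrow> \<phi> x \<in> carrier_mat d d"
  by (auto simp: unitary_rep_def unitary_mat_def)

lemma unitary_rep_mult:
  "unitary_rep G d \<phi> \<Longrightarrow> x \<in> carrier G \<Longrightarrow> y \<in> carrier G \<Longrightarrow> \<phi> (x \<otimes>\<^bsub>G\<^esub> y) = \<phi> x * \<phi> y"
  by (auto simp: unitary_rep_def)

definition intertwiner ::
  "('g, 'b) monoid_scheme \<Rightarrow> nat \<Rightarrow> ('g \<Rightarrow> complex mat) \<Rightarrow> nat \<Rightarrow> ('g \<Rightarrow> complex mat) \<Rightarrow>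
   complex mat \<Rightarrow> bool" where
  "intertwiner G d \<phi> e \<psi> T \<longleftrightarrow>
     T \<in> carrier_mat d e \<and> (\<forall>x\<in>carrier G. \<phi> x * T = T * \<psi> x)"

lemma irreducible_repD:
  assumes "irreducible_rep G d \<phi>" "W \<subseteq> carrier_vec d" "0\<^sub>v d \<in> W"
    and "\<And>v w. v \<in> W \<Longrightarrow> w \<in> W \<Longrightarrow> v + w \<in> W"
    and "\<And>c v. v \<in> W \<Longrightarrow> c \<cdot>\<^sub>v v \<in> W"
    and "\<And>x v. x \<in> carrier G \<Longrightarrow> v \<in> W \<Longrightarrow> \<phi> x *\<^sub>v v \<in> W"
  shows "W = {0\<^sub>v d} \<or> W = carrier_vec d"
  using subspace_module_vecI[OF assms(2-5)] assms(1,6) unfolding irreducible_rep_def by blast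

text \<open>The kernel is an invariant subspace of the irreducible \<open>\<psi>\<close>, hence zero
  or everything.\<close>

lemma intertwiner_kernel:
  assumes "unitary_rep G d \<phi>" "unitary_rep G e \<psi>" "irreducible_rep G e \<psi>"
    and T: "intertwiner G d \<phi> e \<psi> T"
  shows "T = 0\<^sub>m d e \<or> (\<forall>v\<in>carrier_vec e. T *\<^sub>v v = 0\<^sub>v d \<longrightarrow> v = 0\<^sub>v e)"
proof -
  define W where "W = {v \<in> carrier_vec e. T *\<^sub>v v = 0\<^sub>v d}"
  have Tc: "T \<in> carrier_mat d e" using T by (simp add: intertwiner_def)
  have "W = {0\<^sub>v e} \<or> W = carrier_vec e"
  proof (rule irreducible_repD[OF assms(3)])
    fix x v assume x: "x \<in> carrier G" and v: "v \<in> W"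
    note c = unitary_rep_carrier[OF assms(1) x] unitary_rep_carrier[OF assms(2) x]
    have vc: "v \<in> carrier_vec e" using v by (simp add: W_def)
    have "T *\<^sub>v (\<psi> x *\<^sub>v v) = (\<phi> x * T) *\<^sub>v v"
      using T x assoc_mult_mat_vec[OF Tc c(2) vc] by (simp add: intertwiner_def)
    also have "\<dots> = \<phi> x *\<^sub>v 0\<^sub>v d"
      using v assoc_mult_mat_vec[OF c(1) Tc vc] by (simp add: W_def)
    also have "\<dots> = 0\<^sub>v d"
      by (rule mult_mat_zero_vec[OF c(1)])
    finally show "\<psi> x *\<^sub>v v \<in> W" using c v by (simp add: W_def)
  qed (use Tc in \<open>auto simp: W_def mult_add_distrib_mat_vec mult_mat_vec mult_mat_zero_vec[OF Tc]\<close>)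
  moreover have "T = 0\<^sub>m d e" if "W = carrier_vec e"
  proof (rule mat_eqI_mult_vec[OF Tc])
    fix v :: "complex vec" assume v: "v \<in> carrier_vec e"
    then have "v \<in> W" using that by simp
    then show "T *\<^sub>v v = 0\<^sub>m d e *\<^sub>v v" using v by (auto simp: W_def)
  qed simp
  ultimately show ?thesis unfolding W_def by blast
qed

text \<open>The range is an invariant subspace of the irreducible \<open>\<phi>\<close>.\<close>

lemma intertwiner_range:
  assumes "unitary_rep G d \<phi>" "unitary_rep G e \<psi>" "irreducible_rep G d \<phi>"
    and T: "intertwiner G d \<phi> e \<psi> T"
  shows "T = 0\<^sub>m d e \<or> (\<forall>w\<in>carrier_vec d. \<exists>v\<in>carrier_vec e. T *\<^sub>v v = w)"
proof -
  define W where "W = (\<lambda>v. T *\<^sub>v v) ` carrier_vec e"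
  have Tc: "T \<in> carrier_mat d e" using T by (simp add: intertwiner_def)
  have "W = {0\<^sub>v d} \<or> W = carrier_vec d"
  proof (rule irreducible_repD[OF assms(3)])
    show "W \<subseteq> carrier_vec d" using Tc by (auto simp: W_def)
    have "T *\<^sub>v 0\<^sub>v e \<in> W" by (simp add: W_def)
    then show "0\<^sub>v d \<in> W" using mult_mat_zero_vec[OF Tc] by simp
    show "v + w \<in> W" if "v \<in> W" "w \<in> W" for v w
      using that Tc by (auto simp: W_def image_iff mult_add_distrib_mat_vec[symmetric]
          intro!: bexI[of _ "_ + _"])
    show "c \<cdot>\<^sub>v v \<in> W" if "v \<in> W" for c v
      using that Tc by (auto simp: W_def image_iff mult_mat_vec[symmetric] intro!: bexI[of _ "_ \<cdot>\<^sub>v _"])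
    fix x v assume x: "x \<in> carrier G" and "v \<in> W"
    then obtain u where u: "u \<in> carrier_vec e" "v = T *\<^sub>v u" by (auto simp: W_def)
    note c = unitary_rep_carrier[OF assms(1) x] unitary_rep_carrier[OF assms(2) x]
    have "\<phi> x *\<^sub>v v = (\<phi> x * T) *\<^sub>v u" using u c Tc by simp
    also have "\<dots> = T *\<^sub>v (\<psi> x *\<^sub>v u)" using u c Tc T x by (simp add: intertwiner_def)
    finally show "\<phi> x *\<^sub>v v \<in> W" using u c by (auto simp: W_def)
  qed
  moreover have "T = 0\<^sub>m d e" if "W = {0\<^sub>v d}"
  proof (rule mat_eqI_mult_vec[OF Tc])
    fix v :: "complex vec" assume v: "v \<in> carrier_vec e"
    then have "T *\<^sub>v v \<in> W" by (auto simp: W_def)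
    then show "T *\<^sub>v v = 0\<^sub>m d e *\<^sub>v v" using v that by auto
  qed simp
  moreover have "\<exists>v\<in>carrier_vec e. T *\<^sub>v v = w" if "w \<in> W" for w
    using that by (auto simp: W_def)
  ultimately show ?thesis by blast
qed

text \<open>Preimages of the unit vectors are the columns of a right inverse \<open>R\<close>, and
  injectivity makes it two-sided. The traces of \<open>T * R\<close> and \<open>R * T\<close> agree;
  they are \<open>d\<close> and \<open>e\<close>.\<close>

lemma bijective_mat_square:
  assumes T: "(T :: complex mat) \<in> carrier_mat d e"
    and inj: "\<And>v. v \<in> carrier_vec e \<Longrightarrow> T *\<^sub>v v = 0\<^sub>v d \<Longrightarrow> v = 0\<^sub>v e"
    and surj: "\<And>w. w \<in> carrier_vec d \<Longrightarrow> \<exists>v\<in>carrier_vec e. T *\<^sub>v v = w"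
  shows "d = e" "invertible_mat T"
proof -
  have "\<forall>j. \<exists>v\<in>carrier_vec e. T *\<^sub>v v = unit_vec d j" using surj by auto
  then obtain r where r: "\<And>j. r j \<in> carrier_vec e" "\<And>j. T *\<^sub>v r j = unit_vec d j" by metis
  define R where "R = mat e d (\<lambda>(i, j). vec_index (r j) i)"
  have R: "R \<in> carrier_mat e d" by (simp add: R_def)
  have TR: "T * R = 1\<^sub>m d"
  proof (rule eq_matI)
    fix i j assume ij: "i < dim_row (1\<^sub>m d :: complex mat)" "j < dim_col (1\<^sub>m d :: complex mat)"
    have "col R j = r j"
      using ij r(1)[of j] by (auto simp: R_def)
    then have "(T * R) $$ (i, j) = vec_index (T *\<^sub>v r j) i"
      using ij T R by simp
    then show "(T * R) $$ (i, j) = 1\<^sub>m d $$ (i, j)"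
      using ij by (simp add: r(2))
  qed (use T R in auto)
  have RT: "R * T = 1\<^sub>m e"
  proof (rule mat_eqI_mult_vec)
    fix v :: "complex vec" assume v: "v \<in> carrier_vec e"
    let ?w = "(R * T) *\<^sub>v v"
    have w: "?w \<in> carrier_vec e" using R T v by auto
    have "T *\<^sub>v ?w = (T * R * T) *\<^sub>v v"
      unfolding assoc_mult_mat[OF T R T]
      by (rule assoc_mult_mat_vec[OF T mult_carrier_mat[OF R T] v, symmetric])
    also have "\<dots> = T *\<^sub>v v" using T by (simp add: TR)
    finally have "T *\<^sub>v (?w - v) = 0\<^sub>v d"
      using T v w by (simp add: mult_minus_distrib_mat_vec) 
    then have "?w - v = 0\<^sub>v e" using inj v w by auto
    then have "?w = v" using v w
      by (metis carrier_vecD eq_vecI index_minus_vec(1) index_zero_vec(1) eq_iff_diff_eq_0)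
    then show "?w = 1\<^sub>m e *\<^sub>v v" using v by simp
  qed (use R T in auto)
  have "(\<Sum>i<d. (T * R) $$ (i, i)) = (\<Sum>i<d. \<Sum>j<e. T $$ (i, j) * R $$ (j, i))"
    by (intro sum.cong refl index_mult_mat_sum[OF T R]) auto
  also have "\<dots> = (\<Sum>j<e. (R * T) $$ (j, j))"
    by (subst sum.swap) (auto simp: mult.commute index_mult_mat_sum[OF R T] simp del: index_mult_mat intro!: sum.cong)
  finally show de: "d = e" by (simp add: TR RT)
  show "invertible_mat T"
    using T R TR RT de invertible_mat_iff_inverse[of T d] by blast
qed

lemma schur_inequivalent:
  assumes "unitary_rep G d \<phi>" "unitary_rep G e \<psi>" "irreducible_rep G d \<phi>" "irreducible_rep G e \<psi>"
    and T: "intertwiner G d \<phi> e \<psi> T" and "\<not> equivalent_reps G e \<psi> d \<phi>"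
  shows "T = 0\<^sub>m d e"
proof (rule ccontr)
  assume nz: "T \<noteq> 0\<^sub>m d e"
  have Tc: "T \<in> carrier_mat d e" using T by (simp add: intertwiner_def)
  have "d = e" "invertible_mat T"
    using bijective_mat_square[OF Tc] intertwiner_kernel[OF assms(1,2,4) T]
      intertwiner_range[OF assms(1,2,3) T] nz by blast+
  then have "equivalent_reps G e \<psi> d \<phi>"
    using T unfolding equivalent_reps_def intertwiner_def by (auto intro!: bexI[of _ T])
  with assms(6) show False by blast
qed

text \<open>Over the complex numbers \<open>T\<close> has an eigenvalue \<open>c\<close>. Then
  \<open>T - c\<close> is again an intertwiner and kills an eigenvector, so the kernel alternative
  leaves only \<open>T - c = 0\<close>.\<close>

lemma schur_scalar:
  assumes "unitary_rep G d \<phi>" "irreducible_rep G d \<phi>" and T: "intertwiner G d \<phi> d \<phi> T"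
  obtains c where "T = c \<cdot>\<^sub>m 1\<^sub>m d"
proof -
  have Tc: "T \<in> carrier_mat d d" using T by (simp add: intertwiner_def)
  have "d > 0" using assms(2) by (simp add: irreducible_rep_def)
  then obtain c where "eigenvalue T c"
    using spectrum_non_empty[OF Tc] by (auto simp: spectrum_def)
  then obtain v where v: "v \<in> carrier_vec d" "v \<noteq> 0\<^sub>v d" "T *\<^sub>v v = c \<cdot>\<^sub>v v"
    using Tc by (auto simp: eigenvalue_def eigenvector_def)
  let ?S = "T - c \<cdot>\<^sub>m 1\<^sub>m d"
  have "\<phi> x * ?S = ?S * \<phi> x" if x: "x \<in> carrier G" for x
  proof -
    have c: "\<phi> x \<in> carrier_mat d d" "c \<cdot>\<^sub>m 1\<^sub>m d \<in> carrier_mat d d"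
      using unitary_rep_carrier[OF assms(1) x] by auto
    have "\<phi> x * ?S = \<phi> x * T - c \<cdot>\<^sub>m \<phi> x"
      using c mult_smult_distrib[OF c(1), of "1\<^sub>m d" d c]
      by (simp add: mult_minus_distrib_mat[OF c(1) Tc c(2)])
    moreover have "?S * \<phi> x = T * \<phi> x - c \<cdot>\<^sub>m \<phi> x"
      using c mult_smult_assoc_mat[OF one_carrier_mat c(1), of c]
      by (simp add: minus_mult_distrib_mat[OF Tc c(2) c(1)])
    ultimately show ?thesis using T x by (simp add: intertwiner_def)
  qed
  then have "intertwiner G d \<phi> d \<phi> ?S"
    by (auto simp: intertwiner_def intro!: minus_carrier_mat)
  moreover have "?S *\<^sub>v v = 0\<^sub>v d"
  proof -
    have "?S *\<^sub>v v = T *\<^sub>v v - (c \<cdot>\<^sub>m 1\<^sub>m d) *\<^sub>v v"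
      by (rule minus_mult_distrib_mat_vec[OF Tc _ v(1)]) simp
    also have "(c \<cdot>\<^sub>m 1\<^sub>m d) *\<^sub>v v = c \<cdot>\<^sub>v v"
      using v(1) by (intro eq_vecI) auto
    finally show ?thesis using v by simp
  qed
  ultimately have S: "?S = 0\<^sub>m d d"
    using intertwiner_kernel[OF assms(1,1,2)] v by blast
  have "T = c \<cdot>\<^sub>m 1\<^sub>m d"
  proof (rule eq_matI)
    fix i j assume "i < dim_row (c \<cdot>\<^sub>m 1\<^sub>m d)" "j < dim_col (c \<cdot>\<^sub>m 1\<^sub>m d)"
    then have ij: "i < d" "j < d" by auto
    then have "?S $$ (i, j) = 0" by (simp only: S index_zero_mat)
    moreover have "?S $$ (i, j) = T $$ (i, j) - (c \<cdot>\<^sub>m 1\<^sub>m d) $$ (i, j)"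
      using ij by (intro index_minus_mat) auto
    ultimately show "T $$ (i, j) = (c \<cdot>\<^sub>m 1\<^sub>m d) $$ (i, j)"
      by (simp only: right_minus_eq)
  qed (use Tc in auto)
  then show ?thesis by (rule that)
qed

section \<open>Averaging over a finite group and the orthogonality relations\<close>

locale finite_group = group G for G (structure) +
  assumes finite_carrier [simp]: "finite (carrier G)"
begin

text \<open>An invertible idempotent is the identity.\<close>

lemma unitary_rep_one:
  assumes "unitary_rep G d \<phi>"
  shows "\<phi> \<one> = 1\<^sub>m d"
proof -
  have U: "unitary_mat d (\<phi> \<one>)" using assms by (simp add: unitary_rep_def)
  then have c: "\<phi> \<one> \<in> carrier_mat d d" "mat_adjoint (\<phi> \<one>) \<in> carrier_mat d d"
    by (auto simp: unitary_mat_def mat_adjoint_carrier)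
  have "\<phi> \<one> * \<phi> \<one> = \<phi> \<one>" using unitary_rep_mult[OF assms, of \<one> \<one>] by simp
  then have "mat_adjoint (\<phi> \<one>) * (\<phi> \<one> * \<phi> \<one>) = mat_adjoint (\<phi> \<one>) * \<phi> \<one>" by simp
  then have "(mat_adjoint (\<phi> \<one>) * \<phi> \<one>) * \<phi> \<one> = mat_adjoint (\<phi> \<one>) * \<phi> \<one>"
    by (simp only: assoc_mult_mat[OF c(2) c(1) c(1)])
  moreover have "mat_adjoint (\<phi> \<one>) * \<phi> \<one> = 1\<^sub>m d" using U by (simp add: unitary_mat_def)
  ultimately show ?thesis using left_mult_one_mat[OF c(1)] by metis
qed

lemma unitary_rep_inv:
  assumes "unitary_rep G d \<phi>" "x \<in> carrier G"
  shows "\<phi> (inv x) = mat_adjoint (\<phi> x)"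
proof -
  have U: "unitary_mat d (\<phi> x)" using assms by (simp add: unitary_rep_def)
  then have c: "\<phi> x \<in> carrier_mat d d" "mat_adjoint (\<phi> x) \<in> carrier_mat d d" "\<phi> (inv x) \<in> carrier_mat d d"
    using unitary_rep_carrier[OF assms(1)] assms(2) by (auto simp: unitary_mat_def mat_adjoint_carrier)
  have "\<phi> (inv x) * \<phi> x = 1\<^sub>m d"
    using unitary_rep_mult[OF assms(1), of "inv x" x] assms unitary_rep_one by simp
  then have "\<phi> (inv x) * (\<phi> x * mat_adjoint (\<phi> x)) = mat_adjoint (\<phi> x)"
    by (simp only: assoc_mult_mat[OF c(3) c(1) c(2), symmetric] left_mult_one_mat[OF c(2)])
  moreover have "\<phi> x * mat_adjoint (\<phi> x) = 1\<^sub>m d" using U by (simp add: unitary_mat_def)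
  ultimately show ?thesis using right_mult_one_mat[OF c(3)] by metis
qed

lemma unitary_rep_inv_index:
  assumes "unitary_rep G d \<phi>" "x \<in> carrier G" "i < d" "j < d"
  shows "\<phi> (inv x) $$ (i, j) = cnj (\<phi> x $$ (j, i))"
  using assms(3,4) unitary_rep_carrier[OF assms(1,2)]
  by (simp add: unitary_rep_inv[OF assms(1,2)] mat_adjoint_conv)

text \<open>Averaging forces an arbitrary \<open>E\<close> to become an intertwiner. The division by
  the group order is left out.\<close>

definition average_mat ::
  "nat \<Rightarrow> ('a \<Rightarrow> complex mat) \<Rightarrow> nat \<Rightarrow> ('a \<Rightarrow> complex mat) \<Rightarrow> complex mat \<Rightarrow> complex mat" where
  "average_mat d \<phi> e \<psi> E =
     mat d e (\<lambda>(i, j). \<Sum>x\<in>carrier G. (\<phi> x * E * \<psi> (inv x)) $$ (i, j))"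

lemma sum_translate:
  assumes "y \<in> carrier G"
  shows "(\<Sum>x\<in>carrier G. f (y \<otimes> x)) = (\<Sum>x\<in>carrier G. f x)"
proof -
  have "inv y \<otimes> (y \<otimes> x) = x" "y \<otimes> (inv y \<otimes> x) = x" if "x \<in> carrier G" for x
    using assms that by (simp_all only: m_assoc[symmetric] l_inv r_inv l_one inv_closed)
  then show ?thesis
    using assms by (intro sum.reindex_bij_witness[of _ "\<lambda>x. inv y \<otimes> x" "\<lambda>x. y \<otimes> x"]) auto
qed

text \<open>Replacing \<open>x\<close> by \<open>y \<otimes> x\<close> absorbs
  \<open>\<phi> y\<close> on the left, and
  \<open>\<psi> (inv (y \<otimes> x)) * \<psi> y = \<psi> (inv x)\<close> makes
  \<open>\<psi> y\<close> appear on the right.\<close>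

lemma intertwiner_average_mat:
  assumes \<phi>: "unitary_rep G d \<phi>" and \<psi>: "unitary_rep G e \<psi>" and E: "E \<in> carrier_mat d e"
  shows "intertwiner G d \<phi> e \<psi> (average_mat d \<phi> e \<psi> E)"
  unfolding intertwiner_def
proof (intro conjI ballI)
  show T: "average_mat d \<phi> e \<psi> E \<in> carrier_mat d e" by (simp add: average_mat_def)
  fix y assume y: "y \<in> carrier G"
  note c = unitary_rep_carrier[OF \<phi>] unitary_rep_carrier[OF \<psi>]
  have c3: "\<phi> x * E * \<psi> z \<in> carrier_mat d e" if "x \<in> carrier G" "z \<in> carrier G" for x z
    using c that E by (meson mult_carrier_mat)
  show "\<phi> y * average_mat d \<phi> e \<psi> E = average_mat d \<phi> e \<psi> E * \<psi> y"
  proof (rule eq_matI)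
    fix i j
    assume "i < dim_row (average_mat d \<phi> e \<psi> E * \<psi> y)" "j < dim_col (average_mat d \<phi> e \<psi> E * \<psi> y)"
    then have ij: "i < d" "j < e" using T c y by auto
    have "(\<phi> y * average_mat d \<phi> e \<psi> E) $$ (i, j) =
        (\<Sum>k<d. \<phi> y $$ (i, k) * (\<Sum>x\<in>carrier G. (\<phi> x * E * \<psi> (inv x)) $$ (k, j)))"
      using ij by (subst index_mult_mat_sum[OF c(1)[OF y] T]) (auto simp: average_mat_def)
    also have "\<dots> = (\<Sum>x\<in>carrier G. \<Sum>k<d. \<phi> y $$ (i, k) * (\<phi> x * E * \<psi> (inv x)) $$ (k, j))"
      by (simp only: sum_distrib_left) (rule sum.swap)
    also have "\<dots> = (\<Sum>x\<in>carrier G. (\<phi> y * (\<phi> x * E * \<psi> (inv x))) $$ (i, j))"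
      using ij y by (intro sum.cong refl index_mult_mat_sum[symmetric, OF c(1) c3]) auto
    also have "\<dots> = (\<Sum>x\<in>carrier G. ((\<phi> (y \<otimes> x) * E * \<psi> (inv (y \<otimes> x))) * \<psi> y) $$ (i, j))"
    proof (rule sum.cong[OF refl])
      fix x assume x: "x \<in> carrier G"
      have "inv (y \<otimes> x) \<otimes> y = inv x"
        using x y by (simp add: inv_mult_group m_assoc)
      then have "\<psi> (inv (y \<otimes> x)) * \<psi> y = \<psi> (inv x)"
        using unitary_rep_mult[OF \<psi>, of "inv (y \<otimes> x)" y] x y by simp
      then have "(\<phi> (y \<otimes> x) * E * \<psi> (inv (y \<otimes> x))) * \<psi> y = \<phi> (y \<otimes> x) * E * \<psi> (inv x)"
        using c x y assoc_mult_mat[of "\<phi> (y \<otimes> x) * E" d e "\<psi> (inv (y \<otimes> x))" e "\<psi> y" e]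
          mult_carrier_mat[OF c(1)[of "y \<otimes> x"] E] by simp
      also have "\<dots> = \<phi> y * (\<phi> x * E * \<psi> (inv x))"
      proof -
        have "\<phi> y * (\<phi> x * E * \<psi> (inv x)) = (\<phi> y * (\<phi> x * E)) * \<psi> (inv x)"
          using c x y mult_carrier_mat[OF c(1)[OF x] E]
            assoc_mult_mat[of "\<phi> y" d d "\<phi> x * E" e "\<psi> (inv x)" e] by simp
        also have "\<phi> y * (\<phi> x * E) = \<phi> (y \<otimes> x) * E"
          using unitary_rep_mult[OF \<phi> y x] assoc_mult_mat[OF c(1)[OF y] c(1)[OF x] E] by simp
        finally show ?thesis ..
      qed
      finally show "(\<phi> y * (\<phi> x * E * \<psi> (inv x))) $$ (i, j) =
          ((\<phi> (y \<otimes> x) * E * \<psi> (inv (y \<otimes> x))) * \<psi> y) $$ (i, j)" by simp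
    qed
    also have "\<dots> = (\<Sum>x\<in>carrier G. ((\<phi> x * E * \<psi> (inv x)) * \<psi> y) $$ (i, j))"
      by (rule sum_translate[OF y])
    also have "\<dots> = (\<Sum>x\<in>carrier G. \<Sum>k<e. (\<phi> x * E * \<psi> (inv x)) $$ (i, k) * \<psi> y $$ (k, j))"
      using ij y by (intro sum.cong refl index_mult_mat_sum[OF c3 c(2)]) auto
    also have "\<dots> = (\<Sum>k<e. (\<Sum>x\<in>carrier G. (\<phi> x * E * \<psi> (inv x)) $$ (i, k)) * \<psi> y $$ (k, j))"
      by (simp only: sum_distrib_right) (rule sum.swap)
    also have "\<dots> = (average_mat d \<phi> e \<psi> E * \<psi> y) $$ (i, j)"
      using ij by (subst index_mult_mat_sum[OF T c(2)[OF y]]) (auto simp: average_mat_def)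
    finally show "(\<phi> y * average_mat d \<phi> e \<psi> E) $$ (i, j) = (average_mat d \<phi> e \<psi> E * \<psi> y) $$ (i, j)" .
  qed (use T c y in auto)
qed

definition matrix_unit :: "nat \<Rightarrow> nat \<Rightarrow> nat \<Rightarrow> nat \<Rightarrow> complex mat" where
  "matrix_unit d e q q' = mat d e (\<lambda>(i, j). if i = q \<and> j = q' then 1 else 0)"

text \<open>A matrix unit between \<open>\<phi> x\<close> and \<open>\<psi> (inv x)\<close> selects
  one entry of each, and unitarity turns the second into a conjugate. The sums of the orthogonality
  relations are thus entries of intertwiners.\<close>

lemma average_matrix_unit:
  assumes \<phi>: "unitary_rep G d \<phi>" and \<psi>: "unitary_rep G e \<psi>"
    and i: "p < d" "q < d" "p' < e" "q' < e"
  shows "average_mat d \<phi> e \<psi> (matrix_unit d e q q') $$ (p, p') =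
    (\<Sum>x\<in>carrier G. \<phi> x $$ (p, q) * cnj (\<psi> x $$ (p', q')))"
proof -
  let ?E = "matrix_unit d e q q'"
  have E: "?E \<in> carrier_mat d e" by (simp add: matrix_unit_def)
  have "(\<phi> x * ?E * \<psi> (inv x)) $$ (p, p') = \<phi> x $$ (p, q) * cnj (\<psi> x $$ (p', q'))"
    if x: "x \<in> carrier G" for x
  proof -
    have c: "\<phi> x \<in> carrier_mat d d" "\<psi> (inv x) \<in> carrier_mat e e"
      using unitary_rep_carrier[OF \<phi>] unitary_rep_carrier[OF \<psi>] x by auto
    have E1: "(\<phi> x * ?E) $$ (p, j) = (if j = q' then \<phi> x $$ (p, q) else 0)" if "j < e" for j
    proof -
      have "(\<phi> x * ?E) $$ (p, j) = (\<Sum>k<d. \<phi> x $$ (p, k) * (if k = q \<and> j = q' then 1 else 0))"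
        using that i by (subst index_mult_mat_sum[OF c(1) E]) (auto simp: matrix_unit_def intro!: sum.cong)
      also have "\<dots> = (\<Sum>k<d. if k = q then (if j = q' then \<phi> x $$ (p, q) else 0) else 0)"
        by (intro sum.cong) auto
      finally show ?thesis using i by simp
    qed
    have "(\<phi> x * ?E * \<psi> (inv x)) $$ (p, p') =
        (\<Sum>j<e. (if j = q' then \<phi> x $$ (p, q) else 0) * \<psi> (inv x) $$ (j, p'))"
      using i E1 by (subst index_mult_mat_sum[OF mult_carrier_mat[OF c(1) E] c(2)]) (auto intro!: sum.cong)
    also have "\<dots> = (\<Sum>j<e. if j = q' then \<phi> x $$ (p, q) * \<psi> (inv x) $$ (q', p') else 0)"
      by (intro sum.cong) auto
    finally show ?thesis using i x unitary_rep_inv_index[OF \<psi>] by simp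
  qed
  then show ?thesis using i by (simp add: average_mat_def)
qed

lemma schur_orthogonality_inequivalent:
  assumes "unitary_rep G d \<phi>" "unitary_rep G e \<psi>" "irreducible_rep G d \<phi>" "irreducible_rep G e \<psi>"
    and "\<not> equivalent_reps G e \<psi> d \<phi>" and i: "p < d" "q < d" "p' < e" "q' < e"
  shows "(\<Sum>x\<in>carrier G. \<phi> x $$ (p, q) * cnj (\<psi> x $$ (p', q'))) = 0"
proof -
  have "average_mat d \<phi> e \<psi> (matrix_unit d e q q') = 0\<^sub>m d e"
    by (intro schur_inequivalent[OF assms(1-4) _ assms(5)] intertwiner_average_mat assms(1,2))
      (simp add: matrix_unit_def)
  then show ?thesis using average_matrix_unit[OF assms(1,2) i] i by simp
qed

text \<open>By Schur's lemma the averaged matrix unit is a scalar \<open>c\<close>, which settles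
  the case \<open>p \<noteq> p'\<close>. The value of \<open>c\<close> comes from its trace: the
  columns of each \<open>\<phi> x\<close> are orthonormal, so the trace \<open>d * c\<close> is the
  group order if \<open>q = q'\<close> and zero otherwise.\<close>

lemma schur_orthogonality:
  assumes \<phi>: "unitary_rep G d \<phi>" and irr: "irreducible_rep G d \<phi>"
    and i: "p < d" "q < d" "p' < d" "q' < d"
  shows "(\<Sum>x\<in>carrier G. \<phi> x $$ (p, q) * cnj (\<phi> x $$ (p', q'))) =
    (if p = p' \<and> q = q' then of_nat (order G) / of_nat d else 0)"
proof -
  have "matrix_unit d d q q' \<in> carrier_mat d d" by (simp add: matrix_unit_def)
  from intertwiner_average_mat[OF \<phi> \<phi> this]
  obtain c where c: "average_mat d \<phi> d \<phi> (matrix_unit d d q q') = c \<cdot>\<^sub>m 1\<^sub>m d"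
    by (rule schur_scalar[OF \<phi> irr])
  have val: "(\<Sum>x\<in>carrier G. \<phi> x $$ (r, q) * cnj (\<phi> x $$ (r', q'))) = (if r = r' then c else 0)"
    if "r < d" "r' < d" for r r'
    using average_matrix_unit[OF \<phi> \<phi> that(1) i(2) that(2) i(4), symmetric] that by (simp add: c)
  have col: "(\<Sum>r<d. \<phi> x $$ (r, q) * cnj (\<phi> x $$ (r, q'))) = (if q = q' then 1 else 0)"
    if x: "x \<in> carrier G" for x
  proof -
    have cx: "\<phi> x \<in> carrier_mat d d" and "mat_adjoint (\<phi> x) * \<phi> x = 1\<^sub>m d"
      using \<phi> x by (auto simp: unitary_rep_def unitary_mat_def)
    then have "(mat_adjoint (\<phi> x) * \<phi> x) $$ (q', q) = (if q = q' then 1 else 0)"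
      using i by simp
    then show ?thesis
      using i cx by (subst (asm) index_mult_mat_sum[OF mat_adjoint_carrier[OF cx] cx])
        (auto simp: mat_adjoint_conv mult.commute)
  qed
  have "of_nat d * c = (\<Sum>r<d. \<Sum>x\<in>carrier G. \<phi> x $$ (r, q) * cnj (\<phi> x $$ (r, q')))"
    by (simp add: val)
  also have "\<dots> = (\<Sum>x\<in>carrier G. \<Sum>r<d. \<phi> x $$ (r, q) * cnj (\<phi> x $$ (r, q')))"
    by (rule sum.swap)
  also have "\<dots> = (if q = q' then of_nat (order G) else 0)"
    by (simp add: col order_def)
  finally have "c = (if q = q' then of_nat (order G) / of_nat d else 0)"
    using i by (auto simp: field_simps)
  then show ?thesis using val[OF i(1,3)] by auto
qed

end

section \<open>Completeness of the irreducible representations\<close>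

lemma distinct_concat_map:
  assumes "distinct xs" "\<And>x. x \<in> set xs \<Longrightarrow> distinct (f x)"
    and "\<And>x y. x \<in> set xs \<Longrightarrow> y \<in> set xs \<Longrightarrow> x \<noteq> y \<Longrightarrow> set (f x) \<inter> set (f y) = {}"
  shows "distinct (concat (map f xs))"
  using assms
proof (induction xs)
  case (Cons x xs)
  have "set (f x) \<inter> set (f y) = {}" if "y \<in> set xs" for y
    using that Cons.prems by (intro Cons.prems(3)) auto
  with Cons show ?case by auto
qed simp

lemma set_coefficient_list:
  "set (coefficient_list s d) = (SIGMA k:{..<s}. {..<d k} \<times> {..<d k})"
  by (force simp: coefficient_list_def)

lemma distinct_coefficient_list: "distinct (coefficient_list s d)"
  unfolding coefficient_list_def
  by (intro distinct_concat_map) (auto simp: distinct_map inj_on_def)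

lemma length_coefficient_list: "length (coefficient_list s d) = (\<Sum>k<s. (d k)\<^sup>2)"
proof -
  have "length (coefficient_list s d) = card (set (coefficient_list s d))"
    by (rule distinct_card[symmetric, OF distinct_coefficient_list])
  then show ?thesis by (simp add: set_coefficient_list card_cartesian_product power2_eq_square)
qed

lemma sum_nth_distinct:
  assumes "distinct xs"
  shows "(\<Sum>r<length xs. f (xs ! r)) = (\<Sum>y\<in>set xs. f y)"
  using sum.distinct_set_conv_list[OF assms, of f]
  by (simp add: sum_list_sum_nth atLeast0LessThan)

lemma sum_coefficient_list:
  "(\<Sum>r<length (coefficient_list s d). f (coefficient_list s d ! r)) =
   (\<Sum>k<s. \<Sum>q<d k. \<Sum>p<d k. f (k, q, p))"
  unfolding sum_nth_distinct[OF distinct_coefficient_list] set_coefficient_list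
  using sum.Sigma[of "{..<s}" "\<lambda>k. {..<d k} \<times> {..<d k}" "\<lambda>k y. f (k, y)"]
  by (simp add: sum.cartesian_product case_prod_eta[unfolded split_def] split_def)

text \<open>Where orthonormal rows become orthonormal columns: a one-sided inverse of a square
  matrix is two-sided.\<close>

lemma unitary_matI:
  assumes "U \<in> carrier_mat d d" "U * mat_adjoint U = 1\<^sub>m d"
  shows "unitary_mat d U"
  using assms mat_mult_left_right_inverse[OF assms(1) mat_adjoint_carrier[OF assms(1)] assms(2)]
  by (simp add: unitary_mat_def)

lemma index_mult_adjoint:
  assumes "A \<in> carrier_mat n m" "B \<in> carrier_mat l m" "i < n" "j < l"
  shows "(A * mat_adjoint B) $$ (i, j) = (\<Sum>c<m. A $$ (i, c) * cnj (B $$ (j, c)))"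
  using assms
  by (subst index_mult_mat_sum[OF assms(1) mat_adjoint_carrier[OF assms(2)]])
    (auto simp: mat_adjoint_conv)

lemma index_adjoint_mult:
  assumes "A \<in> carrier_mat m n" "B \<in> carrier_mat m l" "i < n" "j < l"
  shows "(mat_adjoint A * B) $$ (i, j) = (\<Sum>c<m. cnj (A $$ (c, i)) * B $$ (c, j))"
  using assms
  by (subst index_mult_mat_sum[OF mat_adjoint_carrier[OF assms(1)] assms(2)])
    (auto simp: mat_adjoint_conv)

section \<open>Characters and class functions\<close>

definition character :: "nat \<Rightarrow> ('g \<Rightarrow> complex mat) \<Rightarrow> 'g \<Rightarrow> complex" where
  "character d \<phi> x = (\<Sum>p<d. \<phi> x $$ (p, p))"

context finite_group
begin

lemma order_pos: "0 < order G"
  by (simp add: order_gt_0_iff_finite)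

lemma character_one: "unitary_rep G d \<phi> \<Longrightarrow> character d \<phi> \<one> = of_nat d"
  by (simp add: character_def unitary_rep_one)

text \<open>Cyclicity of the trace for the factors \<open>\<phi> h\<close> and
  \<open>\<phi> (x \<otimes> inv h)\<close>.\<close>

lemma character_conjugate:
  assumes \<phi>: "unitary_rep G d \<phi>" and x: "x \<in> carrier G" and h: "h \<in> carrier G"
  shows "character d \<phi> (h \<otimes> x \<otimes> inv h) = character d \<phi> x"
proof -
  note c = unitary_rep_carrier[OF \<phi>]
  have 1: "\<phi> (h \<otimes> x \<otimes> inv h) = \<phi> h * \<phi> (x \<otimes> inv h)"
    using unitary_rep_mult[OF \<phi> h, of "x \<otimes> inv h"] x h by (simp add: m_assoc)
  have 2: "\<phi> (x \<otimes> inv h) * \<phi> h = \<phi> x"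
    using unitary_rep_mult[OF \<phi> _ h, of "x \<otimes> inv h"] x h by (simp add: m_assoc)
  have "character d \<phi> (h \<otimes> x \<otimes> inv h) =
      (\<Sum>p<d. \<Sum>k<d. \<phi> h $$ (p, k) * \<phi> (x \<otimes> inv h) $$ (k, p))"
    unfolding character_def 1 using x h by (intro sum.cong refl index_mult_mat_sum[OF c c]) auto
  also have "\<dots> = (\<Sum>k<d. \<Sum>p<d. \<phi> (x \<otimes> inv h) $$ (k, p) * \<phi> h $$ (p, k))"
    by (subst sum.swap) (simp only: mult.commute)
  also have "\<dots> = (\<Sum>k<d. (\<phi> (x \<otimes> inv h) * \<phi> h) $$ (k, k))"
    using x h by (intro sum.cong refl index_mult_mat_sum[OF c c, symmetric]) auto
  finally show ?thesis by (simp add: 2 character_def)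
qed

lemma character_sum_expand:
  "(\<Sum>x\<in>carrier G. character d \<phi> x * cnj (character e \<psi> x)) =
   (\<Sum>p<d. \<Sum>q<e. \<Sum>x\<in>carrier G. \<phi> x $$ (p, p) * cnj (\<psi> x $$ (q, q)))"
proof -
  have "(\<Sum>x\<in>carrier G. character d \<phi> x * cnj (character e \<psi> x)) =
      (\<Sum>x\<in>carrier G. \<Sum>p<d. \<Sum>q<e. \<phi> x $$ (p, p) * cnj (\<psi> x $$ (q, q)))"
    by (simp add: character_def sum_product)
  also have "\<dots> = (\<Sum>p<d. \<Sum>x\<in>carrier G. \<Sum>q<e. \<phi> x $$ (p, p) * cnj (\<psi> x $$ (q, q)))"
    by (rule sum.swap)
  also have "\<dots> = (\<Sum>p<d. \<Sum>q<e. \<Sum>x\<in>carrier G. \<phi> x $$ (p, p) * cnj (\<psi> x $$ (q, q)))"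
    by (intro sum.cong refl sum.swap)
  finally show ?thesis .
qed

lemma orbit_conjugation_eq:
  assumes x: "x \<in> carrier G" and y: "y \<in> orbit G (\<lambda>h x. h \<otimes> x \<otimes> inv h) x"
  shows "orbit G (\<lambda>h x. h \<otimes> x \<otimes> inv h) y = orbit G (\<lambda>h x. h \<otimes> x \<otimes> inv h) x"
proof -
  obtain h where h: "h \<in> carrier G" "y = h \<otimes> x \<otimes> inv h" using y by (auto simp: orbit_def)
  have 1: "k \<otimes> y \<otimes> inv k = (k \<otimes> h) \<otimes> x \<otimes> inv (k \<otimes> h)" if "k \<in> carrier G" for k
    using that h x by (simp add: inv_mult_group m_assoc)
  have 2: "k \<otimes> x \<otimes> inv k = (k \<otimes> inv h) \<otimes> y \<otimes> inv (k \<otimes> inv h)" if k: "k \<in> carrier G" for k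
    using k h x 1[of "k \<otimes> inv h"] by (simp add: m_assoc)
  show ?thesis
  proof (intro equalityI subsetI)
    fix z assume "z \<in> orbit G (\<lambda>h x. h \<otimes> x \<otimes> inv h) y"
    then obtain k where k: "k \<in> carrier G" "z = k \<otimes> y \<otimes> inv k" unfolding orbit_def by blast
    have "k \<otimes> h \<in> carrier G" using k h by simp
    then show "z \<in> orbit G (\<lambda>h x. h \<otimes> x \<otimes> inv h) x"
      unfolding orbit_def using k(2) 1[OF k(1)] by blast
  next
    fix z assume "z \<in> orbit G (\<lambda>h x. h \<otimes> x \<otimes> inv h) x"
    then obtain k where k: "k \<in> carrier G" "z = k \<otimes> x \<otimes> inv k" unfolding orbit_def by blast
    have "k \<otimes> inv h \<in> carrier G" using k h by simp
    then show "z \<in> orbit G (\<lambda>h x. h \<otimes> x \<otimes> inv h) y"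
      unfolding orbit_def using k(2) 2[OF k(1)] by blast
  qed
qed

lemma conjugacy_classes_partition:
  "\<Union>(conjugacy_classes G) = carrier G"
  "A \<in> conjugacy_classes G \<Longrightarrow> B \<in> conjugacy_classes G \<Longrightarrow> A \<noteq> B \<Longrightarrow> A \<inter> B = {}"
  "A \<in> conjugacy_classes G \<Longrightarrow> A \<noteq> {}"
  "{\<one>} \<in> conjugacy_classes G"
proof -
  let ?o = "orbit G (\<lambda>h x. h \<otimes> x \<otimes> inv h)"
  have refl: "x \<in> ?o x" if "x \<in> carrier G" for x
    using that by (auto simp: orbit_def intro!: exI[of _ \<one>])
  have sub: "?o x \<subseteq> carrier G" if "x \<in> carrier G" for x
    using that by (auto simp: orbit_def)
  show "\<Union>(conjugacy_classes G) = carrier G"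
    using refl sub by (fastforce simp: conjugacy_classes_def orbits_def)
  show "A \<noteq> {}" if "A \<in> conjugacy_classes G"
    using that refl by (auto simp: conjugacy_classes_def orbits_def)
  show "A \<inter> B = {}" if AB: "A \<in> conjugacy_classes G" "B \<in> conjugacy_classes G" "A \<noteq> B"
  proof (rule ccontr)
    assume "A \<inter> B \<noteq> {}"
    then obtain z where z: "z \<in> A" "z \<in> B" by blast
    obtain a where a: "a \<in> carrier G" "A = ?o a"
      using AB(1) unfolding conjugacy_classes_def orbits_def by blast
    obtain b where b: "b \<in> carrier G" "B = ?o b"
      using AB(2) unfolding conjugacy_classes_def orbits_def by blast
    have "?o z = A" unfolding a(2) by (rule orbit_conjugation_eq[OF a(1) z(1)[unfolded a(2)]])
    moreover have "?o z = B" unfolding b(2) by (rule orbit_conjugation_eq[OF b(1) z(2)[unfolded b(2)]])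
    ultimately show False using AB(3) by simp
  qed
  have "?o \<one> \<subseteq> {\<one>}" by (auto simp: orbit_def)
  with refl[OF one_closed] have "{\<one>} = ?o \<one>" by blast
  then show "{\<one>} \<in> conjugacy_classes G"
    unfolding conjugacy_classes_def orbits_def using one_closed by blast
qed

lemma finite_conjugacy_classes: "finite (conjugacy_classes G)"
  by (rule finite_UnionD) (simp add: conjugacy_classes_partition(1))

text \<open>The factor \<open>card C\<close> is the source of the weights in
  \<open>sum_degrees_squared\<close>. The representative chosen by \<open>SOME\<close> does not
  matter, because \<open>f\<close> is constant on each class.\<close>

lemma sum_class_function:
  fixes f :: "'a \<Rightarrow> complex"
  assumes "\<And>h x. h \<in> carrier G \<Longrightarrow> x \<in> carrier G \<Longrightarrow> f (h \<otimes> x \<otimes> inv h) = f x"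
  shows "(\<Sum>x\<in>carrier G. f x) = (\<Sum>C\<in>conjugacy_classes G. of_nat (card C) * f (SOME x. x \<in> C))"
proof -
  have fin: "finite C" if "C \<in> conjugacy_classes G" for C
    by (rule finite_subset[of _ "carrier G"]) (use that conjugacy_classes_partition(1) in auto)
  have const: "f x = f (SOME x. x \<in> C)" if C: "C \<in> conjugacy_classes G" and x: "x \<in> C" for x C
  proof -
    have "(SOME x. x \<in> C) \<in> C" using x by (rule someI)
    moreover obtain z where z: "z \<in> carrier G" "C = orbit G (\<lambda>h x. h \<otimes> x \<otimes> inv h) z"
      using C unfolding conjugacy_classes_def orbits_def by blast
    have "f y = f z" if "y \<in> C" for y
      using that assms[OF _ z(1)] unfolding z(2) orbit_def by auto
    ultimately show ?thesis using x by simp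
  qed
  have "(\<Sum>x\<in>\<Union>(conjugacy_classes G). f x) = (\<Sum>C\<in>conjugacy_classes G. \<Sum>x\<in>C. f x)"
    using fin conjugacy_classes_partition(2) sum.Union_disjoint[of "conjugacy_classes G" f]
    by (simp add: comp_def)
  also have "\<dots> = (\<Sum>C\<in>conjugacy_classes G. \<Sum>x\<in>C. f (SOME x. x \<in> C))"
    by (intro sum.cong refl const)
  finally show ?thesis by (simp add: conjugacy_classes_partition(1))
qed

end

section \<open>Systems with as many representations as conjugacy classes\<close>

locale irreducible_family = finite_group +
  fixes s :: nat and d :: "nat \<Rightarrow> nat" and \<phi> :: "nat \<Rightarrow> 'a \<Rightarrow> complex mat"
  assumes family: "irreducible_system G s d \<phi>"
begin

lemma rep: "k < s \<Longrightarrow> unitary_rep G (d k) (\<phi> k)"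
  and irr: "k < s \<Longrightarrow> irreducible_rep G (d k) (\<phi> k)"
  and inequiv: "j < s \<Longrightarrow> k < s \<Longrightarrow> j \<noteq> k \<Longrightarrow> \<not> equivalent_reps G (d j) (\<phi> j) (d k) (\<phi> k)"
  and card_classes: "card (conjugacy_classes G) = s"
  using family by (auto simp: irreducible_system_def)

lemma degree_pos: "k < s \<Longrightarrow> 0 < d k"
  using irr by (auto simp: irreducible_rep_def)

lemma coefficient_orthogonality:
  assumes "j < s" "k < s" "p < d j" "q < d j" "p' < d k" "q' < d k"
  shows "(\<Sum>x\<in>carrier G. \<phi> j x $$ (p, q) * cnj (\<phi> k x $$ (p', q'))) =
    (if j = k \<and> p = p' \<and> q = q' then of_nat (order G) / of_nat (d k) else 0)"
proof (cases "j = k")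
  case True
  then show ?thesis using assms schur_orthogonality[OF rep irr] by simp
next
  case False
  then show ?thesis
    using assms schur_orthogonality_inequivalent[OF rep rep irr irr] inequiv[of k j] by simp
qed

lemma character_orthogonality:
  assumes "j < s" "k < s"
  shows "(\<Sum>x\<in>carrier G. character (d j) (\<phi> j) x * cnj (character (d k) (\<phi> k) x)) =
    (if j = k then of_nat (order G) else 0)"
proof -
  have "(\<Sum>x\<in>carrier G. character (d j) (\<phi> j) x * cnj (character (d k) (\<phi> k) x)) =
      (\<Sum>p<d j. \<Sum>q<d k. if j = k \<and> p = q then of_nat (order G) / of_nat (d k) else 0)"
    unfolding character_sum_expand using assms
    by (intro sum.cong refl) (simp add: coefficient_orthogonality)
  also have "\<dots> = (if j = k then of_nat (order G) else 0)"
    using degree_pos[OF assms(2)] by (auto simp: sum.delta)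
  finally show ?thesis .
qed

text \<open>The normalized characters of the \<open>s\<close> representations form the rows of a square matrix with
  orthonormal rows, because the number of classes is also \<open>s\<close>. Hence its columns are orthonormal;
  the column of the unit element gives the claim.\<close>

theorem sum_degrees_squared: "(\<Sum>k<s. (d k)\<^sup>2) = order G"
proof -
  let ?\<chi> = "\<lambda>k. character (d k) (\<phi> k)"
  let ?n = "order G"
  obtain C where C: "bij_betw C {0..<s} (conjugacy_classes G)"
    using ex_bij_betw_nat_finite[OF finite_conjugacy_classes] card_classes by auto
  define r where "r c = (SOME x. x \<in> C c)" for c
  \<comment> \<open>The squares of these weights are \<open>card (C c) / n\<close>, so that the
    products of the rows of \<open>M\<close> are averages over \<open>G\<close> of products of
    characters.\<close>
  define w where "w c = complex_of_real (sqrt (card (C c) / ?n))" for c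
  have ww: "w c * cnj (w c) = of_nat (card (C c)) / of_nat ?n" for c
    by (simp add: w_def flip: of_real_mult)
  define M where "M = mat s s (\<lambda>(k, c). w c * ?\<chi> k (r c))"
  have M: "M \<in> carrier_mat s s" by (simp add: M_def)
  have "M * mat_adjoint M = 1\<^sub>m s"
  proof (rule eq_matI)
    fix j k assume "j < dim_row (1\<^sub>m s :: complex mat)" "k < dim_col (1\<^sub>m s :: complex mat)"
    then have jk: "j < s" "k < s" by auto
    have "(M * mat_adjoint M) $$ (j, k) = (\<Sum>c<s. M $$ (j, c) * cnj (M $$ (k, c)))"
      by (rule index_mult_adjoint[OF M M jk])
    also have "\<dots> = (\<Sum>c<s. of_nat (card (C c)) * (?\<chi> j (r c) * cnj (?\<chi> k (r c)))) / of_nat ?n"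
      unfolding sum_divide_distrib
    proof (intro sum.cong refl)
      fix c assume "c \<in> {..<s}"
      then have "M $$ (j, c) * cnj (M $$ (k, c)) = (w c * cnj (w c)) * (?\<chi> j (r c) * cnj (?\<chi> k (r c)))"
        using jk by (simp add: M_def)
      then show "M $$ (j, c) * cnj (M $$ (k, c)) =
          of_nat (card (C c)) * (?\<chi> j (r c) * cnj (?\<chi> k (r c))) / of_nat ?n"
        unfolding ww by simp
    qed
    also have "(\<Sum>c<s. of_nat (card (C c)) * (?\<chi> j (r c) * cnj (?\<chi> k (r c)))) =
        (\<Sum>D\<in>conjugacy_classes G. of_nat (card D) *
          (?\<chi> j (SOME x. x \<in> D) * cnj (?\<chi> k (SOME x. x \<in> D))))"
      unfolding r_def atLeast0LessThan[symmetric]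
      by (rule sum.reindex_bij_betw[OF C])
    also have "\<dots> = (\<Sum>x\<in>carrier G. ?\<chi> j x * cnj (?\<chi> k x))"
      using jk by (intro sum_class_function[symmetric]) (simp add: character_conjugate[OF rep])
    also have "\<dots> / of_nat ?n = (if j = k then 1 else 0)"
      using jk order_pos by (simp add: character_orthogonality)
    finally show "(M * mat_adjoint M) $$ (j, k) = 1\<^sub>m s $$ (j, k)" using jk by simp
  qed (use M mat_adjoint_carrier[OF M] in auto)
  then have XX: "mat_adjoint M * M = 1\<^sub>m s"
    using unitary_matI[OF M] by (simp add: unitary_mat_def)
  \<comment> \<open>For the class of the unit element the squared weight is \<open>1 / n\<close> and
    the characters are the degrees; the norm of its column is one.\<close>
  have "{\<one>} \<in> C ` {0..<s}"
    using C conjugacy_classes_partition(4) by (simp add: bij_betw_def)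
  then obtain c where c: "c < s" "C c = {\<one>}" by auto
  have "w c * cnj (w c) = 1 / of_nat ?n" by (simp add: ww c)
  have "(1::complex) = (mat_adjoint M * M) $$ (c, c)" using c by (simp add: XX)
  also have "\<dots> = (\<Sum>k<s. cnj (M $$ (k, c)) * M $$ (k, c))"
    by (rule index_adjoint_mult[OF M M c(1) c(1)])
  also have "\<dots> = (\<Sum>k<s. (w c * cnj (w c)) * of_nat ((d k)\<^sup>2))"
  proof (intro sum.cong refl)
    fix k assume k: "k \<in> {..<s}"
    then have "?\<chi> k (r c) = of_nat (d k)"
      using c character_one[OF rep] by (simp add: r_def)
    then show "cnj (M $$ (k, c)) * M $$ (k, c) = (w c * cnj (w c)) * of_nat ((d k)\<^sup>2)"
      using c(1) k by (simp add: M_def power2_eq_square)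
  qed
  also have "\<dots> = of_nat (\<Sum>k<s. (d k)\<^sup>2) / of_nat ?n"
    unfolding \<open>w c * cnj (w c) = 1 / of_nat ?n\<close> by (simp add: sum_divide_distrib)
  finally have "of_nat (\<Sum>k<s. (d k)\<^sup>2) = (of_nat ?n :: complex)"
    using order_pos by (simp add: field_simps)
  then show ?thesis by (rule of_nat_eq_iff[THEN iffD1])
qed

section \<open>The Fourier matrix\<close>

lemma fourier_matrix_carrier:
  "n = order G \<Longrightarrow> fourier_matrix n g s d \<phi> \<in> carrier_mat n n"
  by (simp add: fourier_matrix_def length_coefficient_list sum_degrees_squared)

lemma fourier_matrix_index:
  assumes "n = order G" "r < n" "c < n" "coefficient_list s d ! r = (k, q, p)"
  shows "fourier_matrix n g s d \<phi> $$ (r, c) =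
    complex_of_real (sqrt (d k / n)) * \<phi> k (g c) $$ (p, q)"
  using assms by (simp add: fourier_matrix_def length_coefficient_list sum_degrees_squared)

lemma coefficient_list_nthE:
  assumes "r < order G"
  obtains k q p where "coefficient_list s d ! r = (k, q, p)" "k < s" "q < d k" "p < d k"
proof -
  have "coefficient_list s d ! r \<in> set (coefficient_list s d)"
    using assms by (intro nth_mem) (simp add: length_coefficient_list sum_degrees_squared)
  then show ?thesis using that unfolding set_coefficient_list by auto
qed

text \<open>The matrix is square by \<open>sum_degrees_squared\<close>, so orthonormality of the
  rows suffices. Different rows carry different triples because the coefficient list has no
  repetitions.\<close>

theorem unitary_fourier_matrix:
  assumes n: "n = order G" and g: "bij_betw g {0..<n} (carrier G)"
  shows "unitary_mat n (fourier_matrix n g s d \<phi>)"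
proof (rule unitary_matI[OF fourier_matrix_carrier[OF n]])
  let ?F = "fourier_matrix n g s d \<phi>"
  note F = fourier_matrix_carrier[OF n, of g]
  have N: "length (coefficient_list s d) = n"
    using n by (simp add: length_coefficient_list sum_degrees_squared)
  show "?F * mat_adjoint ?F = 1\<^sub>m n"
  proof (rule eq_matI)
    fix r r' assume "r < dim_row (1\<^sub>m n :: complex mat)" "r' < dim_col (1\<^sub>m n :: complex mat)"
    then have r: "r < n" "r' < n" by auto
    obtain k q p where kqp: "coefficient_list s d ! r = (k, q, p)" "k < s" "q < d k" "p < d k"
      using coefficient_list_nthE[of r] r n by metis
    obtain k' q' p' where kqp': "coefficient_list s d ! r' = (k', q', p')" "k' < s" "q' < d k'" "p' < d k'"
      using coefficient_list_nthE[of r'] r n by metis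
    have "(?F * mat_adjoint ?F) $$ (r, r') = (\<Sum>c<n. ?F $$ (r, c) * cnj (?F $$ (r', c)))"
      by (rule index_mult_adjoint[OF F F r])
    also have "\<dots> = (\<Sum>c<n. complex_of_real (sqrt (d k / n) * sqrt (d k' / n)) *
        (\<phi> k (g c) $$ (p, q) * cnj (\<phi> k' (g c) $$ (p', q'))))"
      using r by (intro sum.cong refl)
        (simp add: fourier_matrix_index[OF n _ _ kqp(1)] fourier_matrix_index[OF n _ _ kqp'(1)])
    also have "\<dots> = complex_of_real (sqrt (d k / n) * sqrt (d k' / n)) *
        (\<Sum>c\<in>{0..<n}. \<phi> k (g c) $$ (p, q) * cnj (\<phi> k' (g c) $$ (p', q')))"
      by (simp add: sum_distrib_left atLeast0LessThan)
    also have "(\<Sum>c\<in>{0..<n}. \<phi> k (g c) $$ (p, q) * cnj (\<phi> k' (g c) $$ (p', q'))) =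
        (\<Sum>x\<in>carrier G. \<phi> k x $$ (p, q) * cnj (\<phi> k' x $$ (p', q')))"
      by (rule sum.reindex_bij_betw[OF g])
    also have "\<dots> = (if k = k' \<and> p = p' \<and> q = q' then of_nat n / of_nat (d k') else 0)"
      using kqp kqp' n by (simp add: coefficient_orthogonality)
    also have "complex_of_real (sqrt (d k / n) * sqrt (d k' / n)) * \<dots> =
        (if (k, q, p) = (k', q', p') then 1 else 0)"
    proof (cases "(k, q, p) = (k', q', p')")
      case True
      then have "complex_of_real (sqrt (d k / n) * sqrt (d k' / n)) = of_nat (d k) / of_nat n"
        by simp
      then show ?thesis using True degree_pos[OF kqp(2)] order_pos n by (simp add: field_simps)
    qed auto
    also have "(k, q, p) = (k', q', p') \<longleftrightarrow> r = r'"
      using nth_eq_iff_index_eq[OF distinct_coefficient_list, of r s d r'] r kqp(1) kqp'(1) N by simp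
    finally show "(?F * mat_adjoint ?F) $$ (r, r') = 1\<^sub>m n $$ (r, r')" using r by simp
  qed (use F mat_adjoint_carrier[OF F] in auto)
qed

text \<open>This is the product of two columns of the Fourier matrix, those of \<open>x\<close> and
  of the unit element. In the latter the coefficients are Kronecker deltas up to the normalization,
  so the sum over \<open>p\<close> and \<open>q\<close> collapses to a character.\<close>

lemma sum_degree_character:
  assumes x: "x \<in> carrier G"
  shows "(\<Sum>k<s. of_nat (d k) * cnj (character (d k) (\<phi> k) x)) =
    (if x = \<one> then of_nat (order G) else 0)"
proof -
  define n where "n = order G"
  obtain g where g: "bij_betw g {0..<n} (carrier G)"
    using ex_bij_betw_nat_finite[OF finite_carrier] by (auto simp: n_def order_def)
  let ?F = "fourier_matrix n g s d \<phi>"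
  note F = fourier_matrix_carrier[OF n_def, of g]
  have n0: "n > 0" using order_pos by (simp add: n_def)
  have N: "length (coefficient_list s d) = n"
    using n_def by (simp add: length_coefficient_list sum_degrees_squared)
  have "x \<in> g ` {0..<n}" "\<one> \<in> g ` {0..<n}"
    using g x by (simp_all add: bij_betw_def)
  then obtain c e where ce: "c < n" "g c = x" "e < n" "g e = \<one>" by auto
  have ceq: "c = e \<longleftrightarrow> x = \<one>"
    using g ce by (auto simp: bij_betw_def inj_on_def)
  have "(mat_adjoint ?F * ?F) $$ (c, e) = (\<Sum>r<n. cnj (?F $$ (r, c)) * ?F $$ (r, e))"
    by (rule index_adjoint_mult[OF F F ce(1,3)])
  also have "\<dots> = (\<Sum>r<length (coefficient_list s d).
      case coefficient_list s d ! r of (k, q, p) \<Rightarrow> of_nat (d k) / of_nat n *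
        (cnj (\<phi> k x $$ (p, q)) * (if p = q then 1 else 0)))"
    unfolding N
  proof (intro sum.cong refl)
    fix r assume "r \<in> {..<n}"
    then have r: "r < n" by simp
    obtain k q p where kqp: "coefficient_list s d ! r = (k, q, p)" "k < s" "q < d k" "p < d k"
      using coefficient_list_nthE[of r] r n_def by metis
    have "complex_of_real (sqrt (d k / n)) * complex_of_real (sqrt (d k / n)) = of_nat (d k) / of_nat n"
      by (simp flip: of_real_mult)
    then have "cnj (?F $$ (r, c)) * ?F $$ (r, e) = of_nat (d k) / of_nat n *
        (cnj (\<phi> k x $$ (p, q)) * \<phi> k \<one> $$ (p, q))"
      unfolding fourier_matrix_index[OF n_def r ce(1) kqp(1)] fourier_matrix_index[OF n_def r ce(3) kqp(1)]
        ce by (simp add: algebra_simps)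
    then show "cnj (?F $$ (r, c)) * ?F $$ (r, e) =
        (case coefficient_list s d ! r of (k, q, p) \<Rightarrow> of_nat (d k) / of_nat n *
        (cnj (\<phi> k x $$ (p, q)) * (if p = q then 1 else 0)))"
      using kqp by (simp add: unitary_rep_one[OF rep])
  qed
  also have "\<dots> = (\<Sum>k<s. \<Sum>q<d k. \<Sum>p<d k. of_nat (d k) / of_nat n *
        (cnj (\<phi> k x $$ (p, q)) * (if p = q then 1 else 0)))"
    unfolding sum_coefficient_list by simp
  also have "\<dots> = (\<Sum>k<s. \<Sum>q<d k. of_nat (d k) / of_nat n * cnj (\<phi> k x $$ (q, q)))"
  proof (intro sum.cong refl)
    fix k q assume "q \<in> {..<d k}"
    then show "(\<Sum>p<d k. of_nat (d k) / of_nat n * (cnj (\<phi> k x $$ (p, q)) * (if p = q then 1 else 0))) =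
        of_nat (d k) / of_nat n * cnj (\<phi> k x $$ (q, q))"
      by (simp add: if_distrib[of "\<lambda>t. _ * t"] sum.delta cong: if_cong)
  qed
  also have "\<dots> = (\<Sum>k<s. of_nat (d k) * cnj (character (d k) (\<phi> k) x)) / of_nat n"
    by (simp add: character_def sum_divide_distrib sum_distrib_left)
  finally have "(\<Sum>k<s. of_nat (d k) * cnj (character (d k) (\<phi> k) x)) =
      of_nat n * (mat_adjoint ?F * ?F) $$ (c, e)"
    using n0 by simp
  also have "mat_adjoint ?F * ?F = 1\<^sub>m n"
    using unitary_fourier_matrix[OF n_def g] by (simp add: unitary_mat_def)
  finally show ?thesis using ce ceq by (simp add: n_def)
qed

section \<open>Degree one and the commutator subgroup\<close>

lemma degree_one_trivial_on_derived:
  assumes k: "k < s" "d k = 1" and h: "h \<in> derived G (carrier G)"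
  shows "\<phi> k h = 1\<^sub>m (d k)"
proof -
  note c = unitary_rep_carrier[OF rep[OF k(1)]]
  note m = unitary_rep_mult[OF rep[OF k(1)]]
  note o = unitary_rep_one[OF rep[OF k(1)]]
  have comm: "A * B = B * A" if "A \<in> carrier_mat (d k) (d k)" "B \<in> carrier_mat (d k) (d k)"
    for A B :: "complex mat"
    using that k by (intro eq_matI) (auto simp: scalar_prod_def mult.commute)
  \<comment> \<open>\<open>K\<close> is the kernel of the representation; it contains all
    commutators because matrices of size one commute.\<close>
  define K where "K = {x \<in> carrier G. \<phi> k x = 1\<^sub>m (d k)}"
  have "subgroup K G"
  proof (rule subgroupI)
    fix x assume x: "x \<in> K"
    then have "\<phi> k (x \<otimes> inv x) = \<phi> k (inv x)"
      using m[of x "inv x"] left_mult_one_mat[OF c[of "inv x"]] by (simp add: K_def del: r_inv)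
    then show "inv x \<in> K" using x o by (simp add: K_def)
  next
    fix x y assume "x \<in> K" "y \<in> K"
    then show "x \<otimes> y \<in> K" using m[of x y] by (simp add: K_def)
  qed (use o in \<open>auto simp: K_def\<close>)
  moreover have "x \<otimes> y \<otimes> inv x \<otimes> inv y \<in> K" if xy: "x \<in> carrier G" "y \<in> carrier G" for x y
  proof -
    have "\<phi> k (x \<otimes> y \<otimes> inv x \<otimes> inv y) = (\<phi> k (x \<otimes> y) * \<phi> k (inv x)) * \<phi> k (inv y)"
      using m xy by simp
    also have "\<phi> k (x \<otimes> y) = \<phi> k (y \<otimes> x)"
      using m xy comm c by metis
    also have "(\<phi> k (y \<otimes> x) * \<phi> k (inv x)) * \<phi> k (inv y) = \<phi> k (y \<otimes> x \<otimes> inv x \<otimes> inv y)"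
      using m xy by simp
    also have "y \<otimes> x \<otimes> inv x \<otimes> inv y = \<one>" using xy by (simp add: m_assoc)
    finally show ?thesis using xy o by (simp add: K_def)
  qed
  ultimately have "derived G (carrier G) \<subseteq> K"
    unfolding derived_def by (intro generate_subgroup_incl) auto
  with h show ?thesis by (auto simp: K_def)
qed

text \<open>By Schur's lemma each \<open>\<phi> k x\<close> is scalar, so every subspace is
  invariant. The first coordinate axis \<open>W\<close> is nonzero, hence the whole space.\<close>

lemma commuting_irreducible_degree_one:
  assumes k: "k < s"
    and comm: "\<And>x y. x \<in> carrier G \<Longrightarrow> y \<in> carrier G \<Longrightarrow> \<phi> k x * \<phi> k y = \<phi> k y * \<phi> k x"
  shows "d k = 1"
proof -
  note c = unitary_rep_carrier[OF rep[OF k]]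
  have scalar: "\<exists>a. \<phi> k x = a \<cdot>\<^sub>m 1\<^sub>m (d k)" if x: "x \<in> carrier G" for x
  proof -
    have "intertwiner G (d k) (\<phi> k) (d k) (\<phi> k) (\<phi> k x)"
      unfolding intertwiner_def using comm[OF _ x] c[OF x] by blast
    then show ?thesis by (rule schur_scalar[OF rep irr, OF k k]) blast
  qed
  define W where "W = {v \<in> carrier_vec (d k). \<forall>i<d k. i \<noteq> 0 \<longrightarrow> vec_index v i = (0::complex)}"
  have "W = {0\<^sub>v (d k)} \<or> W = carrier_vec (d k)"
  proof (rule irreducible_repD[OF irr[OF k]])
    fix x v assume x: "x \<in> carrier G" and v: "v \<in> W"
    obtain a where a: "\<phi> k x = a \<cdot>\<^sub>m 1\<^sub>m (d k)" using scalar[OF x] by blast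
    have "(a \<cdot>\<^sub>m 1\<^sub>m (d k)) *\<^sub>v v = a \<cdot>\<^sub>v v"
      using v by (intro eq_vecI) (auto simp: W_def)
    then show "\<phi> k x *\<^sub>v v \<in> W" using v unfolding a by (auto simp: W_def)
  qed (auto simp: W_def)
  then show ?thesis
  proof
    assume W: "W = {0\<^sub>v (d k)}"
    have "unit_vec (d k) 0 \<in> W" by (auto simp: W_def)
    then have "vec_index (unit_vec (d k) 0) 0 = (vec_index (0\<^sub>v (d k)) 0 :: complex)" by (simp add: W)
    then show ?thesis using degree_pos[OF k] by simp
  next
    assume W: "W = carrier_vec (d k)"
    show ?thesis
    proof (rule ccontr)
      assume "d k \<noteq> 1"
      then have d: "1 < d k" using degree_pos[OF k] by simp
      have "unit_vec (d k) 1 \<in> W" by (simp add: W)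
      then have "vec_index (unit_vec (d k) 1) 1 = (0::complex)"
        unfolding W_def using d zero_neq_one by blast
      then show False using d by simp
    qed
  qed
qed

text \<open>In degree one the subgroup acts trivially. Otherwise the sum \<open>P\<close> of its
  matrices is an intertwiner, hence a scalar \<open>a\<close>, and the character sum is the trace of
  \<open>P\<close>; the point is that \<open>a = 0\<close>.\<close>

lemma sum_character_derived:
  assumes k: "k < s"
  shows "(\<Sum>x\<in>derived G (carrier G). character (d k) (\<phi> k) x) =
    (if d k = 1 then of_nat (card (derived G (carrier G))) else 0)"
proof (cases "d k = 1")
  case True
  then show ?thesis
    using k by (simp add: character_def degree_one_trivial_on_derived)
next
  case False
  define D where "D = derived G (carrier G)"
  have D: "D \<lhd> G" unfolding D_def by (rule derived_self_is_normal)
  have Dsub: "D \<subseteq> carrier G" using D by (simp add: normal_imp_subgroup subgroup.subset)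
  note c = unitary_rep_carrier[OF rep[OF k]]
  note m = unitary_rep_mult[OF rep[OF k]]
  define P where "P = mat (d k) (d k) (\<lambda>(i, j). \<Sum>h\<in>D. \<phi> k h $$ (i, j))"
  have P: "P \<in> carrier_mat (d k) (d k)" by (simp add: P_def)
  have left: "(\<phi> k x * P) $$ (i, j) = (\<Sum>h\<in>D. \<phi> k (x \<otimes> h) $$ (i, j))"
    if "x \<in> carrier G" "i < d k" "j < d k" for x i j
  proof -
    have "(\<phi> k x * P) $$ (i, j) = (\<Sum>l<d k. \<phi> k x $$ (i, l) * (\<Sum>h\<in>D. \<phi> k h $$ (l, j)))"
      using that by (subst index_mult_mat_sum[OF c P]) (auto simp: P_def)
    also have "\<dots> = (\<Sum>h\<in>D. \<Sum>l<d k. \<phi> k x $$ (i, l) * \<phi> k h $$ (l, j))"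
      by (simp only: sum_distrib_left) (rule sum.swap)
    also have "\<dots> = (\<Sum>h\<in>D. (\<phi> k x * \<phi> k h) $$ (i, j))"
      using that Dsub by (intro sum.cong refl index_mult_mat_sum[OF c c, symmetric]) auto
    finally show ?thesis using that Dsub m by (auto intro!: sum.cong)
  qed
  have right: "(P * \<phi> k x) $$ (i, j) = (\<Sum>h\<in>D. \<phi> k (h \<otimes> x) $$ (i, j))"
    if "x \<in> carrier G" "i < d k" "j < d k" for x i j
  proof -
    have "(P * \<phi> k x) $$ (i, j) = (\<Sum>l<d k. (\<Sum>h\<in>D. \<phi> k h $$ (i, l)) * \<phi> k x $$ (l, j))"
      using that by (subst index_mult_mat_sum[OF P c]) (auto simp: P_def)
    also have "\<dots> = (\<Sum>h\<in>D. \<Sum>l<d k. \<phi> k h $$ (i, l) * \<phi> k x $$ (l, j))"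
      by (simp only: sum_distrib_right) (rule sum.swap)
    also have "\<dots> = (\<Sum>h\<in>D. (\<phi> k h * \<phi> k x) $$ (i, j))"
      using that Dsub by (intro sum.cong refl index_mult_mat_sum[OF c c, symmetric]) auto
    finally show ?thesis using that Dsub m by (auto intro!: sum.cong)
  qed
  have "\<phi> k x * P = P * \<phi> k x" if x: "x \<in> carrier G" for x
  proof (rule eq_matI)
    fix i j assume "i < dim_row (P * \<phi> k x)" "j < dim_col (P * \<phi> k x)"
    then have ij: "i < d k" "j < d k" using P c[OF x] by auto
    have "(\<Sum>h\<in>D. \<phi> k (x \<otimes> h) $$ (i, j)) = (\<Sum>h\<in>D. \<phi> k (h \<otimes> x) $$ (i, j))"
    \<comment> \<open>\<open>x \<otimes> h = (x \<otimes> h \<otimes> inv x) \<otimes> x\<close>,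
      and conjugation by \<open>x\<close> permutes the normal subgroup \<open>D\<close>.\<close>
    proof (rule sum.reindex_bij_witness[of _ "\<lambda>h. inv x \<otimes> h \<otimes> x" "\<lambda>h. x \<otimes> h \<otimes> inv x"])
      fix h assume h: "h \<in> D"
      then have hc: "h \<in> carrier G" using Dsub by blast
      have "inv x \<otimes> (x \<otimes> h) = h" "x \<otimes> (inv x \<otimes> h) = h"
        using x hc by (simp_all only: m_assoc[symmetric] l_inv r_inv l_one inv_closed)
      then show "inv x \<otimes> (x \<otimes> h \<otimes> inv x) \<otimes> x = h" "x \<otimes> (inv x \<otimes> h \<otimes> x) \<otimes> inv x = h"
        using x hc by (simp_all add: m_assoc)
      show "x \<otimes> h \<otimes> inv x \<in> D" by (rule normal.inv_op_closed2[OF D x h])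
      show "inv x \<otimes> h \<otimes> x \<in> D" by (rule normal.inv_op_closed1[OF D x h])
      show "\<phi> k (x \<otimes> h \<otimes> inv x \<otimes> x) $$ (i, j) = \<phi> k (x \<otimes> h) $$ (i, j)"
        using x hc by (simp add: m_assoc)
    qed
    then show "(\<phi> k x * P) $$ (i, j) = (P * \<phi> k x) $$ (i, j)"
      using left[OF x ij] right[OF x ij] by simp
  qed (use P c[OF x] in auto)
  then have "intertwiner G (d k) (\<phi> k) (d k) (\<phi> k) P" using P by (simp add: intertwiner_def)
  then obtain a where a: "P = a \<cdot>\<^sub>m 1\<^sub>m (d k)" by (rule schur_scalar[OF rep irr, OF k k])
  have "a = 0"
  proof (rule ccontr)
    \<comment> \<open>\<open>\<phi> k h * P = P\<close> for \<open>h\<close> in \<open>D\<close>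
      would now make \<open>D\<close> act trivially. Then all \<open>\<phi> k x\<close> commute,
      which is possible only in degree one.\<close>
    assume a0: "a \<noteq> 0"
    have triv: "\<phi> k h = 1\<^sub>m (d k)" if h: "h \<in> D" for h
    proof (rule eq_matI)
      fix i j assume "i < dim_row (1\<^sub>m (d k) :: complex mat)" "j < dim_col (1\<^sub>m (d k) :: complex mat)"
      then have ij: "i < d k" "j < d k" by auto
      have hc: "h \<in> carrier G" using h Dsub by blast
      have sg: "subgroup D G" using D by (rule normal_imp_subgroup)
      have "a * \<phi> k h $$ (i, j) = (\<phi> k h * P) $$ (i, j)"
        using c[OF hc] ij unfolding a mult_smult_distrib[OF c[OF hc] one_carrier_mat] by simp
      also have "\<dots> = (\<Sum>h'\<in>D. \<phi> k (h \<otimes> h') $$ (i, j))" by (rule left[OF hc ij])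
      also have "\<dots> = (\<Sum>h'\<in>D. \<phi> k h' $$ (i, j))"
      proof (rule sum.reindex_bij_witness[of _ "\<lambda>h'. inv h \<otimes> h'" "\<lambda>h'. h \<otimes> h'"])
        fix h' assume h': "h' \<in> D"
        then have "h' \<in> carrier G" using Dsub by blast
        then show "inv h \<otimes> (h \<otimes> h') = h'" "h \<otimes> (inv h \<otimes> h') = h'"
          using hc by (simp_all only: m_assoc[symmetric] l_inv r_inv l_one inv_closed)
        show "h \<otimes> h' \<in> D" "inv h \<otimes> h' \<in> D"
          using h h' sg by (auto intro: subgroup.m_closed subgroup.m_inv_closed)
      qed auto
      also have "\<dots> = P $$ (i, j)" using ij by (simp add: P_def)
      also have "\<dots> = a * 1\<^sub>m (d k) $$ (i, j)" using ij by (simp add: a)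
      finally show "\<phi> k h $$ (i, j) = 1\<^sub>m (d k) $$ (i, j)" 
        using a0 by (simp only: mult_left_cancel not_False_eq_True)
    qed (use c[of h] h Dsub in auto)
    have "\<phi> k x * \<phi> k y = \<phi> k y * \<phi> k x" if xy: "x \<in> carrier G" "y \<in> carrier G" for x y
    proof -
      let ?h = "x \<otimes> y \<otimes> inv x \<otimes> inv y"
      have h: "?h \<in> D" unfolding D_def derived_def using xy by (intro generate.incl) blast
      have "?h \<otimes> (y \<otimes> x) = x \<otimes> y"
      proof -
        have "inv y \<otimes> (y \<otimes> x) = x" using xy by (simp only: m_assoc[symmetric] l_inv l_one inv_closed)
        then show ?thesis using xy by (simp add: m_assoc)
      qed
      then have "\<phi> k (x \<otimes> y) = \<phi> k ?h * \<phi> k (y \<otimes> x)" using m[of ?h "y \<otimes> x"] xy by simp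
      then show ?thesis
        using triv[OF h] m[OF xy] m[OF xy(2,1)] left_mult_one_mat[OF c[of "y \<otimes> x"]] xy by simp
    qed
    then have "d k = 1" by (rule commuting_irreducible_degree_one[OF k])
    with False show False by simp
  qed
  have "(\<Sum>x\<in>D. character (d k) (\<phi> k) x) = (\<Sum>p<d k. P $$ (p, p))"
    unfolding character_def by (subst sum.swap) (simp add: P_def)
  also have "\<dots> = 0" by (simp add: a \<open>a = 0\<close>)
  finally show ?thesis using False by (simp add: D_def)
qed

text \<open>Sum the column relation between \<open>x\<close> and the unit element over the commutator subgroup: only
  the representations of degree one contribute.\<close>

theorem card_degree_one:
  "card {k. k < s \<and> d k = 1} = card (rcosets derived G (carrier G))"
proof -
  let ?D = "derived G (carrier G)"
  have sg: "subgroup ?D G" by (rule derived_is_subgroup) simp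
  have Dsub: "?D \<subseteq> carrier G" using sg by (rule subgroup.subset)
  have finD: "finite ?D" using Dsub by (rule finite_subset) simp
  have D1: "\<one> \<in> ?D" using sg by (rule subgroup.one_closed)
  have "(of_nat (order G) :: complex) = (\<Sum>x\<in>?D. if x = \<one> then of_nat (order G) else 0)"
    using finD D1 by (simp add: sum.delta)
  also have "\<dots> = (\<Sum>x\<in>?D. \<Sum>k<s. of_nat (d k) * cnj (character (d k) (\<phi> k) x))"
    using Dsub by (intro sum.cong refl sum_degree_character[symmetric]) auto
  also have "\<dots> = (\<Sum>k<s. of_nat (d k) * cnj (\<Sum>x\<in>?D. character (d k) (\<phi> k) x))"
    by (subst sum.swap) (simp add: sum_distrib_left)
  also have "\<dots> = (\<Sum>k<s. if d k = 1 then of_nat (card ?D) else 0)"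
    by (intro sum.cong refl) (simp add: sum_character_derived)
  also have "\<dots> = (\<Sum>k\<in>{k. k < s \<and> d k = 1}. of_nat (card ?D))"
    by (rule sum.mono_neutral_cong_right) auto
  also have "\<dots> = of_nat (card {k. k < s \<and> d k = 1} * card ?D)" by simp
  finally have "order G = card {k. k < s \<and> d k = 1} * card ?D"
    by (rule of_nat_eq_iff[THEN iffD1])
  moreover have "card (rcosets ?D) * card ?D = order G" using sg by (rule lagrange)
  moreover have "card ?D > 0" using finD D1 by (auto simp: card_gt_0_iff)
  ultimately show ?thesis by (metis mult_cancel2 less_numeral_extra(3))
qed

end

section \<open>Block diagonalization of group matrices\<close>

lemma diag_block_mat_Cons:
  assumes "(A :: 'x :: zero mat) \<in> carrier_mat n n" "diag_block_mat As \<in> carrier_mat m m"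
  shows "diag_block_mat (A # As) = four_block_mat A (0\<^sub>m n m) (0\<^sub>m m n) (diag_block_mat As)"
  using assms by (simp add: Let_def)

text \<open>Blocks are given as a family over a list \<open>bs\<close> of labels, with sizes
  \<open>sz\<close>, so that several families over the same labels can be multiplied
  blockwise.\<close>

lemma diag_block_mat_carrier:
  assumes "\<And>b. b \<in> set bs \<Longrightarrow> A b \<in> carrier_mat (sz b) (sz b)"
  shows "diag_block_mat (map A bs) \<in> carrier_mat (sum_list (map sz bs)) (sum_list (map sz bs))"
proof
  have sz: "map dim_row (map A bs) = map sz bs" "map dim_col (map A bs) = map sz bs"
    using assms by (auto dest: carrier_matD)
  show "dim_row (diag_block_mat (map A bs)) = sum_list (map sz bs)"
    "dim_col (diag_block_mat (map A bs)) = sum_list (map sz bs)"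
    unfolding dim_diag_block_mat sz by (rule refl)+
qed

lemma det_diag_block_mat:
  assumes "\<And>b. b \<in> set bs \<Longrightarrow> (A b :: complex mat) \<in> carrier_mat (sz b) (sz b)"
  shows "Determinant.det (diag_block_mat (map A bs)) = (\<Prod>b\<leftarrow>bs. Determinant.det (A b))"
  using assms
proof (induction bs)
  case (Cons b bs)
  let ?m = "sum_list (map sz bs)"
  have c: "A b \<in> carrier_mat (sz b) (sz b)" "diag_block_mat (map A bs) \<in> carrier_mat ?m ?m"
    using Cons.prems by (auto intro!: diag_block_mat_carrier)
  show ?case
    using Cons unfolding list.map diag_block_mat_Cons[OF c]
    by (subst det_four_block_mat_lower_left_zero[OF c(1) _ _ c(2)]) auto
qed (simp add: det_dim_zero)

lemma invertible_diag_block_mat: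
  assumes "\<And>b. b \<in> set bs \<Longrightarrow> (A b :: complex mat) \<in> carrier_mat (sz b) (sz b)"
  shows "invertible_mat (diag_block_mat (map A bs)) \<longleftrightarrow> (\<forall>b\<in>set bs. invertible_mat (A b))"
proof -
  have "invertible_mat (diag_block_mat (map A bs)) \<longleftrightarrow> (\<Prod>b\<leftarrow>bs. Determinant.det (A b)) \<noteq> 0"
    using invertible_mat_iff_det[OF diag_block_mat_carrier[of bs A sz, OF assms]]
      det_diag_block_mat[of bs A sz, OF assms] by simp
  also have "\<dots> \<longleftrightarrow> (\<forall>b\<in>set bs. Determinant.det (A b) \<noteq> 0)"
    by (auto simp: prod_list_zero_iff)
  also have "\<dots> \<longleftrightarrow> (\<forall>b\<in>set bs. invertible_mat (A b))"
    using invertible_mat_iff_det[OF assms] by simp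
  finally show ?thesis .
qed

lemma diag_block_mat_mult:
  assumes "\<And>b. b \<in> set bs \<Longrightarrow> (A b :: complex mat) \<in> carrier_mat (sz b) (sz b)"
    and "\<And>b. b \<in> set bs \<Longrightarrow> B b \<in> carrier_mat (sz b) (sz b)"
  shows "diag_block_mat (map (\<lambda>b. A b * B b) bs) =
    diag_block_mat (map A bs) * diag_block_mat (map B bs)"
  using assms
proof (induction bs)
  case (Cons b bs)
  let ?m = "sum_list (map sz bs)" and ?n = "sz b"
  have A: "A b \<in> carrier_mat ?n ?n" "diag_block_mat (map A bs) \<in> carrier_mat ?m ?m"
    and B: "B b \<in> carrier_mat ?n ?n" "diag_block_mat (map B bs) \<in> carrier_mat ?m ?m"
    using Cons.prems by (auto intro!: diag_block_mat_carrier)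
  have AB: "A b * B b \<in> carrier_mat ?n ?n"
    "diag_block_mat (map (\<lambda>b. A b * B b) bs) \<in> carrier_mat ?m ?m"
    using Cons.prems by (auto intro!: diag_block_mat_carrier[where sz = sz] mult_carrier_mat)
  have IH: "diag_block_mat (map (\<lambda>b. A b * B b) bs) =
      diag_block_mat (map A bs) * diag_block_mat (map B bs)"
    using Cons by simp
  have z: "0\<^sub>m ?n ?m \<in> carrier_mat ?n ?m" "0\<^sub>m ?m ?n \<in> carrier_mat ?m ?n" for m n by auto
  have "diag_block_mat (map A (b # bs)) * diag_block_mat (map B (b # bs)) =
      four_block_mat (A b * B b) (0\<^sub>m ?n ?m) (0\<^sub>m ?m ?n)
        (diag_block_mat (map A bs) * diag_block_mat (map B bs))"
    unfolding list.map diag_block_mat_Cons[OF A] diag_block_mat_Cons[OF B]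
      mult_four_block_mat[OF A(1) z A(2) B(1) z B(2)]
    using A B by (simp add: right_add_zero_mat[of _ ?n ?n] left_add_zero_mat[of _ ?m ?m])
  then show ?case unfolding IH[symmetric] list.map diag_block_mat_Cons[OF AB] by simp
qed simp

lemma diag_block_mat_mat_diag:
  assumes "\<And>b. b \<in> set bs \<Longrightarrow> length (\<rho> b) = sz b"
  shows "diag_block_mat (map (\<lambda>b. mat_diag (sz b) (\<lambda>i. f (\<rho> b ! i) :: complex)) bs) =
    mat_diag (sum_list (map sz bs)) (\<lambda>i. f (concat (map \<rho> bs) ! i))"
  using assms
proof (induction bs)
  case Nil
  show ?case by (rule eq_matI) (auto simp: mat_diag_def)
next
  case (Cons b bs)
  have IH: "diag_block_mat (map (\<lambda>b. mat_diag (sz b) (\<lambda>i. f (\<rho> b ! i))) bs) =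
    mat_diag (sum_list (map sz bs)) (\<lambda>i. f (concat (map \<rho> bs) ! i))"
    using Cons by simp
  have c: "diag_block_mat (map (\<lambda>b. mat_diag (sz b) (\<lambda>i. f (\<rho> b ! i))) bs)
      \<in> carrier_mat (sum_list (map sz bs)) (sum_list (map sz bs))"
    unfolding IH by (rule mat_diag_dim)
  have len: "length (\<rho> b) = sz b" using Cons.prems by simp
  show ?case
    unfolding list.map diag_block_mat_Cons[OF mat_diag_dim c] unfolding IH
    by (rule eq_matI) (auto simp: mat_diag_def nth_append len)
qed

text \<open>The list \<open>ix\<close> names each row by its block label and its position in the
  block. Since the labels are distinct, equal labels mean the same block, even where the blocks
  themselves coincide.\<close>

lemma diag_block_mat_index:
  assumes "\<And>b. b \<in> set bs \<Longrightarrow> (A b :: complex mat) \<in> carrier_mat (sz b) (sz b)" "distinct bs"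
  defines "ix \<equiv> concat (map (\<lambda>b. map (Pair b) [0..<sz b]) bs)"
  assumes "r < length ix" "c < length ix"
  shows "diag_block_mat (map A bs) $$ (r, c) =
    (if fst (ix ! r) = fst (ix ! c) then A (fst (ix ! r)) $$ (snd (ix ! r), snd (ix ! c)) else 0)"
  using assms(1,2,4,5) unfolding ix_def
proof (induction bs arbitrary: r c)
  case (Cons b bs)
  let ?n = "sz b" and ?m = "sum_list (map sz bs)"
  let ?jx = "concat (map (\<lambda>b. map (Pair b) [0..<sz b]) bs)"
  have len: "length ?jx = ?m" by (simp add: length_concat comp_def)
  have A: "A b \<in> carrier_mat ?n ?n" "diag_block_mat (map A bs) \<in> carrier_mat ?m ?m"
    using Cons.prems by (auto intro!: diag_block_mat_carrier)
  have tag: "fst (?jx ! i) \<noteq> b" if "i < ?m" for i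
  proof -
    have "?jx ! i \<in> set ?jx" using that len by (intro nth_mem) simp
    then show ?thesis using Cons.prems(2) by auto
  qed
  have rc: "r < ?n + ?m" "c < ?n + ?m" using Cons.prems(3,4) len by auto
  have nth: "concat (map (\<lambda>b. map (Pair b) [0..<sz b]) (b # bs)) ! i =
      (if i < ?n then (b, i) else ?jx ! (i - ?n))" for i
    by (simp add: nth_append)
  have entry: "diag_block_mat (map A (b # bs)) $$ (r, c) =
      (if r < ?n then if c < ?n then A b $$ (r, c) else 0
       else if c < ?n then 0 else diag_block_mat (map A bs) $$ (r - ?n, c - ?n))"
    unfolding list.map diag_block_mat_Cons[OF A] using A rc by auto
  show ?case
    unfolding nth entry
    using Cons.IH[of "r - ?n" "c - ?n"] Cons.prems(1,2) rc len tag[of "r - ?n"] tag[of "c - ?n"]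
      not_sym[OF tag, of "c - ?n"]
    by auto
qed simp

text \<open>The tag \<open>(k, q)\<close> stands for the \<open>q\<close>-th copy of the
  \<open>k\<close>-th block. Copies are equal as matrices, and the tags keep them apart.\<close>

definition block_tags :: "nat \<Rightarrow> (nat \<Rightarrow> nat) \<Rightarrow> (nat \<times> nat) list" where
  "block_tags s d = concat (map (\<lambda>k. map (Pair k) [0..<d k]) [0..<s])"

lemma set_block_tags: "set (block_tags s d) = (SIGMA k:{..<s}. {..<d k})"
  by (force simp: block_tags_def)

lemma distinct_block_tags: "distinct (block_tags s d)"
  unfolding block_tags_def by (intro distinct_concat_map) (auto simp: distinct_map inj_on_def)

lemma concat_concat: "concat (concat xs) = concat (map concat xs)"
  by (induction xs) auto

lemma concat_map_replicate:
  "concat (map (\<lambda>k. replicate (m k) (f k)) xs) =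
   map (\<lambda>b. f (fst b)) (concat (map (\<lambda>k. map (Pair k) [0..<m k]) xs))"
  by (induction xs) (auto simp: map_replicate_const comp_def)

section \<open>Repeated blocks and repeated indices\<close>

lemma repeated_blocks_conv:
  "repeated_blocks s d M = diag_block_mat (map (\<lambda>b. M (fst b)) (block_tags s d))"
  by (simp add: repeated_blocks_def block_tags_def concat_map_replicate)

lemma repeated_indices_conv:
  "repeated_indices s d \<rho> = concat (map (\<lambda>b. \<rho> (fst b)) (block_tags s d))"
  unfolding repeated_indices_def block_tags_def concat_map_replicate[symmetric] concat_concat
  by (simp add: comp_def)

text \<open>Identifies the rows of the Fourier matrix with positions inside tagged blocks, so that
  entries of block matrices can be computed in the numbering of those rows.\<close>

lemma coefficient_list_conv:
  "coefficient_list s d =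
   map (\<lambda>(b, p). (fst b, snd b, p)) (concat (map (\<lambda>b. map (Pair b) [0..<d (fst b)]) (block_tags s d)))"
  by (simp add: coefficient_list_def block_tags_def map_concat comp_def concat_concat)

lemma sum_list_block_tags: "sum_list (map (\<lambda>b. d (fst b)) (block_tags s d)) = (\<Sum>k<s. (d k)\<^sup>2)"
  unfolding length_coefficient_list[symmetric] coefficient_list_conv
  by (simp add: length_concat comp_def)

lemma repeated_blocks_carrier:
  assumes "\<And>k. k < s \<Longrightarrow> M k \<in> carrier_mat (d k) (d k)"
  shows "repeated_blocks s d M \<in> carrier_mat (\<Sum>k<s. (d k)\<^sup>2) (\<Sum>k<s. (d k)\<^sup>2)"
  using diag_block_mat_carrier[of "block_tags s d" "\<lambda>b. M (fst b)" "\<lambda>b. d (fst b)"] assms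
  by (auto simp: repeated_blocks_conv sum_list_block_tags set_block_tags)

lemma repeated_blocks_index:
  assumes "\<And>k. k < s \<Longrightarrow> (M k :: complex mat) \<in> carrier_mat (d k) (d k)"
    and "r < (\<Sum>k<s. (d k)\<^sup>2)" "c < (\<Sum>k<s. (d k)\<^sup>2)"
    and "coefficient_list s d ! r = (k, q, p)" "coefficient_list s d ! c = (k', q', p')"
  shows "repeated_blocks s d M $$ (r, c) = (if k = k' \<and> q = q' then M k $$ (p, p') else 0)"
proof -
  let ?ix = "concat (map (\<lambda>b. map (Pair b) [0..<d (fst b)]) (block_tags s d))"
  have len: "length ?ix = (\<Sum>k<s. (d k)\<^sup>2)"
    using length_coefficient_list[of s d] by (simp add: coefficient_list_conv)
  have "?ix ! r = ((k, q), p)" "?ix ! c = ((k', q'), p')"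
    using assms(2-5) len by (auto simp: coefficient_list_conv split: prod.splits)
  then show ?thesis
    using diag_block_mat_index[of "block_tags s d" "\<lambda>b. M (fst b)" "\<lambda>b. d (fst b)" r c]
      assms(1-3) len distinct_block_tags[of s d]
    by (auto simp: repeated_blocks_conv set_block_tags)
qed

lemma repeated_blocks_mult:
  assumes "\<And>k. k < s \<Longrightarrow> (M k :: complex mat) \<in> carrier_mat (d k) (d k)"
    and "\<And>k. k < s \<Longrightarrow> N k \<in> carrier_mat (d k) (d k)"
  shows "repeated_blocks s d (\<lambda>k. M k * N k) = repeated_blocks s d M * repeated_blocks s d N"
  unfolding repeated_blocks_conv using assms
  by (intro diag_block_mat_mult[where sz = "\<lambda>b. d (fst b)"]) (auto simp: set_block_tags)

lemma repeated_blocks_mat_diag: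
  assumes "\<And>k. k < s \<Longrightarrow> length (\<rho> k) = d k"
  shows "repeated_blocks s d (\<lambda>k. mat_diag (d k) (\<lambda>i. f (\<rho> k ! i) :: complex)) =
    mat_diag (\<Sum>k<s. (d k)\<^sup>2) (\<lambda>i. f (repeated_indices s d \<rho> ! i))"
  unfolding repeated_blocks_conv repeated_indices_conv sum_list_block_tags[symmetric] using assms
  by (intro diag_block_mat_mat_diag) (auto simp: set_block_tags)

lemma length_repeated_indices:
  assumes "\<And>k. k < s \<Longrightarrow> length (\<rho> k) = d k"
  shows "length (repeated_indices s d \<rho>) = (\<Sum>k<s. (d k)\<^sup>2)"
proof -
  have lens: "map (\<lambda>b. length (\<rho> (fst b))) (block_tags s d) = map (\<lambda>b. d (fst b)) (block_tags s d)"
    using assms by (auto simp: set_block_tags)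
  have "length (repeated_indices s d \<rho>) = sum_list (map (\<lambda>b. length (\<rho> (fst b))) (block_tags s d))"
    by (simp add: repeated_indices_conv length_concat comp_def)
  then show ?thesis unfolding lens sum_list_block_tags .
qed

lemma count_repeated_indices:
  "count (mset (repeated_indices s d \<rho>)) r = (\<Sum>k<s. d k * count (mset (\<rho> k)) r)"
proof -
  have "count (mset (concat (replicate m xs))) r = m * count (mset xs) r" for m and xs :: "int list"
    by (induction m) auto
  then have "count (mset (concat (map (\<lambda>k. concat (replicate (d k) (\<rho> k))) xs))) r =
      (\<Sum>k\<leftarrow>xs. d k * count (mset (\<rho> k)) r)" for xs
    by (induction xs) auto
  then show ?thesis
    by (simp add: repeated_indices_def interv_sum_list_conv_sum_set_nat atLeast0LessThan)
qed

text \<open>Positive degrees ensure that each \<open>M k\<close> occurs at least once, so that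
  invertibility of the whole says something about every block.\<close>

lemma invertible_repeated_blocks:
  assumes "\<And>k. k < s \<Longrightarrow> (M k :: complex mat) \<in> carrier_mat (d k) (d k)"
    and "\<And>k. k < s \<Longrightarrow> 0 < d k"
  shows "invertible_mat (repeated_blocks s d M) \<longleftrightarrow> (\<forall>k<s. invertible_mat (M k))"
proof -
  have "invertible_mat (repeated_blocks s d M) \<longleftrightarrow>
      (\<forall>b\<in>set (block_tags s d). invertible_mat (M (fst b)))"
    unfolding repeated_blocks_conv using assms(1)
    by (intro invertible_diag_block_mat[where sz = "\<lambda>b. d (fst b)"]) (auto simp: set_block_tags)
  then show ?thesis using assms(2) by (force simp: set_block_tags)
qed

section \<open>Group matrices in the Fourier basis\<close>

lemma symbol_carrier [simp]: "symbol G m \<psi> a t \<in> carrier_mat m m"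
  by (simp add: symbol_def)

lemma group_matrix_carrier [simp]: "group_matrix G n g a t \<in> carrier_mat n n"
  by (simp add: group_matrix_def)

context irreducible_family
begin

text \<open>With \<open>y = g i \<otimes> inv (g c)\<close> a row of \<open>F\<close> times a column
  of the group matrix becomes a sum of \<open>a y t\<close> times
  \<open>\<phi> k (y \<otimes> g c)\<close>, and multiplicativity splits off the symbol. The index
  \<open>q\<close> is only carried along, which is why the symbol occurs once for each
  \<open>q\<close>.\<close>

lemma fourier_intertwines:
  assumes n: "n = order G" and g: "bij_betw g {0..<n} (carrier G)"
  shows "fourier_matrix n g s d \<phi> * group_matrix G n g a t =
    repeated_blocks s d (\<lambda>k. symbol G (d k) (\<phi> k) a t) * fourier_matrix n g s d \<phi>"
proof (rule eq_matI)
  let ?F = "fourier_matrix n g s d \<phi>" and ?A = "group_matrix G n g a t"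
    and ?\<Lambda> = "\<lambda>k. symbol G (d k) (\<phi> k) a t"
  let ?D = "repeated_blocks s d ?\<Lambda>"
  note F = fourier_matrix_carrier[OF n, of g]
  have D: "?D \<in> carrier_mat n n"
    using repeated_blocks_carrier[of s ?\<Lambda> d] n by (simp add: sum_degrees_squared)
  have N: "length (coefficient_list s d) = n"
    using n by (simp add: length_coefficient_list sum_degrees_squared)
  fix r c assume "r < dim_row (?D * ?F)" "c < dim_col (?D * ?F)"
  then have rc: "r < n" "c < n" using D F by auto
  obtain k q p where kqp: "coefficient_list s d ! r = (k, q, p)" "k < s" "q < d k" "p < d k"
    using coefficient_list_nthE[of r] rc n by metis
  define w where "w k = complex_of_real (sqrt (d k / n))" for k
  have x: "g c \<in> carrier G" using g rc by (auto simp: bij_betw_def)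
  note cr = unitary_rep_carrier[OF rep[OF kqp(2)]]
  have "(?F * ?A) $$ (r, c) = (\<Sum>i<n. ?F $$ (r, i) * ?A $$ (i, c))"
    using rc by (intro index_mult_mat_sum[OF F]) auto
  also have "\<dots> = (\<Sum>i\<in>{0..<n}. w k * \<phi> k (g i) $$ (p, q) * a (g i \<otimes> inv (g c)) t)"
    using rc by (intro sum.cong) (auto simp: fourier_matrix_index[OF n _ _ kqp(1)] group_matrix_def w_def)
  also have "\<dots> = (\<Sum>y\<in>carrier G. w k * \<phi> k y $$ (p, q) * a (y \<otimes> inv (g c)) t)"
    by (rule sum.reindex_bij_betw[OF g])
  also have "\<dots> = (\<Sum>y\<in>carrier G. w k * \<phi> k (y \<otimes> g c) $$ (p, q) * a y t)"
    by (rule sum.reindex_bij_witness[of _ "\<lambda>y. y \<otimes> g c" "\<lambda>y. y \<otimes> inv (g c)"])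
      (use x in \<open>auto simp: m_assoc\<close>)
  also have "\<dots> = (\<Sum>y\<in>carrier G. \<Sum>p'<d k. w k * (a y t * \<phi> k y $$ (p, p')) * \<phi> k (g c) $$ (p', q))"
  proof (intro sum.cong refl)
    fix y assume y: "y \<in> carrier G"
    have "\<phi> k (y \<otimes> g c) $$ (p, q) = (\<Sum>p'<d k. \<phi> k y $$ (p, p') * \<phi> k (g c) $$ (p', q))"
      unfolding unitary_rep_mult[OF rep[OF kqp(2)] y x]
      by (rule index_mult_mat_sum[OF cr[OF y] cr[OF x] kqp(4,3)])
    then show "w k * \<phi> k (y \<otimes> g c) $$ (p, q) * a y t =
        (\<Sum>p'<d k. w k * (a y t * \<phi> k y $$ (p, p')) * \<phi> k (g c) $$ (p', q))"
      by (simp add: sum_distrib_left sum_distrib_right mult_ac)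
  qed
  also have "\<dots> = (\<Sum>p'<d k. \<Sum>y\<in>carrier G. w k * (a y t * \<phi> k y $$ (p, p')) * \<phi> k (g c) $$ (p', q))"
    by (rule sum.swap)
  also have "\<dots> = (\<Sum>p'<d k. ?\<Lambda> k $$ (p, p') * (w k * \<phi> k (g c) $$ (p', q)))"
    using kqp by (intro sum.cong) (auto simp: symbol_def sum_distrib_left sum_distrib_right mult_ac)
  \<comment> \<open>Zeros are added for all other pairs \<open>(k', q')\<close>, so that the sum can
    be read as running over all rows of \<open>F\<close>.\<close>
  also have "\<dots> = (\<Sum>k'<s. \<Sum>q'<d k'. \<Sum>p'<d k'. if k' = k \<and> q' = q then
      ?\<Lambda> k $$ (p, p') * (w k * \<phi> k (g c) $$ (p', q)) else 0)"
  proof -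
    have "(\<Sum>q'<d k'. \<Sum>p'<d k'. if k' = k \<and> q' = q then
        ?\<Lambda> k $$ (p, p') * (w k * \<phi> k (g c) $$ (p', q)) else 0) =
      (if k' = k then \<Sum>q'<d k. if q' = q then
        \<Sum>p'<d k. ?\<Lambda> k $$ (p, p') * (w k * \<phi> k (g c) $$ (p', q)) else 0 else 0)" for k'
    proof (cases "k' = k")
      case True
      then show ?thesis by (simp only: if_True simp_thms) (rule sum.cong[OF refl], simp)
    qed simp
    then show ?thesis using kqp by simp
  qed
  also have "\<dots> = (\<Sum>l<length (coefficient_list s d). case coefficient_list s d ! l of (k', q', p') \<Rightarrow>
      if k' = k \<and> q' = q then ?\<Lambda> k $$ (p, p') * (w k * \<phi> k (g c) $$ (p', q)) else 0)"
    unfolding sum_coefficient_list by simp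
  also have "\<dots> = (\<Sum>l<n. ?D $$ (r, l) * ?F $$ (l, c))"
    unfolding N
  proof (intro sum.cong refl)
    fix l assume "l \<in> {..<n}"
    then have l: "l < n" by simp
    obtain k' q' p' where l': "coefficient_list s d ! l = (k', q', p')"
      by (cases "coefficient_list s d ! l") auto
    have "?D $$ (r, l) = (if k = k' \<and> q = q' then ?\<Lambda> k $$ (p, p') else 0)"
      using rc l n by (intro repeated_blocks_index kqp(1) l') (auto simp: sum_degrees_squared)
    then show "(case coefficient_list s d ! l of (k', q', p') \<Rightarrow>
      if k' = k \<and> q' = q then ?\<Lambda> k $$ (p, p') * (w k * \<phi> k (g c) $$ (p', q)) else 0) =
      ?D $$ (r, l) * ?F $$ (l, c)"
      unfolding l' fourier_matrix_index[OF n l rc(2) l'] by (auto simp: w_def)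
  qed
  also have "\<dots> = (?D * ?F) $$ (r, c)"
    by (rule index_mult_mat_sum[OF D F rc, symmetric])
  finally show "(?F * ?A) $$ (r, c) = (?D * ?F) $$ (r, c)" .
qed (use fourier_matrix_carrier[OF n, of g] n repeated_blocks_carrier[of s "\<lambda>k. symbol G (d k) (\<phi> k) a t" d]
    in \<open>auto simp: sum_degrees_squared group_matrix_def\<close>)

theorem group_matrix_block_diagonalization:
  assumes n: "n = order G" and g: "bij_betw g {0..<n} (carrier G)"
  defines "F \<equiv> fourier_matrix n g s d \<phi>"
  shows "group_matrix G n g a t =
    mat_adjoint F * repeated_blocks s d (\<lambda>k. symbol G (d k) (\<phi> k) a t) * F"
proof -
  let ?A = "group_matrix G n g a t" and ?D = "repeated_blocks s d (\<lambda>k. symbol G (d k) (\<phi> k) a t)"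
  have F: "F \<in> carrier_mat n n" "mat_adjoint F \<in> carrier_mat n n" "mat_adjoint F * F = 1\<^sub>m n"
    using unitary_fourier_matrix[OF n g] unfolding F_def
    by (auto simp: unitary_mat_def mat_adjoint_carrier)
  have D: "?D \<in> carrier_mat n n"
    using repeated_blocks_carrier[of s "\<lambda>k. symbol G (d k) (\<phi> k) a t" d] n
    by (simp add: sum_degrees_squared)
  have A: "?A \<in> carrier_mat n n" by simp
  have "mat_adjoint F * ?D * F = mat_adjoint F * (?D * F)"
    by (rule assoc_mult_mat[OF F(2) D F(1)])
  also have "?D * F = F * ?A"
    unfolding F_def by (rule fourier_intertwines[OF n g, symmetric])
  also have "mat_adjoint F * (F * ?A) = ?A"
    unfolding assoc_mult_mat[OF F(2,1) A, symmetric] F(3) by (rule left_mult_one_mat[OF A])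
  finally show ?thesis ..
qed

end

section \<open>Removability of Lipschitz curves\<close>

definition seg_int :: "(complex \<Rightarrow> complex) \<Rightarrow> complex \<Rightarrow> complex \<Rightarrow> complex" where
  "seg_int f u v = contour_integral (linepath u v) f"

text \<open>The corners may come in any order. Reversed rectangles count with a sign and degenerate
  ones give zero, so the splitting rules need no inequalities.\<close>

definition rect_int :: "(complex \<Rightarrow> complex) \<Rightarrow> real \<Rightarrow> real \<Rightarrow> real \<Rightarrow> real \<Rightarrow> complex" where
  "rect_int f a b c e =
     seg_int f (Complex a c) (Complex b c) + seg_int f (Complex b c) (Complex b e) +
     seg_int f (Complex b e) (Complex a e) + seg_int f (Complex a e) (Complex a c)"

lemma seg_int_reverse: "seg_int f v u = - seg_int f u v"
  using contour_integral_reversepath[OF valid_path_linepath, of u v f] by (simp add: seg_int_def)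

lemma seg_int_refl [simp]: "seg_int f u u = 0"
  by (simp add: seg_int_def contour_integral_trivial)

text \<open>Whichever of the three points lies between the other two, the oriented integrals combine
  in the same way.\<close>

lemma seg_int_collinear:
  assumes f: "continuous_on UNIV f" and "collinear {u, v, w}"
  shows "seg_int f u v + seg_int f v w = seg_int f u w"
proof -
  have split: "seg_int f x z = seg_int f x y + seg_int f y z" if "between (x, z) y" for x y z
    using that f unfolding seg_int_def by (intro contour_integral_split_linepath)
      (auto simp: between_mem_segment intro: continuous_on_subset)
  from assms(2) consider "between (v, w) u" | "between (w, u) v" | "between (u, v) w"
    by (auto simp: collinear_between_cases)
  then show ?thesis
  proof cases
    case 1
    then show ?thesis using split[of v w u] seg_int_reverse[of f u v] by simp
  next
    case 2
    then show ?thesis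
      using split[of w u v] seg_int_reverse[of f u v] seg_int_reverse[of f v w]
        seg_int_reverse[of f u w] by simp
  next
    case 3
    then show ?thesis using split[of u v w] seg_int_reverse[of f v w] by simp
  qed
qed

lemma seg_int_horizontal:
  assumes "continuous_on UNIV f"
  shows "seg_int f (Complex a c) (Complex x c) + seg_int f (Complex x c) (Complex b c) =
         seg_int f (Complex a c) (Complex b c)"
proof (rule seg_int_collinear[OF assms])
  have "\<exists>k. Complex p c - Complex q c = k *\<^sub>R 1" for p q
    by (rule exI[of _ "p - q"]) (simp add: complex_eq_iff)
  then show "collinear {Complex a c, Complex x c, Complex b c}"
    unfolding collinear_def by blast
qed

lemma seg_int_vertical:
  assumes "continuous_on UNIV f"
  shows "seg_int f (Complex a c) (Complex a y) + seg_int f (Complex a y) (Complex a e) =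
         seg_int f (Complex a c) (Complex a e)"
proof (rule seg_int_collinear[OF assms])
  have "\<exists>k. Complex a p - Complex a q = k *\<^sub>R \<i>" for p q
    by (rule exI[of _ "p - q"]) (simp add: complex_eq_iff)
  then show "collinear {Complex a c, Complex a y, Complex a e}"
    unfolding collinear_def by blast
qed

lemma rect_int_split_horizontal:
  assumes "continuous_on UNIV f"
  shows "rect_int f a x c e + rect_int f x b c e = rect_int f a b c e"
  unfolding rect_int_def seg_int_horizontal[OF assms, of a c x b, symmetric]
    seg_int_horizontal[OF assms, of b e x a, symmetric]
    seg_int_reverse[of f "Complex x c" "Complex x e"]
  by simp

lemma rect_int_split_vertical:
  assumes "continuous_on UNIV f"
  shows "rect_int f a b c y + rect_int f a b y e = rect_int f a b c e"
  unfolding rect_int_def seg_int_vertical[OF assms, of b c y e, symmetric]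
    seg_int_vertical[OF assms, of a e y c, symmetric]
    seg_int_reverse[of f "Complex a y" "Complex b y"]
  by simp

lemma rect_int_grid:
  assumes "continuous_on UNIV f"
  shows "rect_int f (x 0) (x n) (y 0) (y m) =
         (\<Sum>i<n. \<Sum>j<m. rect_int f (x i) (x (Suc i)) (y j) (y (Suc j)))"
proof -
  have degenerate: "rect_int f u u p q = 0" "rect_int f p q u u = 0" for u p q
    using seg_int_reverse[of f "Complex u p" "Complex u q"]
      seg_int_reverse[of f "Complex p u" "Complex q u"]
    by (simp_all add: rect_int_def)
  have rows: "rect_int f (x 0) (x n) c e = (\<Sum>i<n. rect_int f (x i) (x (Suc i)) c e)" for c e
    by (induction n) (simp_all add: degenerate
        rect_int_split_horizontal[OF assms, of "x 0" "x n" _ _ "x (Suc n)" for n, symmetric])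
  have cols: "rect_int f a b (y 0) (y m) = (\<Sum>j<m. rect_int f a b (y j) (y (Suc j)))" for a b
    by (induction m) (simp_all add: degenerate
        rect_int_split_vertical[OF assms, of _ _ "y 0" "y n" "y (Suc n)" for n, symmetric])
  show ?thesis unfolding rows by (simp add: cols)
qed

lemma rect_int_flip:
  "rect_int f b a c e = - rect_int f a b c e" "rect_int f a b e c = - rect_int f a b c e"
  using seg_int_reverse[of f "Complex a c" "Complex b c"]
    seg_int_reverse[of f "Complex a e" "Complex b e"]
    seg_int_reverse[of f "Complex a c" "Complex a e"]
    seg_int_reverse[of f "Complex b c" "Complex b e"]
  by (simp_all add: rect_int_def)

lemma segments_in_rect:
  assumes "a \<le> b" "c \<le> e"
  shows "closed_segment (Complex a c) (Complex b c) \<subseteq> cbox (Complex a c) (Complex b e)"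
    and "closed_segment (Complex b c) (Complex b e) \<subseteq> cbox (Complex a c) (Complex b e)"
    and "closed_segment (Complex b e) (Complex a e) \<subseteq> cbox (Complex a c) (Complex b e)"
    and "closed_segment (Complex a e) (Complex a c) \<subseteq> cbox (Complex a c) (Complex b e)"
  using assms
  by (intro closed_segment_subset convex_box; simp add: in_cbox_complex_iff)+

lemma rect_int_holomorphic:
  assumes f: "continuous_on UNIV f" and le: "a \<le> b" "c \<le> e"
    and hol: "f holomorphic_on cbox (Complex a c) (Complex b e)"
  shows "rect_int f a b c e = 0"
proof -
  have int: "f contour_integrable_on linepath u v" for u v
    using f by (intro contour_integrable_continuous_linepath) (auto intro: continuous_on_subset)
  have "(f has_contour_integral 0) (rectpath (Complex a c) (Complex b e))"
    using le by (intro Cauchy_theorem_convex_simple[OF hol] convex_box)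
      (auto simp: intro!: path_image_rectpath_subset_cbox[THEN subsetD])
  then have "contour_integral (rectpath (Complex a c) (Complex b e)) f = 0"
    by (rule contour_integral_unique)
  then show ?thesis
    using int by (simp add: rectpath_def Let_def rect_int_def seg_int_def add.assoc contour_integrable_joinI)
qed

text \<open>A constant \<open>k\<close> has integral zero around the rectangle, so \<open>f\<close>
  may be replaced by \<open>f - k\<close>; the factor in front of \<open>\<omega>\<close> is the
  perimeter.\<close>

lemma rect_int_bound:
  assumes f: "continuous_on UNIV f" and le: "a \<le> b" "c \<le> e"
    and osc: "\<And>z. z \<in> cbox (Complex a c) (Complex b e) \<Longrightarrow> norm (f z - k) \<le> \<omega>"
  shows "norm (rect_int f a b c e) \<le> 2 * ((b - a) + (e - c)) * \<omega>"
proof -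
  have int: "h contour_integrable_on linepath u v" if "continuous_on UNIV h" for u v h
    using that by (intro contour_integrable_continuous_linepath) (auto intro: continuous_on_subset)
  have cont: "continuous_on UNIV (\<lambda>z. f z - k)"
    by (intro continuous_intros f)
  have seg: "seg_int f u v = seg_int (\<lambda>z. f z - k) u v + k * (v - u)" for u v
    using contour_integral_diff[OF int[OF f, of u v] int[of "\<lambda>_. k" u v]]
    by (simp add: seg_int_def)
  have "Complex a c \<in> cbox (Complex a c) (Complex b e)"
    using le by (simp add: in_cbox_complex_iff)
  then have \<omega>: "0 \<le> \<omega>"
    using osc norm_ge_zero order_trans by blast
  have bd: "norm (seg_int (\<lambda>z. f z - k) u v) \<le> \<omega> * norm (v - u)"
    if "closed_segment u v \<subseteq> cbox (Complex a c) (Complex b e)" for u v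
    using that \<omega> osc unfolding seg_int_def by (intro contour_integral_bound_linepath int cont) auto
  have nrm: "norm (Complex p q - Complex p r) = \<bar>q - r\<bar>"
    "norm (Complex q p - Complex r p) = \<bar>q - r\<bar>" for p q r
    by (simp_all add: cmod_def)
  have "rect_int f a b c e = rect_int (\<lambda>z. f z - k) a b c e"
    unfolding rect_int_def seg by (simp add: algebra_simps)
  also have "norm \<dots> \<le> \<omega> * (b - a) + \<omega> * (e - c) + \<omega> * (b - a) + \<omega> * (e - c)"
    unfolding rect_int_def using segments_in_rect[OF le, THEN bd] le
    by (intro norm_triangle_mono) (simp_all add: nrm abs_of_nonneg abs_of_nonpos)
  also have "\<dots> = 2 * ((b - a) + (e - c)) * \<omega>"
    by (simp add: algebra_simps)
  finally show ?thesis .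
qed

text \<open>A closed interval of length 3 contains at most four integers. The window will hold the
  numbers of the columns (or rows) of cells that a short arc near a sample point can meet.\<close>

lemma card_nat_window:
  fixes u :: real
  shows "finite {i::nat. u - 2 \<le> i \<and> i \<le> u + 1}" "card {i::nat. u - 2 \<le> i \<and> i \<le> u + 1} \<le> 4"
proof -
  have sub: "int ` {i::nat. u - 2 \<le> i \<and> i \<le> u + 1} \<subseteq> {\<lceil>u - 2\<rceil>..\<lfloor>u + 1\<rfloor>}"
    by (auto simp del: ceiling_diff_numeral) linarith+
  then have "finite (int ` {i::nat. u - 2 \<le> i \<and> i \<le> u + 1})"
    by (rule finite_subset) simp
  then show "finite {i::nat. u - 2 \<le> i \<and> i \<le> u + 1}"
    by (rule finite_imageD) simp
  have "card (int ` {i::nat. u - 2 \<le> i \<and> i \<le> u + 1}) \<le> card {\<lceil>u - 2\<rceil>..\<lfloor>u + 1\<rfloor>}"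
    by (rule card_mono[OF _ sub]) simp
  also have "\<dots> \<le> 4"
    by simp linarith
  finally show "card {i::nat. u - 2 \<le> i \<and> i \<le> u + 1} \<le> 4"
    by (simp add: card_image)
qed

text \<open>Of the \<open>n\<^sup>2\<close> cells of a grid only \<open>O(n)\<close> meet the curve; each contributes at most
  its perimeter times the oscillation of \<open>f\<close>, i.e. \<open>o(1/n)\<close>.\<close>

lemma rect_int_eq_0:
  fixes \<gamma> :: "real \<Rightarrow> complex"
  assumes f: "continuous_on UNIV f" and hol: "f holomorphic_on - \<gamma> ` {0..1}"
    and lip: "\<And>s t. s \<in> {0..1} \<Longrightarrow> t \<in> {0..1} \<Longrightarrow> norm (\<gamma> s - \<gamma> t) \<le> L * \<bar>s - t\<bar>"
    and less: "a < b" "c < e"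
  shows "rect_int f a b c e = 0"
proof -
  define R where "R = cbox (Complex a c) (Complex b e)"
  \<comment> \<open>With \<open>K\<close> times as many parameter steps as grid columns,
    \<open>\<gamma>\<close> moves by at most one cell width and one cell height in each
    step.\<close>
  obtain K :: nat where K: "K > 0" "L \<le> K * (b - a)" "L \<le> K * (e - c)"
  proof -
    obtain K1 :: nat where "L / (b - a) \<le> K1" using real_arch_simple by blast
    moreover obtain K2 :: nat where "L / (e - c) \<le> K2" using real_arch_simple by blast
    ultimately have *: "L \<le> K1 * (b - a)" "L \<le> K2 * (e - c)"
      using less by (simp_all add: divide_simps mult.commute)
    have "real K1 * (b - a) \<le> real (Suc (K1 + K2)) * (b - a)"
      "real K2 * (e - c) \<le> real (Suc (K1 + K2)) * (e - c)"
      using less by (intro mult_right_mono; simp)+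
    with * show ?thesis by (intro that[of "Suc (K1 + K2)"]) linarith+
  qed
  \<comment> \<open>The constant 64 is 2 from the perimeter times 32: each of the
    \<open>P + 1 \<le> 2 * P\<close> sample points accounts for at most 4 times 4 cells.\<close>
  have bound: "norm (rect_int f a b c e) \<le> 64 * K * ((b - a) + (e - c)) * \<epsilon>" if "\<epsilon> > 0" for \<epsilon>
  proof -
    have "uniformly_continuous_on R f"
      unfolding R_def using f by (intro compact_uniformly_continuous) (auto intro: continuous_on_subset)
    then obtain \<delta> where \<delta>: "\<delta> > 0"
      "\<And>z z'. z \<in> R \<Longrightarrow> z' \<in> R \<Longrightarrow> dist z' z < \<delta> \<Longrightarrow> dist (f z') (f z) < \<epsilon>"
      using \<open>\<epsilon> > 0\<close> unfolding uniformly_continuous_on_def by metis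
    obtain n :: nat where n: "((b - a) + (e - c)) / \<delta> < n"
      using reals_Archimedean2 by blast
    then have n0: "n > 0"
      using less \<delta> by (cases n) (auto simp: divide_simps split: if_splits)
    define w where "w = (b - a) / n"
    define h where "h = (e - c) / n"
    have "w + h = ((b - a) + (e - c)) / n"
      unfolding w_def h_def by (rule add_divide_distrib[symmetric])
    also have "\<dots> < \<delta>"
      using n n0 \<delta>(1) by (simp only: pos_divide_less_eq of_nat_0_less_iff mult.commute)
    finally have wh: "w > 0" "h > 0" "w + h < \<delta>"
      using less n0 by (simp_all add: w_def h_def)
    define x where "x i = a + i * w" for i :: nat
    define y where "y j = c + j * h" for j :: nat
    have xn: "x 0 = a" "x n = b" "y 0 = c" "y n = e"
      using n0 by (simp_all add: x_def y_def w_def h_def)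
    have step: "x (Suc i) = x i + w" "y (Suc i) = y i + h" for i
      by (simp_all add: x_def y_def algebra_simps)
    define cell where "cell i j = cbox (Complex (x i) (y j)) (Complex (x (Suc i)) (y (Suc j)))" for i j
    have cellR: "cell i j \<subseteq> R" if "i < n" "j < n" for i j
    proof -
      have "real (Suc i) * w \<le> n * w" "real (Suc j) * h \<le> n * h" "0 \<le> real i * w" "0 \<le> real j * h"
        using that wh by (auto intro!: mult_right_mono simp del: of_nat_Suc)
      then have "a \<le> x i" "x (Suc i) \<le> b" "c \<le> y j" "y (Suc j) \<le> e"
        using n0 by (simp_all add: x_def y_def w_def h_def)
      then show ?thesis
        by (auto simp: cell_def R_def in_cbox_complex_iff)
    qed
    define B where "B = {(i, j). i < n \<and> j < n \<and> cell i j \<inter> \<gamma> ` {0..1} \<noteq> {}}"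
    define P where "P = n * K"
    have P0: "P > 0" using n0 K by (simp add: P_def)
    have LP: "L / P \<le> w" "L / P \<le> h"
      using K n0 by (simp_all add: P_def w_def h_def field_simps)
    \<comment> \<open>\<open>u p\<close> and \<open>v p\<close> are the coordinates of the sample
      point \<open>\<gamma> (p / P)\<close> measured in cells.\<close>
    define u where "u p = (Re (\<gamma> (p / P)) - a) / w" for p :: nat
    define v where "v p = (Im (\<gamma> (p / P)) - c) / h" for p :: nat
    define W where "W r = {i::nat. r - 2 \<le> i \<and> i \<le> r + 1}" for r :: real
    \<comment> \<open>Rounding \<open>t\<close> down to a multiple of \<open>1 / P\<close> moves the
      point by at most one cell in each coordinate, and the cell containing
      \<open>\<gamma> t\<close> begins up to one more cell before it. Hence the window from
      \<open>u p - 2\<close> to \<open>u p + 1\<close>.\<close>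
    have "B \<subseteq> (\<Union>p\<le>P. W (u p) \<times> W (v p))"
    proof
      fix ij assume "ij \<in> B"
      then obtain i j t where ij: "ij = (i, j)" "i < n" "j < n" "t \<in> {0..1}" "\<gamma> t \<in> cell i j"
        unfolding B_def by blast
      define p where "p = nat \<lfloor>t * P\<rfloor>"
      have p1: "real p \<le> t * P" "t * P \<le> p + 1"
        using ij(4) by (auto simp: p_def) (use floor_correct in linarith)
      have tP: "t * P \<le> P" using ij(4) by (simp add: mult_left_le_one_le)
      with p1(1) have pP: "p \<le> P" by linarith
      have pP1: "p / P \<in> {0..1}" using pP P0 by (simp add: divide_simps)
      have d: "\<bar>t - p / P\<bar> \<le> 1 / P"
      proof -
        have "\<bar>t - p / P\<bar> = \<bar>t * P - p\<bar> / P"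
          using P0 abs_divide[of "t * P - p" P] by (simp add: diff_divide_distrib)
        also have "\<dots> \<le> 1 / P"
          using p1 P0 by (intro divide_right_mono) (auto simp: abs_le_iff)
        finally show ?thesis .
      qed
      have "0 \<le> L" using order_trans[OF norm_ge_zero lip[of 0 1]] by simp
      have "norm (\<gamma> t - \<gamma> (p / P)) \<le> L * \<bar>t - p / P\<bar>"
        by (rule lip[OF ij(4) pP1])
      also have "\<dots> \<le> L * (1 / P)"
        using d \<open>0 \<le> L\<close> by (rule mult_left_mono)
      finally have nb: "norm (\<gamma> t - \<gamma> (p / P)) \<le> L / P" by simp
      then have "\<bar>Re (\<gamma> t) - Re (\<gamma> (p / P))\<bar> \<le> w" "\<bar>Im (\<gamma> t) - Im (\<gamma> (p / P))\<bar> \<le> h"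
        using abs_Re_le_cmod[of "\<gamma> t - \<gamma> (p / P)"] abs_Im_le_cmod[of "\<gamma> t - \<gamma> (p / P)"] LP by auto
      moreover have "x i \<le> Re (\<gamma> t)" "Re (\<gamma> t) \<le> x i + w" "y j \<le> Im (\<gamma> t)" "Im (\<gamma> t) \<le> y j + h"
        using ij(5) by (auto simp: cell_def step in_cbox_complex_iff)
      moreover have "Re (\<gamma> (p / P)) = a + u p * w" "Im (\<gamma> (p / P)) = c + v p * h"
        using wh by (simp_all add: u_def v_def)
      ultimately have "u p * w - w - w \<le> i * w" "i * w \<le> u p * w + w"
        "v p * h - h - h \<le> j * h" "j * h \<le> v p * h + h"
        unfolding x_def y_def by linarith+
      then have "(u p - 2) * w \<le> i * w" "i * w \<le> (u p + 1) * w"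
        "(v p - 2) * h \<le> j * h" "j * h \<le> (v p + 1) * h"
        by (simp_all add: algebra_simps)
      then have "i \<in> W (u p)" "j \<in> W (v p)"
        using wh by (simp_all add: W_def)
      with pP ij(1) show "ij \<in> (\<Union>p\<le>P. W (u p) \<times> W (v p))" by blast
    qed
    moreover have Wf: "finite (W r)" "card (W r) \<le> 4" for r
      unfolding W_def by (rule card_nat_window)+
    ultimately have "card B \<le> card (\<Union>p\<le>P. W (u p) \<times> W (v p))"
      by (intro card_mono) auto
    also have "\<dots> \<le> (\<Sum>p\<le>P. card (W (u p) \<times> W (v p)))"
      by (rule card_UN_le) simp
    also have "\<dots> \<le> (\<Sum>p\<le>P. 4 * 4)"
      unfolding card_cartesian_product by (intro sum_mono mult_mono Wf) auto
    also have "\<dots> \<le> 32 * P" using P0 by simp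
    finally have cardB: "card B \<le> 32 * P" .
    let ?r = "\<lambda>i j. rect_int f (x i) (x (Suc i)) (y j) (y (Suc j))"
    have le: "x i \<le> x (Suc i)" "y i \<le> y (Suc i)" for i using wh by (simp_all add: step)
    have zero: "?r i j = 0" if "cell i j \<inter> \<gamma> ` {0..1} = {}" for i j
      using that by (intro rect_int_holomorphic[OF f le] holomorphic_on_subset[OF hol])
        (auto simp: cell_def)
    have small: "norm (?r i j) \<le> 2 * (w + h) * \<epsilon>" if ij: "i < n" "j < n" for i j
    proof -
      have "norm (?r i j) \<le> 2 * ((x (Suc i) - x i) + (y (Suc j) - y j)) * \<epsilon>"
      proof (rule rect_int_bound[OF f le])
        fix z assume z: "z \<in> cbox (Complex (x i) (y j)) (Complex (x (Suc i)) (y (Suc j)))"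
        have z0: "Complex (x i) (y j) \<in> cell i j"
          using le by (simp add: cell_def in_cbox_complex_iff)
        have "dist z (Complex (x i) (y j)) \<le> \<bar>Re z - x i\<bar> + \<bar>Im z - y j\<bar>"
          unfolding dist_norm using cmod_le[of "z - Complex (x i) (y j)"] by simp
        also have "\<dots> \<le> w + h"
          using z by (auto simp: in_cbox_complex_iff step)
        finally have "dist (f z) (f (Complex (x i) (y j))) < \<epsilon>"
          using z z0 cellR[OF ij] wh by (intro \<delta>(2)) (auto simp: cell_def)
        then show "norm (f z - f (Complex (x i) (y j))) \<le> \<epsilon>" by (simp add: dist_norm)
      qed
      then show ?thesis by (simp add: step)
    qed
    have finB: "finite B"
      by (rule finite_subset[of _ "{..<n} \<times> {..<n}"]) (auto simp: B_def)
    have "rect_int f a b c e = (\<Sum>i<n. \<Sum>j<n. ?r i j)"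
      using rect_int_grid[OF f, of x n y n] by (simp add: xn)
    also have "\<dots> = (\<Sum>ij\<in>{..<n} \<times> {..<n}. ?r (fst ij) (snd ij))"
      by (simp add: sum.cartesian_product case_prod_unfold)
    also have "\<dots> = (\<Sum>ij\<in>B. ?r (fst ij) (snd ij))"
      by (rule sum.mono_neutral_right) (auto simp: B_def intro!: zero)
    also have "norm \<dots> \<le> (\<Sum>ij\<in>B. 2 * (w + h) * \<epsilon>)"
      using small by (intro sum_norm_le) (simp only: B_def mem_Collect_eq case_prod_beta)
    also have "\<dots> = real (card B) * (2 * (w + h) * \<epsilon>)" by simp
    also have "\<dots> \<le> real (32 * P) * (2 * (w + h) * \<epsilon>)"
      using cardB wh \<open>\<epsilon> > 0\<close> by (intro mult_right_mono) (simp_all only: of_nat_le_iff, auto)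
    also have "\<dots> = 64 * K * ((b - a) + (e - c)) * \<epsilon>"
      using n0 by (simp add: P_def w_def h_def field_simps)
    finally show ?thesis .
  qed
  define M where "M = 64 * K * ((b - a) + (e - c))"
  have M: "M > 0" using K less by (simp add: M_def)
  have "norm (rect_int f a b c e) \<le> 0 + \<eta>" if "\<eta> > 0" for \<eta>
    using bound[of "\<eta> / M"] that M unfolding M_def[symmetric] by simp
  then show ?thesis
    using field_le_epsilon[of "norm (rect_int f a b c e)" 0] by simp
qed

text \<open>Morera's theorem with rectangles. \<open>F\<close> integrates \<open>f\<close> from 0
  along a horizontal and then a vertical segment. Vanishing rectangle integrals turn
  \<open>F z' - F z\<close> into the integral over such a corner path from \<open>z\<close> to
  \<open>z'\<close>, so \<open>F\<close> is a primitive, and \<open>f\<close> is holomorphic as the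
  derivative of \<open>F\<close>.\<close>

theorem holomorphic_off_lipschitz_curve:
  fixes \<gamma> :: "real \<Rightarrow> complex"
  assumes f: "continuous_on UNIV f" and hol: "f holomorphic_on - \<gamma> ` {0..1}"
    and lip: "\<And>s t. s \<in> {0..1} \<Longrightarrow> t \<in> {0..1} \<Longrightarrow> norm (\<gamma> s - \<gamma> t) \<le> L * \<bar>s - t\<bar>"
  shows "f holomorphic_on UNIV"
proof -
  \<comment> \<open>Sign flips extend the vanishing to corners in any order, since \<open>z\<close>
    may lie in any quadrant.\<close>
  have rect: "rect_int f a b c e = 0" for a b c e
  proof -
    have *: "rect_int f a b c e = 0" if "a \<le> b" "c \<le> e" for a b c e
    proof (cases "a = b \<or> c = e")
      case True
      then show ?thesis
        using rect_int_flip(1)[of f a a c e] rect_int_flip(2)[of f a b c c] by auto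
    next
      case False
      then show ?thesis using rect_int_eq_0[OF f hol lip, of a b c e] that by auto
    qed
    show ?thesis
      using *[of a b c e] *[of b a c e] *[of a b e c] *[of b a e c]
        rect_int_flip(1)[of f b a c e] rect_int_flip(2)[of f a b e c] rect_int_flip(1)[of f a b e c]
      by (cases "a \<le> b"; cases "c \<le> e") auto
  qed
  define F where "F z = seg_int f 0 (Complex (Re z) 0) + seg_int f (Complex (Re z) 0) z" for z
  have diff: "F z' - F z = seg_int f z (Complex (Re z') (Im z)) + seg_int f (Complex (Re z') (Im z)) z'"
    for z z'
  proof -
    note h = seg_int_horizontal[OF f, of 0 0 "Re z" "Re z'"]
    note v = seg_int_vertical[OF f, of "Re z'" 0 "Im z" "Im z'"]
    have rearrange: "p + q = r + s" if "p + q + - s + - r = 0" for p q r s :: complex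
    proof -
      have "p + q = (p + q + - s + - r) + (r + s)" by simp
      with that show ?thesis by simp
    qed
    have "rect_int f (Re z) (Re z') 0 (Im z) = 0" by (rule rect)
    then have "seg_int f (Complex (Re z) 0) (Complex (Re z') 0) +
        seg_int f (Complex (Re z') 0) (Complex (Re z') (Im z)) =
        seg_int f (Complex (Re z) 0) z + seg_int f z (Complex (Re z') (Im z))"
      unfolding rect_int_def complex_surj seg_int_reverse[of f "Complex (Re z') (Im z)" z]
        seg_int_reverse[of f z "Complex (Re z) 0"]
      by (rule rearrange)
    then show ?thesis
      unfolding F_def h[unfolded zero_complex.code[symmetric], symmetric] v[unfolded complex_surj, symmetric]
      by (simp add: algebra_simps)
  qed
  have "(F has_field_derivative f z) (at z)" for z
    unfolding has_field_derivative_def has_derivative_at_alt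
  proof (intro conjI allI impI)
    show "bounded_linear ((*) (f z))" by (rule bounded_linear_mult_right)
    fix \<epsilon> :: real assume "\<epsilon> > 0"
    have "isCont f z" using f by (simp add: continuous_on_eq_continuous_at)
    \<comment> \<open>Half of \<open>\<epsilon>\<close> for each of the two legs of the corner
      path.\<close>
    then obtain \<delta> where \<delta>: "\<delta> > 0" "\<And>y. dist y z < \<delta> \<Longrightarrow> dist (f y) (f z) < \<epsilon> / 2"
      using \<open>\<epsilon> > 0\<close> unfolding continuous_at_eps_delta by (meson half_gt_zero)
    show "\<exists>\<delta>>0. \<forall>z'. norm (z' - z) < \<delta> \<longrightarrow>
            norm (F z' - F z - f z * (z' - z)) \<le> \<epsilon> * norm (z' - z)"
    proof (intro exI[of _ \<delta>] conjI allI impI \<delta>(1))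
      fix z' assume z': "norm (z' - z) < \<delta>"
      let ?m = "Complex (Re z') (Im z)"
      have int: "h contour_integrable_on linepath u v" if "continuous_on UNIV h" for u v h
        using that by (intro contour_integrable_continuous_linepath) (auto intro: continuous_on_subset)
      have cont: "continuous_on UNIV (\<lambda>y. f y - f z)"
        by (intro continuous_intros f)
      have seg: "seg_int f u v = seg_int (\<lambda>y. f y - f z) u v + f z * (v - u)" for u v
        using contour_integral_diff[OF int[OF f, of u v] int[of "\<lambda>_. f z" u v]]
        by (simp add: seg_int_def)
      have m: "norm (?m - z) \<le> norm (z' - z)" "norm (z' - ?m) \<le> norm (z' - z)"
        using abs_Re_le_cmod[of "z' - z"] abs_Im_le_cmod[of "z' - z"] by (simp_all add: cmod_def)
      have near: "norm (f y - f z) \<le> \<epsilon> / 2" if "y \<in> ball z \<delta>" for y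
        using \<delta>(2)[of y] that by (simp add: dist_norm norm_minus_commute)
      have ball: "z \<in> ball z \<delta>" "?m \<in> ball z \<delta>" "z' \<in> ball z \<delta>"
        using m z' \<delta>(1) by (simp_all add: dist_norm norm_minus_commute)
      have bd: "norm (seg_int (\<lambda>y. f y - f z) u v) \<le> (\<epsilon> / 2) * norm (v - u)"
        if "u \<in> ball z \<delta>" "v \<in> ball z \<delta>" for u v
      unfolding seg_int_def
      proof (rule contour_integral_bound_linepath[OF int[OF cont]])
        show "norm (f y - f z) \<le> \<epsilon> / 2" if "y \<in> closed_segment u v" for y
          using that closed_segment_subset[OF \<open>u \<in> _\<close> \<open>v \<in> _\<close> convex_ball] near by blast
      qed (use \<open>\<epsilon> > 0\<close> in simp)
      have "F z' - F z - f z * (z' - z) =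
              seg_int (\<lambda>y. f y - f z) z ?m + seg_int (\<lambda>y. f y - f z) ?m z'"
        unfolding diff seg[of z ?m] seg[of ?m z'] by (simp add: algebra_simps)
      also have "norm \<dots> \<le> (\<epsilon> / 2) * norm (?m - z) + (\<epsilon> / 2) * norm (z' - ?m)"
        by (intro norm_triangle_mono bd ball)
      also have "\<dots> \<le> (\<epsilon> / 2) * norm (z' - z) + (\<epsilon> / 2) * norm (z' - z)"
        using m \<open>\<epsilon> > 0\<close> by (intro add_mono mult_left_mono) auto
      finally show "norm (F z' - F z - f z * (z' - z)) \<le> \<epsilon> * norm (z' - z)"
        by simp
    qed
  qed
  then have "F holomorphic_on UNIV" "deriv F = f"
    by (auto simp: holomorphic_on_def field_differentiable_def
        intro: has_field_derivative_at_within DERIV_imp_deriv)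
  then show ?thesis
    using holomorphic_deriv[of F UNIV] by simp
qed

section \<open>Continuous matrix functions with a holomorphic continuation\<close>

text \<open>\<open>K\<close> is a closed domain and \<open>U\<close> its open part. The pair is kept
  abstract because the notion serves the interior in the coordinate \<open>z\<close> and the
  exterior in the coordinate \<open>1/z\<close>.\<close>

definition cont_holo :: "complex set \<Rightarrow> complex set \<Rightarrow> (complex \<Rightarrow> complex) \<Rightarrow> bool" where
  "cont_holo K U f \<longleftrightarrow> continuous_on K f \<and> f holomorphic_on U"

lemma cont_holo_const: "cont_holo K U (\<lambda>_. c)"
  by (simp add: cont_holo_def)

lemma cont_holo_mult: "cont_holo K U f \<Longrightarrow> cont_holo K U h \<Longrightarrow> cont_holo K U (\<lambda>z. f z * h z)"
  by (auto simp: cont_holo_def intro!: continuous_intros holomorphic_intros)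

lemma cont_holo_power: "cont_holo K U f \<Longrightarrow> cont_holo K U (\<lambda>z. f z ^ n)"
  by (auto simp: cont_holo_def intro!: continuous_intros holomorphic_intros)

lemma cont_holo_ident: "cont_holo K U (\<lambda>z. z)"
  by (simp add: cont_holo_def)

lemma cont_holo_sum: "(\<And>i. i \<in> I \<Longrightarrow> cont_holo K U (f i)) \<Longrightarrow> cont_holo K U (\<lambda>z. \<Sum>i\<in>I. f i z)"
  by (auto simp: cont_holo_def intro!: continuous_intros holomorphic_intros)

lemma cont_holo_prod: "(\<And>i. i \<in> I \<Longrightarrow> cont_holo K U (f i)) \<Longrightarrow> cont_holo K U (\<lambda>z. \<Prod>i\<in>I. f i z)"
  by (auto simp: cont_holo_def intro!: continuous_intros holomorphic_intros)

lemma cont_holo_inverse: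
  assumes "cont_holo K U f" "U \<subseteq> K" "\<And>z. z \<in> K \<Longrightarrow> f z \<noteq> 0"
  shows "cont_holo K U (\<lambda>z. inverse (f z))"
  using assms by (auto simp: cont_holo_def intro!: continuous_intros holomorphic_intros)

lemma cont_holo_cong:
  assumes "cont_holo K U f" "U \<subseteq> K" "\<And>z. z \<in> K \<Longrightarrow> h z = f z"
  shows "cont_holo K U h"
  using assms continuous_on_cong[of K K h f] holomorphic_cong[of U U h f]
  by (auto simp: cont_holo_def)

definition cont_holo_mat :: "complex set \<Rightarrow> complex set \<Rightarrow> nat \<Rightarrow> (complex \<Rightarrow> complex mat) \<Rightarrow> bool" where
  "cont_holo_mat K U m F \<longleftrightarrow> (\<forall>z\<in>K. F z \<in> carrier_mat m m) \<and>
     (\<forall>i<m. \<forall>j<m. cont_holo K U (\<lambda>z. F z $$ (i, j)))"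

definition regular_mat :: "complex set \<Rightarrow> complex set \<Rightarrow> nat \<Rightarrow> (complex \<Rightarrow> complex mat) \<Rightarrow> bool" where
  "regular_mat K U m F \<longleftrightarrow> cont_holo_mat K U m F \<and> (\<forall>z\<in>K. invertible_mat (F z))"

lemma regular_mat_carrier: "regular_mat K U m F \<Longrightarrow> z \<in> K \<Longrightarrow> F z \<in> carrier_mat m m"
  and regular_mat_invertible: "regular_mat K U m F \<Longrightarrow> z \<in> K \<Longrightarrow> invertible_mat (F z)"
  and regular_mat_entry:
    "regular_mat K U m F \<Longrightarrow> i < m \<Longrightarrow> j < m \<Longrightarrow> cont_holo K U (\<lambda>z. F z $$ (i, j))"
  by (auto simp: regular_mat_def cont_holo_mat_def)

lemma cont_holo_mat_mult:
  assumes "cont_holo_mat K U m F" "cont_holo_mat K U m H" "U \<subseteq> K"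
  shows "cont_holo_mat K U m (\<lambda>z. F z * H z)"
  unfolding cont_holo_mat_def
proof (intro conjI ballI allI impI)
  fix i j assume ij: "i < m" "j < m"
  have "cont_holo K U (\<lambda>z. \<Sum>k<m. F z $$ (i, k) * H z $$ (k, j))"
    using assms ij by (intro cont_holo_sum cont_holo_mult) (auto simp: cont_holo_mat_def)
  then show "cont_holo K U (\<lambda>z. (F z * H z) $$ (i, j))"
    using assms ij
    by (elim cont_holo_cong) (auto simp: cont_holo_mat_def intro!: index_mult_mat_sum)
qed (use assms in \<open>auto simp: cont_holo_mat_def intro!: mult_carrier_mat\<close>)

lemma regular_mat_mult:
  assumes "regular_mat K U m F" "regular_mat K U m H" "U \<subseteq> K"
  shows "regular_mat K U m (\<lambda>z. F z * H z)"
  using assms cont_holo_mat_mult[of K U m F H]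
  by (auto simp: regular_mat_def cont_holo_mat_def intro!: invertible_mat_mult[of _ m])

lemma regular_mat_const:
  "C \<in> carrier_mat m m \<Longrightarrow> invertible_mat C \<Longrightarrow> regular_mat K U m (\<lambda>_. C)"
  by (auto simp: regular_mat_def cont_holo_mat_def cont_holo_const)

lemma permutes_less: "p permutes {0..<m} \<Longrightarrow> i < m \<Longrightarrow> p i < (m::nat)"
  using permutes_in_image[of p "{0..<m}" i] by simp

lemma cont_holo_det:
  assumes "cont_holo_mat K U m F" "U \<subseteq> K"
  shows "cont_holo K U (\<lambda>z. Determinant.det (F z))"
proof -
  have "cont_holo K U (\<lambda>z. \<Sum>p\<in>{p. p permutes {0..<m}}. signof p * (\<Prod>i = 0..<m. F z $$ (i, p i)))"
    using assms(1)
    by (intro cont_holo_sum cont_holo_mult cont_holo_prod cont_holo_const)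
      (auto simp: cont_holo_mat_def permutes_less)
  then show ?thesis
    using assms by (elim cont_holo_cong) (auto simp: cont_holo_mat_def intro!: det_def')
qed

text \<open>The entries of the inverse are cofactors divided by the determinant, that is,
  polynomials in the entries of \<open>F\<close> over a function without zeros on
  \<open>K\<close>.\<close>

lemma regular_mat_inverse:
  assumes F: "regular_mat K U m F" and U: "U \<subseteq> K"
  obtains E where "regular_mat K U m E"
    and "\<And>z. z \<in> K \<Longrightarrow> E z * F z = 1\<^sub>m m" and "\<And>z. z \<in> K \<Longrightarrow> F z * E z = 1\<^sub>m m"
proof -
  have Fm: "cont_holo_mat K U m F" and c: "\<And>z. z \<in> K \<Longrightarrow> F z \<in> carrier_mat m m"
    using F by (auto simp: regular_mat_def cont_holo_mat_def)
  have det: "Determinant.det (F z) \<noteq> 0" if "z \<in> K" for z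
    using F that invertible_mat_iff_det[OF c[OF that]] by (auto simp: regular_mat_def)
  define E where "E z = inverse (Determinant.det (F z)) \<cdot>\<^sub>m adj_mat (F z)" for z
  have E: "E z \<in> carrier_mat m m" "E z * F z = 1\<^sub>m m" "F z * E z = 1\<^sub>m m" if z: "z \<in> K" for z
    using adj_mat[OF c[OF z]] det[OF z] c[OF z]
    by (auto simp: E_def mult_smult_distrib[OF c[OF z]] mult_smult_assoc_mat[of _ m m _ m] intro!: eq_matI)
  have "cont_holo K U (\<lambda>z. E z $$ (i, j))" if ij: "i < m" "j < m" for i j
  proof -
    have "cont_holo_mat K U (m - 1) (\<lambda>z. mat_delete (F z) j i)"
      unfolding cont_holo_mat_def
    proof (intro conjI ballI allI impI)
      show "mat_delete (F z) j i \<in> carrier_mat (m - 1) (m - 1)" if "z \<in> K" for z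
        using c[OF that] by (auto simp: mat_delete_def)
      fix i' j' assume ij': "i' < m - 1" "j' < m - 1"
      let ?i = "if i' < j then i' else Suc i'" and ?j = "if j' < i then j' else Suc j'"
      have "cont_holo K U (\<lambda>z. F z $$ (?i, ?j))"
        using Fm ij ij' by (auto simp: cont_holo_mat_def)
      then show "cont_holo K U (\<lambda>z. mat_delete (F z) j i $$ (i', j'))"
        using U ij' c by (elim cont_holo_cong) (auto simp: mat_delete_def dest!: c)
    qed
    then have "cont_holo K U (\<lambda>z. inverse (Determinant.det (F z)) *
        ((-1) ^ (j + i) * Determinant.det (mat_delete (F z) j i)))"
      using U det by (intro cont_holo_mult cont_holo_inverse cont_holo_det[OF Fm] cont_holo_const
          cont_holo_det[of K U "m - 1"]) auto
    then show ?thesis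
      using U ij c by (elim cont_holo_cong) (auto simp: E_def adj_mat_def cofactor_def dest!: c)
  qed
  then have "regular_mat K U m E"
    unfolding regular_mat_def cont_holo_mat_def
    using E c invertible_mat_iff_inverse by (metis (no_types, lifting))
  with E show ?thesis by (intro that) auto
qed

section \<open>The exterior domain in the coordinate at infinity\<close>

text \<open>The closed exterior in the coordinate \<open>w = 1/z\<close>, with infinity at
  \<open>w = 0\<close>. In HOL \<open>inverse 0 = 0\<close>, so this point has to be added by hand;
  when the origin lies inside the contour there is no clash.\<close>

definition minus_closed :: "complex set \<Rightarrow> complex set" where
  "minus_closed \<Gamma> = {w. w = 0 \<or> inverse w \<in> \<Gamma> \<union> outside \<Gamma>}"

definition minus_open :: "complex set \<Rightarrow> complex set" where
  "minus_open \<Gamma> = {w. w = 0 \<or> inverse w \<in> outside \<Gamma>}"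

lemma minus_open_subset: "minus_open \<Gamma> \<subseteq> minus_closed \<Gamma>"
  by (auto simp: minus_open_def minus_closed_def)

lemma zero_notin_outside:
  assumes "0 \<in> inside \<Gamma>"
  shows "(0::complex) \<notin> \<Gamma> \<union> outside \<Gamma>"
  using assms inside_Int_outside[of \<Gamma>] inside_no_overlap[of \<Gamma>] by blast

text \<open>If \<open>S\<close> contained 0, the set would contain 0 as well, because
  \<open>inverse 0 = 0\<close>, and it could fail to be open there.\<close>

lemma open_inverse_vimage:
  fixes S :: "complex set"
  assumes "open S" "0 \<notin> S"
  shows "open {w. inverse w \<in> S}"
proof -
  have "open ((- {0}) \<inter> inverse -` S)"
    using assms(1) by (intro continuous_open_preimage continuous_intros) auto
  moreover have "(- {0}) \<inter> inverse -` S = {w. inverse w \<in> S}"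
    using assms(2) by auto
  ultimately show ?thesis by simp
qed

text \<open>The outside of a compact set contains all points of large modulus, so small nonzero
  \<open>w\<close> have their inverse there.\<close>

lemma minus_open_ball:
  assumes "compact \<Gamma>"
  obtains \<epsilon> where "\<epsilon> > 0" "ball 0 \<epsilon> \<subseteq> minus_open \<Gamma>"
proof -
  obtain B where B: "B > 0" "\<And>z. z \<in> - outside \<Gamma> \<Longrightarrow> norm z \<le> B"
    using cobounded_outside[OF compact_imp_bounded[OF assms]] by (auto simp: bounded_pos)
  have "w \<in> minus_open \<Gamma>" if "norm w < inverse B" for w
  proof (cases "w = 0")
    case False
    then have "inverse (inverse B) < inverse (norm w)"
      using that by (intro less_imp_inverse_less) auto
    then have "B < norm (inverse w)"
      using B(1) by (simp add: norm_inverse)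
    then have "inverse w \<in> outside \<Gamma>" using B(2)[of "inverse w"] by (auto simp: not_le)
    then show ?thesis by (simp add: minus_open_def)
  qed (simp add: minus_open_def)
  then show ?thesis using B(1) by (intro that[of "inverse B"]) auto
qed

lemma open_minus_open:
  assumes "compact \<Gamma>" "0 \<in> inside \<Gamma>"
  shows "open (minus_open \<Gamma>)"
proof -
  obtain \<epsilon> where \<epsilon>: "\<epsilon> > 0" "ball 0 \<epsilon> \<subseteq> minus_open \<Gamma>" by (rule minus_open_ball[OF assms(1)])
  have "minus_open \<Gamma> = ball 0 \<epsilon> \<union> {w. inverse w \<in> outside \<Gamma>}"
    using \<epsilon> by (auto simp: minus_open_def)
  then show ?thesis
    using assms zero_notin_outside[OF assms(2)]
    by (auto intro!: open_Un open_inverse_vimage open_outside compact_imp_closed)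
qed

lemma plus_factor_iff:
  "plus_factor \<Gamma> m B \<longleftrightarrow>
     (\<exists>H. (\<forall>t\<in>\<Gamma>. H t = B t) \<and> regular_mat (\<Gamma> \<union> inside \<Gamma>) (inside \<Gamma>) m H)"
  unfolding plus_factor_def regular_mat_def cont_holo_mat_def cont_holo_def by blast

text \<open>Two descriptions are glued: near 0 the assumed analyticity, away from 0 composition with
  \<open>inverse\<close>. Both pieces are relatively open in the closed exterior, so continuity on
  each suffices.\<close>

lemma cont_holo_at_infinity:
  assumes \<Gamma>: "compact \<Gamma>" "0 \<in> inside \<Gamma>"
    and f: "continuous_on (\<Gamma> \<union> outside \<Gamma>) f" "f holomorphic_on outside \<Gamma>"
    and an: "(\<lambda>w. if w = 0 then l else f (inverse w)) analytic_on {0}"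
  shows "cont_holo (minus_closed \<Gamma>) (minus_open \<Gamma>) (\<lambda>w. if w = 0 then l else f (inverse w))"
    (is "cont_holo _ _ ?h")
proof -
  note z = zero_notin_outside[OF \<Gamma>(2)]
  obtain \<epsilon> where \<epsilon>: "\<epsilon> > 0" "?h holomorphic_on ball 0 \<epsilon>"
    using an by (auto simp: analytic_on_def)
  obtain \<delta> where \<delta>: "\<delta> > 0" "ball 0 \<delta> \<subseteq> minus_open \<Gamma>" by (rule minus_open_ball[OF \<Gamma>(1)])
  define B where "B = ball (0::complex) (min \<epsilon> \<delta>)"
  define S where "S = {w. inverse w \<in> \<Gamma> \<union> outside \<Gamma>}"
  define T where "T = {w. inverse w \<in> outside \<Gamma>}"
  have B: "open B" "0 \<in> B" "B \<subseteq> minus_open \<Gamma>" "?h holomorphic_on B"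
    using \<epsilon> \<delta> by (auto simp: B_def intro!: holomorphic_on_subset[OF \<epsilon>(2)])
  have K: "minus_closed \<Gamma> = B \<union> S" and U: "minus_open \<Gamma> = B \<union> T"
    using B minus_open_subset by (auto simp: minus_closed_def minus_open_def S_def T_def)
  have S0: "0 \<notin> S" and T0: "0 \<notin> T" using z by (auto simp: S_def T_def)
  have "continuous_on S (\<lambda>w. f (inverse w))"
    using S0 by (intro continuous_on_compose2[OF f(1)] continuous_intros) (auto simp: S_def)
  then have "continuous_on S ?h"
    using S0 by (subst continuous_on_cong[OF refl, of _ _ "\<lambda>w. f (inverse w)"]) auto
  moreover have "openin (top_of_set (B \<union> S)) B"
    using B(1) openin_open_Int[of B "B \<union> S"] by (simp add: Int_absorb1)
  moreover have "openin (top_of_set (B \<union> S)) S"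
  proof -
    have "S = (B \<union> S) \<inter> (- {0})" using S0 B by (auto simp: S_def minus_open_def)
    then show ?thesis using openin_open_Int[of "- {0}" "B \<union> S"] by auto
  qed
  ultimately have 1: "continuous_on (minus_closed \<Gamma>) ?h"
    unfolding K using holomorphic_on_imp_continuous_on[OF B(4)]
    by (intro continuous_on_Un_local_open)
  have "(f \<circ> inverse) holomorphic_on T"
    using T0 by (intro holomorphic_on_compose_gen[OF _ f(2)] holomorphic_intros) (auto simp: T_def)
  then have "?h holomorphic_on T"
    by (rule holomorphic_transform) (use T0 in auto)
  moreover have "open T"
    unfolding T_def using z \<Gamma> by (intro open_inverse_vimage open_outside compact_imp_closed) auto
  ultimately have "?h holomorphic_on minus_open \<Gamma>"
    unfolding U using B by (intro holomorphic_on_Un)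
  with 1 show ?thesis by (simp add: cont_holo_def)
qed

text \<open>Merges the continuation and its value at infinity into one function of
  \<open>w = 1/z\<close>, so that products and inverses of minus factors are treated exactly like
  those of plus factors.\<close>

lemma minus_factor_iff:
  assumes \<Gamma>: "compact \<Gamma>" "0 \<in> inside \<Gamma>"
  shows "minus_factor \<Gamma> m B \<longleftrightarrow>
     (\<exists>H. (\<forall>t\<in>\<Gamma>. H (inverse t) = B t) \<and> regular_mat (minus_closed \<Gamma>) (minus_open \<Gamma>) m H)"
proof
  note z = zero_notin_outside[OF \<Gamma>(2)]
  assume "minus_factor \<Gamma> m B"
  then obtain F L where F: "\<forall>t\<in>\<Gamma>. F t = B t"
    "\<forall>z\<in>\<Gamma> \<union> outside \<Gamma>. F z \<in> carrier_mat m m \<and> invertible_mat (F z)"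
    "L \<in> carrier_mat m m" "invertible_mat L"
    and entries: "\<forall>i<m. \<forall>j<m. continuous_on (\<Gamma> \<union> outside \<Gamma>) (\<lambda>z. F z $$ (i, j)) \<and>
       (\<lambda>z. F z $$ (i, j)) holomorphic_on outside \<Gamma> \<and>
       (\<lambda>w. if w = 0 then L $$ (i, j) else F (inverse w) $$ (i, j)) analytic_on {0}"
    unfolding minus_factor_def by blast
  define H where "H w = (if w = 0 then L else F (inverse w))" for w
  have "cont_holo (minus_closed \<Gamma>) (minus_open \<Gamma>) (\<lambda>w. H w $$ (i, j))" if "i < m" "j < m" for i j
  proof -
    have "cont_holo (minus_closed \<Gamma>) (minus_open \<Gamma>)
        (\<lambda>w. if w = 0 then L $$ (i, j) else F (inverse w) $$ (i, j))"
      using entries that by (intro cont_holo_at_infinity[OF \<Gamma>]) auto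
    then show ?thesis unfolding H_def if_distrib[of "\<lambda>M. M $$ (i, j)"] .
  qed
  moreover have "H w \<in> carrier_mat m m \<and> invertible_mat (H w)" if "w \<in> minus_closed \<Gamma>" for w
    using that F(2-4) by (auto simp: H_def minus_closed_def)
  moreover have "H (inverse t) = B t" if "t \<in> \<Gamma>" for t
    using that z F(1) by (auto simp: H_def)
  ultimately show "\<exists>H. (\<forall>t\<in>\<Gamma>. H (inverse t) = B t) \<and> regular_mat (minus_closed \<Gamma>) (minus_open \<Gamma>) m H"
    unfolding regular_mat_def cont_holo_mat_def by blast
next
  note z = zero_notin_outside[OF \<Gamma>(2)]
  assume "\<exists>H. (\<forall>t\<in>\<Gamma>. H (inverse t) = B t) \<and> regular_mat (minus_closed \<Gamma>) (minus_open \<Gamma>) m H"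
  then obtain H where H: "\<And>t. t \<in> \<Gamma> \<Longrightarrow> H (inverse t) = B t"
    "\<And>w. w \<in> minus_closed \<Gamma> \<Longrightarrow> H w \<in> carrier_mat m m" "\<And>w. w \<in> minus_closed \<Gamma> \<Longrightarrow> invertible_mat (H w)"
    "\<And>i j. i < m \<Longrightarrow> j < m \<Longrightarrow> continuous_on (minus_closed \<Gamma>) (\<lambda>w. H w $$ (i, j))"
    "\<And>i j. i < m \<Longrightarrow> j < m \<Longrightarrow> (\<lambda>w. H w $$ (i, j)) holomorphic_on minus_open \<Gamma>"
    unfolding regular_mat_def cont_holo_mat_def cont_holo_def by blast
  have out: "inverse z \<in> minus_closed \<Gamma>" if "z \<in> \<Gamma> \<union> outside \<Gamma>" for z
    using that by (simp add: minus_closed_def)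
  have out': "inverse z \<in> minus_open \<Gamma>" if "z \<in> outside \<Gamma>" for z
    using that by (simp add: minus_open_def)
  have 0: "0 \<in> minus_closed \<Gamma>" "0 \<in> minus_open \<Gamma>" by (simp_all add: minus_closed_def minus_open_def)
  show "minus_factor \<Gamma> m B"
    unfolding minus_factor_def
  proof (intro exI[of _ "\<lambda>z. H (inverse z)"] exI[of _ "H 0"] conjI ballI allI impI)
    fix i j assume ij: "i < m" "j < m"
    show "continuous_on (\<Gamma> \<union> outside \<Gamma>) (\<lambda>z. H (inverse z) $$ (i, j))"
      using z out by (intro continuous_on_compose2[OF H(4)[OF ij]] continuous_intros) auto
    have "((\<lambda>w. H w $$ (i, j)) \<circ> inverse) holomorphic_on outside \<Gamma>"
      using z out' by (intro holomorphic_on_compose_gen[OF _ H(5)[OF ij]] holomorphic_intros) auto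
    then show "(\<lambda>z. H (inverse z) $$ (i, j)) holomorphic_on outside \<Gamma>" by (simp add: o_def)
    have "(\<lambda>w. H w $$ (i, j)) analytic_on {0}"
      using H(5)[OF ij] open_minus_open[OF \<Gamma>] 0 by (auto simp: analytic_at)
    moreover have "(\<lambda>w. if w = 0 then H 0 $$ (i, j) else H (inverse (inverse w)) $$ (i, j)) =
        (\<lambda>w. H w $$ (i, j))" by auto
    ultimately show "(\<lambda>w. if w = 0 then H 0 $$ (i, j) else H (inverse (inverse w)) $$ (i, j))
        analytic_on {0}" by simp
  qed (use H(1-3) out 0 in auto)
qed

section \<open>Uniqueness of the partial indices\<close>

lemma smooth_contour_lipschitz:
  assumes "smooth_contour \<gamma>"
  obtains L where "\<And>s t. s \<in> {0..1} \<Longrightarrow> t \<in> {0..1} \<Longrightarrow> norm (\<gamma> s - \<gamma> t) \<le> L * \<bar>s - t\<bar>"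
proof -
  obtain D where D: "continuous_on {0..1} D"
    "\<And>x. x \<in> {0..1} \<Longrightarrow> (\<gamma> has_vector_derivative D x) (at x within {0..1})"
    using assms by (auto simp: smooth_contour_def)
  have "bounded (D ` {0..1})"
    by (intro compact_imp_bounded compact_continuous_image D(1)) simp
  then obtain L where "\<forall>y\<in>D ` {0..1}. norm y \<le> L"
    unfolding bounded_iff by blast
  then have L: "\<And>x. x \<in> {0..1} \<Longrightarrow> norm (D x) \<le> L" by simp
  have "norm (\<gamma> s - \<gamma> t) \<le> L * norm (s - t)" if "s \<in> {0..1}" "t \<in> {0..1}" for s t
  proof (rule differentiable_bound[of "{0..1}" \<gamma> "\<lambda>x h. h *\<^sub>R D x"])
    show "(\<gamma> has_derivative (\<lambda>h. h *\<^sub>R D x)) (at x within {0..1})" if "x \<in> {0..1}" for x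
      using D(2)[OF that] by (simp add: has_vector_derivative_def)
    show "onorm (\<lambda>h. h *\<^sub>R D x) \<le> L" if "x \<in> {0..1}" for x
    proof (rule onorm_bound)
      show "0 \<le> L" using order_trans[OF norm_ge_zero L[OF that]] .
      show "norm (h *\<^sub>R D x) \<le> L * norm h" for h
        using mult_right_mono[OF L[OF that] abs_ge_zero[of h]] by (simp add: mult.commute)
    qed
  qed (use that in auto)
  then show ?thesis by (intro that) simp
qed

lemma smooth_contour_path:
  assumes "smooth_contour \<gamma>"
  shows "path \<gamma>" "compact (path_image \<gamma>)" "path_image \<gamma> \<noteq> {}"
  using assms by (auto simp: smooth_contour_def simple_path_imp_path compact_path_image)

text \<open>The condition \<open>h 0 = 0\<close> says that the exterior function vanishes at
  infinity; boundedness alone would only make the glued entire function constant.\<close>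

lemma Liouville_across_contour:
  assumes \<gamma>: "smooth_contour \<gamma>" and \<Gamma>: "\<Gamma> = path_image \<gamma>" "0 \<in> inside \<Gamma>"
    and f: "cont_holo (\<Gamma> \<union> inside \<Gamma>) (inside \<Gamma>) f"
    and h: "cont_holo (minus_closed \<Gamma>) (minus_open \<Gamma>) h" "h 0 = 0"
    and eq: "\<And>t. t \<in> \<Gamma> \<Longrightarrow> f t = h (inverse t)" and t: "t \<in> \<Gamma>"
  shows "f t = 0"
proof -
  have cp: "compact \<Gamma>" and cl: "closed \<Gamma>"
    using smooth_contour_path[OF \<gamma>] \<Gamma> compact_imp_closed by auto
  note z = zero_notin_outside[OF \<Gamma>(2)]
  let ?F = "\<lambda>z. if z \<in> \<Gamma> \<union> inside \<Gamma> then f z else h (inverse z)"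
  \<comment> \<open>On the contour both formulas agree, so the exterior formula is valid up to and
    including it.\<close>
  have Fout: "?F z = h (inverse z)" if "z \<in> \<Gamma> \<union> outside \<Gamma>" for z
  proof -
    have "z \<in> \<Gamma>" if "z \<in> \<Gamma> \<union> inside \<Gamma>"
      using that \<open>z \<in> \<Gamma> \<union> outside \<Gamma>\<close> inside_Int_outside[of \<Gamma>] by blast
    then show ?thesis using eq[of z] by auto
  qed
  have hc: "continuous_on (minus_closed \<Gamma>) h" and hh: "h holomorphic_on minus_open \<Gamma>"
    using h(1) by (auto simp: cont_holo_def)
  have c2: "continuous_on (\<Gamma> \<union> outside \<Gamma>) (\<lambda>z. h (inverse z))"
    using z by (intro continuous_on_compose2[OF hc] continuous_intros) (auto simp: minus_closed_def)
  have "continuous_on ((\<Gamma> \<union> inside \<Gamma>) \<union> (\<Gamma> \<union> outside \<Gamma>)) ?F"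
  proof (rule continuous_on_closed_Un)
    show "closed (\<Gamma> \<union> inside \<Gamma>)" "closed (\<Gamma> \<union> outside \<Gamma>)"
      using cl by (simp_all add: union_with_inside union_with_outside open_inside open_outside closed_Compl)
    show "continuous_on (\<Gamma> \<union> inside \<Gamma>) ?F"
      using f by (subst continuous_on_cong[OF refl, of _ _ f]) (auto simp: cont_holo_def)
    show "continuous_on (\<Gamma> \<union> outside \<Gamma>) ?F"
      by (rule continuous_on_eq[OF c2 Fout[symmetric]])
  qed
  moreover have "(\<Gamma> \<union> inside \<Gamma>) \<union> (\<Gamma> \<union> outside \<Gamma>) = UNIV"
    using inside_Un_outside[of \<Gamma>] by blast
  ultimately have cont: "continuous_on UNIV ?F" by simp
  have "(h \<circ> inverse) holomorphic_on outside \<Gamma>"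
    using z by (intro holomorphic_on_compose_gen[OF _ hh] holomorphic_intros) (auto simp: minus_open_def)
  then have "?F holomorphic_on outside \<Gamma>"
    by (rule holomorphic_transform) (subst Fout, auto)
  moreover have "?F holomorphic_on inside \<Gamma>"
    by (rule holomorphic_transform[of f]) (use f in \<open>auto simp: cont_holo_def\<close>)
  ultimately have "?F holomorphic_on inside \<Gamma> \<union> outside \<Gamma>"
    using cl by (intro holomorphic_on_Un open_inside open_outside)
  then have hol: "?F holomorphic_on - \<gamma> ` {0..1}"
    using \<Gamma>(1) by (simp add: path_image_def)
  obtain L where "\<And>s t. s \<in> {0..1} \<Longrightarrow> t \<in> {0..1} \<Longrightarrow> norm (\<gamma> s - \<gamma> t) \<le> L * \<bar>s - t\<bar>"
    by (rule smooth_contour_lipschitz[OF \<gamma>]) blast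
  then have "?F holomorphic_on UNIV"
    by (rule holomorphic_off_lipschitz_curve[OF cont hol])
  moreover have "(?F \<longlongrightarrow> 0) at_infinity"
  proof -
    have "open (minus_open \<Gamma>)" "0 \<in> minus_open \<Gamma>"
      using open_minus_open[OF cp \<Gamma>(2)] by (auto simp: minus_open_def)
    then have "isCont h 0"
      using holomorphic_on_imp_continuous_on[OF hh] continuous_on_eq_continuous_at by blast
    then have "((\<lambda>z. h (inverse z)) \<longlongrightarrow> 0) at_infinity"
      using isCont_tendsto_compose[OF _ tendsto_inverse_0] h(2) by metis
    moreover have "eventually (\<lambda>z. h (inverse z) = ?F z) at_infinity"
    proof -
      obtain B where B: "\<And>z. z \<in> - outside \<Gamma> \<Longrightarrow> norm z \<le> B"
        using cobounded_outside[OF compact_imp_bounded[OF cp]] by (auto simp: bounded_iff)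
      have "h (inverse z) = ?F z" if "norm z \<ge> B + 1" for z
      proof -
        have "z \<in> outside \<Gamma>" using B[of z] that by force
        then show ?thesis by (intro Fout[symmetric] UnI2)
      qed
      then show ?thesis unfolding eventually_at_infinity by blast
    qed
    ultimately show ?thesis by (rule Lim_transform_eventually)
  qed
  ultimately have "?F t = 0" by (rule Liouville_weak_0)
  then show ?thesis using t by simp
qed

text \<open>If \<open>P d\<^sub>\<rho> = d\<^sub>\<sigma> Q\<close> on the contour with \<open>P\<close> regular outside and \<open>Q\<close> regular inside, then
  \<open>Q\<^sub>i\<^sub>j\<close> vanishes whenever \<open>\<rho>\<^sub>j < \<sigma>\<^sub>i\<close>, by Liouville's theorem. Since \<open>det Q \<noteq> 0\<close>, some term of the
  Leibniz formula is nonzero, which gives the permutation.\<close>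

lemma wh_indices_dominated:
  assumes \<gamma>: "smooth_contour \<gamma>" and \<Gamma>: "\<Gamma> = path_image \<gamma>" "0 \<in> inside \<Gamma>"
    and \<rho>: "partial_indices \<Gamma> m B \<rho>" and \<sigma>: "partial_indices \<Gamma> m B \<sigma>"
  obtains p where "p permutes {0..<m}" "\<And>i. i < m \<Longrightarrow> \<sigma> ! i \<le> \<rho> ! p i"
proof -
  have cp: "compact \<Gamma>" and "\<Gamma> \<noteq> {}" using smooth_contour_path[OF \<gamma>] \<Gamma> by auto
  then obtain t0 where t0: "t0 \<in> \<Gamma>" by blast
  note z = zero_notin_outside[OF \<Gamma>(2)]
  note sub = minus_open_subset[of \<Gamma>]
  have sub': "inside \<Gamma> \<subseteq> \<Gamma> \<union> inside \<Gamma>" by blast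
  define d where "d \<tau> t = mat_diag m (\<lambda>i. t powi (\<tau> ! i))" for \<tau> :: "int list" and t :: complex
  have d: "d \<tau> t \<in> carrier_mat m m" for \<tau> t by (simp add: d_def)
  have factors: "\<exists>H H'. regular_mat (minus_closed \<Gamma>) (minus_open \<Gamma>) m H \<and>
      regular_mat (\<Gamma> \<union> inside \<Gamma>) (inside \<Gamma>) m H' \<and> (\<forall>t\<in>\<Gamma>. B t = H (inverse t) * d \<tau> t * H' t)"
    if \<tau>: "partial_indices \<Gamma> m B \<tau>" for \<tau>
  proof -
    obtain Bm Bp where "minus_factor \<Gamma> m Bm" "plus_factor \<Gamma> m Bp"
      and B: "\<And>t. t \<in> \<Gamma> \<Longrightarrow> B t = Bm t * d \<tau> t * Bp t"
      using \<tau> unfolding partial_indices_def wh_factorization_def d_def by blast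
    then obtain H H' where "\<And>t. t \<in> \<Gamma> \<Longrightarrow> H (inverse t) = Bm t" "\<And>t. t \<in> \<Gamma> \<Longrightarrow> H' t = Bp t"
      "regular_mat (minus_closed \<Gamma>) (minus_open \<Gamma>) m H" "regular_mat (\<Gamma> \<union> inside \<Gamma>) (inside \<Gamma>) m H'"
      unfolding minus_factor_iff[OF cp \<Gamma>(2)] plus_factor_iff by blast
    with B show ?thesis by (intro exI[of _ H] exI[of _ H']) auto
  qed
  obtain H H' where H: "regular_mat (minus_closed \<Gamma>) (minus_open \<Gamma>) m H"
    "regular_mat (\<Gamma> \<union> inside \<Gamma>) (inside \<Gamma>) m H'" "\<And>t. t \<in> \<Gamma> \<Longrightarrow> B t = H (inverse t) * d \<rho> t * H' t"
    using factors[OF \<rho>] by blast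
  obtain J J' where J: "regular_mat (minus_closed \<Gamma>) (minus_open \<Gamma>) m J"
    "regular_mat (\<Gamma> \<union> inside \<Gamma>) (inside \<Gamma>) m J'" "\<And>t. t \<in> \<Gamma> \<Longrightarrow> B t = J (inverse t) * d \<sigma> t * J' t"
    using factors[OF \<sigma>] by blast
  obtain E where E: "regular_mat (minus_closed \<Gamma>) (minus_open \<Gamma>) m E"
    "\<And>w. w \<in> minus_closed \<Gamma> \<Longrightarrow> E w * J w = 1\<^sub>m m"
    using regular_mat_inverse[OF J(1) sub] by metis
  obtain E' where E': "regular_mat (\<Gamma> \<union> inside \<Gamma>) (inside \<Gamma>) m E'"
    "\<And>w. w \<in> \<Gamma> \<union> inside \<Gamma> \<Longrightarrow> H' w * E' w = 1\<^sub>m m"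
    using regular_mat_inverse[OF H(2) sub'] by metis
  \<comment> \<open>\<open>H d\<^sub>\<rho> H' = J d\<^sub>\<sigma> J'\<close> on the contour;
    multiplying by the inverse of \<open>J\<close> on the left and that of \<open>H'\<close> on the
    right separates exterior from interior functions.\<close>
  define P where "P w = E w * H w" for w
  define Q where "Q w = J' w * E' w" for w
  have P: "regular_mat (minus_closed \<Gamma>) (minus_open \<Gamma>) m P"
    unfolding P_def by (rule regular_mat_mult[OF E(1) H(1) sub])
  have Q: "regular_mat (\<Gamma> \<union> inside \<Gamma>) (inside \<Gamma>) m Q"
    unfolding Q_def by (rule regular_mat_mult[OF J(2) E'(1) sub'])
  have PQ: "P (inverse t) * d \<rho> t = d \<sigma> t * Q t" if t: "t \<in> \<Gamma>" for t
  proof -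
    have it: "inverse t \<in> minus_closed \<Gamma>" and t': "t \<in> \<Gamma> \<union> inside \<Gamma>"
      using t by (auto simp: minus_closed_def)
    have c: "E (inverse t) \<in> carrier_mat m m" "H (inverse t) \<in> carrier_mat m m"
      "J (inverse t) \<in> carrier_mat m m" "H' t \<in> carrier_mat m m" "J' t \<in> carrier_mat m m"
      "E' t \<in> carrier_mat m m"
      using regular_mat_carrier[OF E(1) it] regular_mat_carrier[OF H(1) it] regular_mat_carrier[OF J(1) it]
        regular_mat_carrier[OF H(2) t'] regular_mat_carrier[OF J(2) t'] regular_mat_carrier[OF E'(1) t']
      by simp_all
    note [simp] = mult_carrier_mat[of _ m m _ m] assoc_mult_mat[of _ m m _ m _ m]
    have "E (inverse t) * B t * E' t = P (inverse t) * d \<rho> t * (H' t * E' t)"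
      unfolding H(3)[OF t] P_def using c d by simp
    also have "\<dots> = P (inverse t) * d \<rho> t"
      unfolding E'(2)[OF t'] using c d by (simp add: P_def right_mult_one_mat[OF d])
    finally have 1: "E (inverse t) * B t * E' t = P (inverse t) * d \<rho> t" .
    have "E (inverse t) * B t * E' t = (E (inverse t) * J (inverse t)) * (d \<sigma> t * Q t)"
      unfolding J(3)[OF t] Q_def using c d by simp
    also have "\<dots> = d \<sigma> t * Q t"
      unfolding E(2)[OF it]
      by (rule left_mult_one_mat[OF mult_carrier_mat[OF d regular_mat_carrier[OF Q t']]])
    finally show ?thesis using 1 by simp
  qed
  have zero: "Q t $$ (i, j) = 0" if t: "t \<in> \<Gamma>" and ij: "i < m" "j < m" and less: "\<rho> ! j < \<sigma> ! i" for t i j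
  proof -
    \<comment> \<open>Entrywise, \<open>P\<^sub>i\<^sub>j\<close> times \<open>t\<close> to the
      power \<open>\<rho> ! j\<close> is \<open>Q\<^sub>i\<^sub>j\<close> times \<open>t\<close> to
      the power \<open>\<sigma> ! i\<close>. So \<open>Q\<^sub>i\<^sub>j\<close> continues to the
      exterior as \<open>w ^ e\<close> times \<open>P\<^sub>i\<^sub>j\<close>, which vanishes at
      \<open>w = 0\<close>.\<close>
    define e where "e = nat (\<sigma> ! i - \<rho> ! j)"
    have e: "e > 0" "\<sigma> ! i = \<rho> ! j + int e" using less by (auto simp: e_def)
    show ?thesis
    proof (rule Liouville_across_contour[OF \<gamma> \<Gamma>, where f = "\<lambda>z. Q z $$ (i, j)"
          and h = "\<lambda>w. w ^ e * P w $$ (i, j)"])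
      show "cont_holo (\<Gamma> \<union> inside \<Gamma>) (inside \<Gamma>) (\<lambda>z. Q z $$ (i, j))"
        by (rule regular_mat_entry[OF Q ij])
      show "cont_holo (minus_closed \<Gamma>) (minus_open \<Gamma>) (\<lambda>w. w ^ e * P w $$ (i, j))"
        by (intro cont_holo_mult cont_holo_power cont_holo_ident regular_mat_entry[OF P ij])
      fix s assume s: "s \<in> \<Gamma>"
      then have s0: "s \<noteq> 0" using z by auto
      have c: "P (inverse s) \<in> carrier_mat m m" "Q s \<in> carrier_mat m m"
        using s by (auto simp: minus_closed_def intro!: regular_mat_carrier[OF P] regular_mat_carrier[OF Q])
      have "P (inverse s) $$ (i, j) * s powi (\<rho> ! j) = s powi (\<sigma> ! i) * Q s $$ (i, j)"
        using arg_cong[OF PQ[OF s], of "\<lambda>M. M $$ (i, j)"] ij c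
        unfolding d_def mat_diag_mult_left[OF c(2)] mat_diag_mult_right[OF c(1)] by simp
      also have "s powi (\<sigma> ! i) = s powi (\<rho> ! j) * s ^ e"
        using s0 by (simp add: e(2) power_int_add)
      finally have "P (inverse s) $$ (i, j) = s ^ e * Q s $$ (i, j)"
        using s0 by (simp add: mult_ac)
      then show "Q s $$ (i, j) = inverse s ^ e * P (inverse s) $$ (i, j)"
        using s0 by (simp add: power_inverse field_simps)
    qed (use e t in auto)
  qed
  have Qc: "Q t0 \<in> carrier_mat m m" using regular_mat_carrier[OF Q] t0 by blast
  have "Determinant.det (Q t0) \<noteq> 0"
    using regular_mat_invertible[OF Q] t0 invertible_mat_iff_det[OF Qc] by blast
  then obtain p where p: "p permutes {0..<m}" "(\<Prod>i = 0..<m. Q t0 $$ (i, p i)) \<noteq> 0"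
    unfolding det_def'[OF Qc] by (metis (mono_tags, lifting) mem_Collect_eq mult_zero_right sum.neutral)
  have "\<sigma> ! i \<le> \<rho> ! p i" if i: "i < m" for i
  proof (rule ccontr)
    assume "\<not> \<sigma> ! i \<le> \<rho> ! p i"
    then have "Q t0 $$ (i, p i) = 0"
      using i p(1) by (intro zero t0) (auto simp: permutes_less)
    with p(2) i show False by (simp add: prod_zero_iff)
  qed
  with p(1) show ?thesis by (rule that)
qed

text \<open>Domination in both directions makes the sums of the two lists equal; then the termwise
  inequality along one permutation must be an equality in every place.\<close>

theorem partial_indices_unique:
  assumes \<gamma>: "smooth_contour \<gamma>" "0 \<in> inside (path_image \<gamma>)"
    and \<rho>: "partial_indices (path_image \<gamma>) m B \<rho>" and \<sigma>: "partial_indices (path_image \<gamma>) m B \<sigma>"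
  shows "mset \<rho> = mset \<sigma>"
proof -
  have len: "length \<rho> = m" "length \<sigma> = m"
    using \<rho> \<sigma> by (auto simp: partial_indices_def wh_factorization_def)
  have sum_le: "(\<Sum>i = 0..<m. \<beta> ! i) \<le> (\<Sum>i = 0..<m. \<alpha> ! i)"
    if \<alpha>\<beta>: "partial_indices (path_image \<gamma>) m B \<alpha>" "partial_indices (path_image \<gamma>) m B \<beta>" for \<alpha> \<beta> :: "int list"
  proof -
    obtain p where p: "p permutes {0..<m}" "\<And>i. i < m \<Longrightarrow> \<beta> ! i \<le> \<alpha> ! p i"
      by (rule wh_indices_dominated[OF \<gamma>(1) refl \<gamma>(2) \<alpha>\<beta>]) blast
    have "(\<Sum>i = 0..<m. \<beta> ! i) \<le> (\<Sum>i = 0..<m. \<alpha> ! p i)"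
      using p(2) by (intro sum_mono) auto
    also have "\<dots> = (\<Sum>i = 0..<m. \<alpha> ! i)"
      using sum.permute[OF p(1), of "\<lambda>i. \<alpha> ! i"] by (simp add: o_def)
    finally show ?thesis .
  qed
  obtain p where p: "p permutes {0..<m}" "\<And>i. i < m \<Longrightarrow> \<sigma> ! i \<le> \<rho> ! p i"
    by (rule wh_indices_dominated[OF \<gamma>(1) refl \<gamma>(2) \<rho> \<sigma>]) blast
  have "(\<Sum>i = 0..<m. \<rho> ! p i - \<sigma> ! i) = (\<Sum>i = 0..<m. \<rho> ! i) - (\<Sum>i = 0..<m. \<sigma> ! i)"
    using sum.permute[OF p(1), of "\<lambda>i. \<rho> ! i"] by (simp add: o_def sum_subtractf)
  also have "\<dots> = 0" using sum_le[OF \<rho> \<sigma>] sum_le[OF \<sigma> \<rho>] by simp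
  finally have "\<forall>i\<in>{0..<m}. \<rho> ! p i - \<sigma> ! i = 0"
    using p(2) by (subst (asm) sum_nonneg_eq_0_iff) auto
  then have "\<sigma> = permute_list p \<rho>"
    using len by (auto simp: permute_list_def intro!: nth_equalityI)
  then show ?thesis
    using mset_permute_list[of p \<rho>] p(1) len by (simp add: atLeast0LessThan)
qed

section \<open>The index of a scalar factorization\<close>

text \<open>Any continuous logarithm computes the winding number: two of them differ by a continuous
  function whose distinct values are at least \<open>2 * pi\<close> apart, hence by a
  constant.\<close>

lemma winding_number_of_exp:
  assumes Q: "path Q" and p: "\<And>t. t \<in> {0..1} \<Longrightarrow> p t = exp (Q t)"
  shows "Q 1 - Q 0 = 2 * of_real pi * \<i> * winding_number p 0"
proof -
  have cQ: "continuous_on {0..1} Q" using Q by (simp add: path_def)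
  have "path p"
    unfolding path_def by (rule continuous_on_eq[OF continuous_on_exp[OF cQ]]) (simp add: p)
  moreover have "0 \<notin> path_image p"
    using p by (auto simp: path_image_def)
  ultimately obtain q where q: "path q"
    "pathfinish q - pathstart q = 2 * of_real pi * \<i> * winding_number p 0"
    "\<And>t. t \<in> {0..1} \<Longrightarrow> p t = 0 + exp (q t)"
    using winding_number_as_continuous_log by blast
  have ex1: "exp (q t - Q t) = 1" if "t \<in> {0..1}" for t
    using p[OF that] q(3)[OF that] by (simp add: exp_diff)
  have gap: "2 * pi \<le> norm (u - v)" if "exp u = 1" "exp v = 1" "u \<noteq> v" for u v :: complex
  proof -
    obtain m n :: int where mn: "Im u = of_int (2 * m) * pi" "Im v = of_int (2 * n) * pi"
      "Re u = 0" "Re v = 0"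
      using \<open>exp u = 1\<close> \<open>exp v = 1\<close> by (auto simp: exp_eq_1)
    then have "m \<noteq> n" using \<open>u \<noteq> v\<close> by (auto simp: complex_eq_iff)
    then have "1 \<le> \<bar>real_of_int (m - n)\<bar>" by linarith
    then have "2 * pi \<le> \<bar>real_of_int (m - n)\<bar> * (2 * pi)" by simp
    also have "\<dots> = \<bar>Im (u - v)\<bar>"
    proof -
      have "Im (u - v) = real_of_int (m - n) * (2 * pi)" by (simp add: mn algebra_simps)
      then show ?thesis by (simp only: abs_mult) simp
    qed
    also have "\<dots> \<le> norm (u - v)" by (rule abs_Im_le_cmod)
    finally show ?thesis .
  qed
  have "(\<lambda>t. q t - Q t) constant_on {0..1::real}"
  proof (rule continuous_discrete_range_constant)
    show "continuous_on {0..1} (\<lambda>t. q t - Q t)"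
      using q(1) cQ unfolding path_def by (intro continuous_intros)
    fix x :: real assume "x \<in> {0..1}"
    then show "\<exists>e>0. \<forall>y. y \<in> {0..1} \<and> q y - Q y \<noteq> q x - Q x \<longrightarrow> e \<le> norm (q y - Q y - (q x - Q x))"
      by (intro exI[of _ "2 * pi"]) (simp add: gap ex1)
  qed simp
  then obtain c where "\<And>t. t \<in> {0..1} \<Longrightarrow> q t - Q t = c" unfolding constant_on_def by blast
  from this[of 0] this[of 1] have "q 1 - Q 1 = q 0 - Q 0" by simp
  then show ?thesis using q(2) by (simp add: pathfinish_def pathstart_def algebra_simps)
qed

text \<open>A compact plane set that does not separate the plane is Borsukian. Both closed domains
  are of this kind, the exterior one in the coordinate \<open>1/z\<close>.\<close>

lemma continuous_log_of_nonvanishing: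
  fixes h :: "complex \<Rightarrow> complex"
  assumes "compact K" "connected (- K)" "continuous_on K h" "\<And>z. z \<in> K \<Longrightarrow> h z \<noteq> 0"
  obtains l where "continuous_on K l" "\<And>z. z \<in> K \<Longrightarrow> h z = exp (l z)"
proof -
  have "Borsukian K" using assms(1,2) by (simp add: Borsukian_separation_compact)
  moreover have "h \<in> K \<rightarrow> - {0}" using assms(4) by auto
  ultimately show ?thesis
    using assms(3) that unfolding Borsukian_continuous_logarithm by blast
qed

text \<open>The complement is the image under inversion of the interior without the origin; removing
  a point from a connected open plane set leaves it connected. Boundedness holds because a disc
  around the origin lies in the interior.\<close>

lemma minus_closed_topology:
  assumes \<gamma>: "smooth_contour \<gamma>" and \<Gamma>: "\<Gamma> = path_image \<gamma>" "0 \<in> inside \<Gamma>"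
  shows "compact (minus_closed \<Gamma>)" "connected (- minus_closed \<Gamma>)"
proof -
  have cl: "closed \<Gamma>" using smooth_contour_path[OF \<gamma>] \<Gamma> compact_imp_closed by auto
  have op: "open (inside \<Gamma> - {0})" using open_inside[OF cl] by (intro open_delete)
  have conn: "connected (inside \<Gamma> - {0})"
    using Jordan_inside_outside[of \<gamma>] \<gamma> \<Gamma> open_inside[OF cl]
    by (intro connected_open_delete) (auto simp: smooth_contour_def)
  have eq: "- minus_closed \<Gamma> = {w. inverse w \<in> inside \<Gamma> - {0}}"
    using union_with_outside[of \<Gamma>] by (auto simp: minus_closed_def)
  also have "\<dots> = inverse ` (inside \<Gamma> - {0})"
    by (auto simp: image_iff intro!: bexI[of _ "inverse _"])
  finally show "connected (- minus_closed \<Gamma>)"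
    using conn by (auto intro!: connected_continuous_image continuous_intros)
  have "open (- minus_closed \<Gamma>)" unfolding eq using op by (intro open_inverse_vimage) auto
  moreover obtain \<delta> where \<delta>: "\<delta> > 0" "ball 0 \<delta> \<subseteq> inside \<Gamma>"
    using open_inside[OF cl] \<Gamma>(2) open_contains_ball by blast
  have "norm w \<le> inverse \<delta>" if w: "w \<in> minus_closed \<Gamma>" for w
  proof (cases "w = 0")
    case False
    then have "inverse w \<notin> inside \<Gamma>"
      using w union_with_outside[of \<Gamma>] by (auto simp: minus_closed_def)
    then have "\<delta> \<le> inverse (norm w)" using \<delta>(2) by (force simp: norm_inverse)
    then have "inverse (inverse (norm w)) \<le> inverse \<delta>" using \<delta>(1) by (rule le_imp_inverse_le)
    then show ?thesis by simp
  qed (use \<delta> in auto)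
  then have "bounded (minus_closed \<Gamma>)" by (auto simp: bounded_iff)
  ultimately show "compact (minus_closed \<Gamma>)"
    by (simp add: compact_eq_bounded_closed closed_def)
qed

lemma invertible_mat_1x1:
  assumes "(M :: complex mat) \<in> carrier_mat 1 1" "invertible_mat M"
  shows "M $$ (0, 0) \<noteq> 0"
proof -
  obtain B where B: "B \<in> carrier_mat 1 1" "M * B = 1\<^sub>m 1"
    using assms invertible_mat_iff_inverse by blast
  have "(M * B) $$ (0, 0) = M $$ (0, 0) * B $$ (0, 0)"
    by (subst index_mult_mat_sum[OF assms(1) B(1)]) auto
  then show ?thesis using B(2) by auto
qed

text \<open>A logarithm of \<open>f\<close> along \<open>\<gamma>\<close> is the sum of the
  logarithms of the two factors and \<open>r\<close> times a logarithm of \<open>\<gamma>\<close>.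
  The first two are functions of the point on the contour and return to their initial values, so
  only \<open>r\<close> times the winding number 1 of \<open>\<gamma>\<close> remains.\<close>

theorem scalar_partial_index:
  assumes \<gamma>: "smooth_contour \<gamma>" and \<Gamma>: "\<Gamma> = path_image \<gamma>" "0 \<in> inside \<Gamma>"
    and r: "partial_indices \<Gamma> 1 (\<lambda>t. mat 1 1 (\<lambda>_. f t)) [r]"
  shows "contour_index \<gamma> f = r"
proof -
  have cp: "compact \<Gamma>" and path: "path \<gamma>" using smooth_contour_path[OF \<gamma>] \<Gamma> by auto
  note z = zero_notin_outside[OF \<Gamma>(2)]
  have on: "\<gamma> x \<in> \<Gamma>" if "x \<in> {0..1}" for x using that \<Gamma>(1) by (auto simp: path_image_def)
  obtain Bm Bp where B: "minus_factor \<Gamma> 1 Bm" "plus_factor \<Gamma> 1 Bp"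
    "\<And>t. t \<in> \<Gamma> \<Longrightarrow> mat 1 1 (\<lambda>_. f t) = Bm t * mat_diag 1 (\<lambda>i. t powi ([r] ! i)) * Bp t"
    using r unfolding partial_indices_def wh_factorization_def by blast
  obtain H where H: "\<forall>t\<in>\<Gamma>. H (inverse t) = Bm t" "regular_mat (minus_closed \<Gamma>) (minus_open \<Gamma>) 1 H"
    using B(1) unfolding minus_factor_iff[OF cp \<Gamma>(2)] by blast
  obtain H' where H': "\<forall>t\<in>\<Gamma>. H' t = Bp t" "regular_mat (\<Gamma> \<union> inside \<Gamma>) (inside \<Gamma>) 1 H'"
    using B(2) unfolding plus_factor_iff by blast
  have inv: "inverse t \<in> minus_closed \<Gamma>" if "t \<in> \<Gamma>" for t
    using that by (simp add: minus_closed_def)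
  have f: "f t = H (inverse t) $$ (0, 0) * t powi r * H' t $$ (0, 0)" if t: "t \<in> \<Gamma>" for t
  proof -
    have c: "H (inverse t) \<in> carrier_mat 1 1" "H' t \<in> carrier_mat 1 1"
      using regular_mat_carrier[OF H(2) inv[OF t]] regular_mat_carrier[OF H'(2), of t] t by auto
    have d: "mat_diag 1 (\<lambda>i. t powi ([r] ! i)) \<in> carrier_mat 1 1" by simp
    have "f t = mat 1 1 (\<lambda>_. f t) $$ (0, 0)" by simp
    also have "\<dots> = (H (inverse t) * mat_diag 1 (\<lambda>i. t powi ([r] ! i)) * H' t) $$ (0, 0)"
      using B(3)[OF t] H(1) H'(1) t by simp
    also have "\<dots> = (H (inverse t) * mat_diag 1 (\<lambda>i. t powi ([r] ! i))) $$ (0, 0) * H' t $$ (0, 0)"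
      by (subst index_mult_mat_sum[OF mult_carrier_mat[OF c(1) d] c(2)]) auto
    also have "(H (inverse t) * mat_diag 1 (\<lambda>i. t powi ([r] ! i))) $$ (0, 0) =
        H (inverse t) $$ (0, 0) * t powi r"
      by (subst index_mult_mat_sum[OF c(1) d]) (auto simp: mat_diag_def)
    finally show ?thesis .
  qed
  have cont: "continuous_on (minus_closed \<Gamma>) (\<lambda>w. H w $$ (0, 0))"
    "continuous_on (\<Gamma> \<union> inside \<Gamma>) (\<lambda>w. H' w $$ (0, 0))"
    using regular_mat_entry[OF H(2), of 0 0] regular_mat_entry[OF H'(2), of 0 0]
    by (auto simp: cont_holo_def)
  obtain l where l: "continuous_on (minus_closed \<Gamma>) l"
    "\<And>w. w \<in> minus_closed \<Gamma> \<Longrightarrow> H w $$ (0, 0) = exp (l w)"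
    using continuous_log_of_nonvanishing[OF minus_closed_topology[OF \<gamma> \<Gamma>] cont(1)]
      invertible_mat_1x1[OF regular_mat_carrier[OF H(2)] regular_mat_invertible[OF H(2)]] by blast
  have K: "compact (\<Gamma> \<union> inside \<Gamma>)" "connected (- (\<Gamma> \<union> inside \<Gamma>))"
    using cp connected_outside[OF compact_imp_bounded[OF cp]] compact_imp_bounded[OF cp]
    by (auto simp: compact_eq_bounded_closed union_with_inside bounded_inside open_outside
        closed_Compl cobounded_outside)
  obtain l' where l': "continuous_on (\<Gamma> \<union> inside \<Gamma>) l'"
    "\<And>w. w \<in> \<Gamma> \<union> inside \<Gamma> \<Longrightarrow> H' w $$ (0, 0) = exp (l' w)"
    using continuous_log_of_nonvanishing[OF K cont(2)]
      invertible_mat_1x1[OF regular_mat_carrier[OF H'(2)] regular_mat_invertible[OF H'(2)]] by blast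
  have "0 \<notin> path_image \<gamma>" using z \<Gamma>(1) by blast
  then obtain q where q: "path q" "pathfinish q - pathstart q = 2 * of_real pi * \<i> * winding_number \<gamma> 0"
    "\<And>t. t \<in> {0..1} \<Longrightarrow> \<gamma> t = 0 + exp (q t)"
    using winding_number_as_continuous_log[OF path] by blast
  define Q where "Q x = l (inverse (\<gamma> x)) + of_int r * q x + l' (\<gamma> x)" for x
  have c\<gamma>: "continuous_on {0..1} \<gamma>" and cq: "continuous_on {0..1} q"
    using path q(1) by (auto simp: path_def)
  have ci: "continuous_on {0..1} (\<lambda>x. inverse (\<gamma> x))"
    using on z by (intro continuous_on_inverse[OF c\<gamma>]) force
  have "continuous_on {0..1} Q"
    unfolding Q_def using on inv
    by (intro continuous_on_add continuous_on_mult continuous_on_const cq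
        continuous_on_compose2[OF l(1) ci] continuous_on_compose2[OF l'(1) c\<gamma>]) auto
  then have "path Q" by (simp add: path_def)
  moreover have "(f \<circ> \<gamma>) x = exp (Q x)" if x: "x \<in> {0..1}" for x
  proof -
    have "exp (of_int r * q x) = \<gamma> x powi r"
      using q(3)[OF x] by (simp add: exp_power_int mult.commute)
    then show ?thesis
      using f[OF on[OF x]] l(2)[OF inv[OF on[OF x]]] l'(2)[of "\<gamma> x"] on[OF x]
      by (simp add: Q_def exp_add)
  qed
  ultimately have "Q 1 - Q 0 = 2 * of_real pi * \<i> * winding_number (f \<circ> \<gamma>) 0"
    by (rule winding_number_of_exp)
  moreover have "\<gamma> 1 = \<gamma> 0" "winding_number \<gamma> 0 = 1"
    using \<gamma> \<Gamma> by (auto simp: smooth_contour_def pathfinish_def pathstart_def)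
  then have "Q 1 - Q 0 = 2 * of_real pi * \<i> * of_int r"
    using q(2) by (simp add: Q_def pathfinish_def pathstart_def algebra_simps flip: right_diff_distrib)
  ultimately have "winding_number (f \<circ> \<gamma>) 0 = of_int r" by simp
  then show ?thesis unfolding contour_index_def by auto
qed

section \<open>Factorization of the block diagonal form\<close>

lemma repeated_blocks_cong:
  "(\<And>k. k < s \<Longrightarrow> M k = N k) \<Longrightarrow> repeated_blocks s d M = repeated_blocks s d N"
proof -
  assume "\<And>k. k < s \<Longrightarrow> M k = N k"
  then have "map (\<lambda>k. replicate (d k) (M k)) [0..<s] = map (\<lambda>k. replicate (d k) (N k)) [0..<s]"
    by (intro map_cong) auto
  then show ?thesis by (simp only: repeated_blocks_def)
qed

text \<open>Each entry is an entry of one block or constantly zero, and which of the two depends on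
  the position alone, not on \<open>z\<close>.\<close>

lemma regular_repeated_blocks:
  assumes H: "\<And>k. k < s \<Longrightarrow> regular_mat K U (d k) (H k)" and U: "U \<subseteq> K"
    and d: "\<And>k. k < s \<Longrightarrow> 0 < d k"
  shows "regular_mat K U (\<Sum>k<s. (d k)\<^sup>2) (\<lambda>z. repeated_blocks s d (\<lambda>k. H k z))"
  unfolding regular_mat_def cont_holo_mat_def
proof (intro conjI ballI allI impI)
  fix z assume z: "z \<in> K"
  note c = regular_mat_carrier[OF H z]
  show "repeated_blocks s d (\<lambda>k. H k z) \<in> carrier_mat (\<Sum>k<s. (d k)\<^sup>2) (\<Sum>k<s. (d k)\<^sup>2)"
    by (rule repeated_blocks_carrier[OF c])
  show "invertible_mat (repeated_blocks s d (\<lambda>k. H k z))"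
    using regular_mat_invertible[OF H z] by (simp add: invertible_repeated_blocks[OF c d])
next
  fix i j assume ij: "i < (\<Sum>k<s. (d k)\<^sup>2)" "j < (\<Sum>k<s. (d k)\<^sup>2)"
  obtain k q p where i: "coefficient_list s d ! i = (k, q, p)"
    by (cases "coefficient_list s d ! i") auto
  obtain k' q' p' where j: "coefficient_list s d ! j = (k', q', p')"
    by (cases "coefficient_list s d ! j") auto
  have "(k, q, p) \<in> set (coefficient_list s d)" "(k', q', p') \<in> set (coefficient_list s d)"
    using ij i j nth_mem[of i "coefficient_list s d"] nth_mem[of j "coefficient_list s d"]
    by (simp_all add: length_coefficient_list)
  then have lt: "k < s" "p < d k" "k' < s" "p' < d k'" by (auto simp: set_coefficient_list)
  have "cont_holo K U (\<lambda>z. if k = k' \<and> q = q' then H k z $$ (p, p') else 0)"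
  proof (cases "k = k' \<and> q = q'")
    case True
    then have "p' < d k" using lt by simp
    with True regular_mat_entry[OF H[OF lt(1)] lt(2)] show ?thesis by simp
  next
    case False
    then show ?thesis by (simp only: if_False cont_holo_const)
  qed
  then show "cont_holo K U (\<lambda>z. repeated_blocks s d (\<lambda>k. H k z) $$ (i, j))"
    using U by (rule cont_holo_cong) (rule repeated_blocks_index[OF regular_mat_carrier[OF H] ij i j])
qed

lemma minus_factor_carrier: "minus_factor \<Gamma> m B \<Longrightarrow> t \<in> \<Gamma> \<Longrightarrow> B t \<in> carrier_mat m m"
  unfolding minus_factor_def by (metis UnI1)

lemma plus_factor_carrier: "plus_factor \<Gamma> m B \<Longrightarrow> t \<in> \<Gamma> \<Longrightarrow> B t \<in> carrier_mat m m"
  unfolding plus_factor_def by (metis UnI1)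

lemma unitary_mat_invertible:
  assumes "unitary_mat n F"
  shows "F \<in> carrier_mat n n" "invertible_mat F" "mat_adjoint F \<in> carrier_mat n n"
    "invertible_mat (mat_adjoint F)"
  using assms mat_adjoint_carrier[of F n n] invertible_mat_iff_inverse[of F n]
    invertible_mat_iff_inverse[of "mat_adjoint F" n]
  by (auto simp: unitary_mat_def)

text \<open>Constant invertible matrices are regular on both sides of the contour, so the adjoint of
  \<open>F\<close> can be absorbed into the minus factor and \<open>F\<close> into the plus
  factor.\<close>

lemma wh_factorization_repeated_blocks:
  assumes \<Gamma>: "compact \<Gamma>" "0 \<in> inside \<Gamma>" and F: "unitary_mat n F"
    and n: "n = (\<Sum>k<s. (d k)\<^sup>2)" and d: "\<And>k. k < s \<Longrightarrow> 0 < d k"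
    and A: "\<And>t. t \<in> \<Gamma> \<Longrightarrow> A t = mat_adjoint F * repeated_blocks s d (\<lambda>k. L k t) * F"
    and wh: "\<And>k. k < s \<Longrightarrow> wh_factorization \<Gamma> (d k) (L k) (Lm k) (\<rho> k) (Lp k)"
  shows "wh_factorization \<Gamma> n A (\<lambda>t. mat_adjoint F * repeated_blocks s d (\<lambda>k. Lm k t))
    (repeated_indices s d \<rho>) (\<lambda>t. repeated_blocks s d (\<lambda>k. Lp k t) * F)"
  unfolding wh_factorization_def
proof (intro conjI ballI)
  note Fi = unitary_mat_invertible[OF F]
  have m: "minus_factor \<Gamma> (d k) (Lm k)" and p: "plus_factor \<Gamma> (d k) (Lp k)"
    and len: "length (\<rho> k) = d k" if "k < s" for k
    using wh[OF that] by (auto simp: wh_factorization_def)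
  have "\<forall>k. \<exists>H. k < s \<longrightarrow> (\<forall>t\<in>\<Gamma>. H (inverse t) = Lm k t) \<and>
      regular_mat (minus_closed \<Gamma>) (minus_open \<Gamma>) (d k) H"
    using m unfolding minus_factor_iff[OF \<Gamma>] by blast
  then obtain H where H: "\<And>k t. k < s \<Longrightarrow> t \<in> \<Gamma> \<Longrightarrow> H k (inverse t) = Lm k t"
    "\<And>k. k < s \<Longrightarrow> regular_mat (minus_closed \<Gamma>) (minus_open \<Gamma>) (d k) (H k)" by metis
  have "regular_mat (minus_closed \<Gamma>) (minus_open \<Gamma>) n
      (\<lambda>w. mat_adjoint F * repeated_blocks s d (\<lambda>k. H k w))"
    unfolding n using Fi(3,4) n
    by (intro regular_mat_mult[OF regular_mat_const regular_repeated_blocks] minus_open_subset H(2) d) auto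
  moreover have "repeated_blocks s d (\<lambda>k. H k (inverse t)) = repeated_blocks s d (\<lambda>k. Lm k t)"
    if "t \<in> \<Gamma>" for t
    using that by (intro repeated_blocks_cong H(1))
  ultimately show "minus_factor \<Gamma> n (\<lambda>t. mat_adjoint F * repeated_blocks s d (\<lambda>k. Lm k t))"
    unfolding minus_factor_iff[OF \<Gamma>]
    by (intro exI[of _ "\<lambda>w. mat_adjoint F * repeated_blocks s d (\<lambda>k. H k w)"]) auto
  have "\<forall>k. \<exists>H. k < s \<longrightarrow> (\<forall>t\<in>\<Gamma>. H t = Lp k t) \<and>
      regular_mat (\<Gamma> \<union> inside \<Gamma>) (inside \<Gamma>) (d k) H"
    using p unfolding plus_factor_iff by blast
  then obtain J where J: "\<And>k t. k < s \<Longrightarrow> t \<in> \<Gamma> \<Longrightarrow> J k t = Lp k t"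
    "\<And>k. k < s \<Longrightarrow> regular_mat (\<Gamma> \<union> inside \<Gamma>) (inside \<Gamma>) (d k) (J k)" by metis
  have "regular_mat (\<Gamma> \<union> inside \<Gamma>) (inside \<Gamma>) n (\<lambda>w. repeated_blocks s d (\<lambda>k. J k w) * F)"
    unfolding n using Fi(1,2) n
    by (intro regular_mat_mult[OF regular_repeated_blocks regular_mat_const] J(2) d) auto
  moreover have "repeated_blocks s d (\<lambda>k. J k t) = repeated_blocks s d (\<lambda>k. Lp k t)"
    if "t \<in> \<Gamma>" for t
    using that by (intro repeated_blocks_cong J(1))
  ultimately show "plus_factor \<Gamma> n (\<lambda>t. repeated_blocks s d (\<lambda>k. Lp k t) * F)"
    unfolding plus_factor_iff
    by (intro exI[of _ "\<lambda>w. repeated_blocks s d (\<lambda>k. J k w) * F"]) auto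
  show "length (repeated_indices s d \<rho>) = n"
    unfolding n by (rule length_repeated_indices[OF len])
  fix t assume t: "t \<in> \<Gamma>"
  let ?D = "\<lambda>k. mat_diag (d k) (\<lambda>i. t powi (\<rho> k ! i))"
  let ?R = "repeated_blocks s d"
  note cm = minus_factor_carrier[OF m t] and cp = plus_factor_carrier[OF p t]
  have "?R (\<lambda>k. L k t) = ?R (\<lambda>k. (Lm k t * ?D k) * Lp k t)"
    using wh t by (intro repeated_blocks_cong) (simp add: wh_factorization_def)
  also have "\<dots> = ?R (\<lambda>k. Lm k t * ?D k) * ?R (\<lambda>k. Lp k t)"
    using cm cp by (intro repeated_blocks_mult) (auto intro!: mult_carrier_mat)
  also have "?R (\<lambda>k. Lm k t * ?D k) = ?R (\<lambda>k. Lm k t) * ?R ?D"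
    using cm by (intro repeated_blocks_mult) auto
  also have "?R ?D = mat_diag n (\<lambda>i. t powi (repeated_indices s d \<rho> ! i))"
    unfolding n by (rule repeated_blocks_mat_diag[OF len])
  finally have R: "?R (\<lambda>k. L k t) =
      ?R (\<lambda>k. Lm k t) * mat_diag n (\<lambda>i. t powi (repeated_indices s d \<rho> ! i)) * ?R (\<lambda>k. Lp k t)" .
  have c: "?R (\<lambda>k. Lm k t) \<in> carrier_mat n n" "?R (\<lambda>k. Lp k t) \<in> carrier_mat n n"
    unfolding n using cm cp by (auto intro!: repeated_blocks_carrier)
  note [simp] = mult_carrier_mat[of _ n n _ n] assoc_mult_mat[of _ n n _ n _ n]
  show "A t = mat_adjoint F * ?R (\<lambda>k. Lm k t) *
      mat_diag n (\<lambda>i. t powi (repeated_indices s d \<rho> ! i)) * (?R (\<lambda>k. Lp k t) * F)"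
    unfolding A[OF t] R using c Fi by simp
qed

lemma count_image_mset_set:
  "finite S \<Longrightarrow> count (image_mset c (mset_set S)) r = (\<Sum>k\<in>S. if c k = r then 1 else 0)"
  by (induction S rule: finite_induct) auto

lemma wh_algebra_sum:
  assumes "wh_algebra \<gamma> \<AA>" "finite S" "\<And>x. x \<in> S \<Longrightarrow> a x \<in> \<AA>"
  shows "(\<lambda>t. \<Sum>x\<in>S. a x t * c x) \<in> \<AA>"
  using assms(2,3)
proof (induction S)
  note alg = assms(1)[unfolded wh_algebra_def, THEN conjunct2]
  note unit = alg[THEN conjunct1]
    and add = alg[THEN conjunct2, THEN conjunct1, rule_format, THEN conjunct1]
    and scale = alg[THEN conjunct2, THEN conjunct2, THEN conjunct1, rule_format]
  {
    case empty
    show ?case using scale[OF unit, of 0] by simp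
  next
    case (insert x S)
    have "(\<lambda>t. c x * a x t + (\<Sum>x\<in>S. a x t * c x)) \<in> \<AA>"
      by (intro add scale insert.IH insert.prems) simp_all
    then show ?case using insert.hyps by (simp add: mult.commute)
  }
qed

theorem corollary2p1:
  fixes \<gamma> :: "real \<Rightarrow> complex"
    and \<AA> :: "(complex \<Rightarrow> complex) set"
    and G :: "('g, 'b) monoid_scheme"
    and n s :: nat
    and g :: "nat \<Rightarrow> 'g"
    and d :: "nat \<Rightarrow> nat"
    and \<phi> :: "nat \<Rightarrow> 'g \<Rightarrow> complex mat"
    and a :: "'g \<Rightarrow> complex \<Rightarrow> complex"
  defines "\<Gamma> \<equiv> path_image \<gamma>"
    and "A \<equiv> group_matrix G n g a"
    and "\<Lambda> \<equiv> (\<lambda>k. symbol G (d k) (\<phi> k) a)"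
    and "F \<equiv> fourier_matrix n g s d \<phi>"
  assumes contour: "smooth_contour \<gamma>" "0 \<in> inside \<Gamma>"
    and algebra: "wh_algebra \<gamma> \<AA>"
    and grp: "group G" "finite (carrier G)" "n = order G"
    and enum: "bij_betw g {0..<n} (carrier G)" "g 0 = \<one>\<^bsub>G\<^esub>"
    and reps: "irreducible_system G s d \<phi>"
    and coeffs: "\<And>x. x \<in> carrier G \<Longrightarrow> a x \<in> \<AA>"
    and inv: "invertible_on \<Gamma> n A"
  shows
    \<comment> \<open>the \<open>s\<close> smaller problems are posed in the same class and are solvable\<close>
    "(\<forall>k<s. entries_in \<AA> (d k) (\<Lambda> k) \<and> invertible_on \<Gamma> (d k) (\<Lambda> k) \<and>
            (\<exists>\<rho>. partial_indices \<Gamma> (d k) (\<Lambda> k) \<rho>))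
     \<comment> \<open>explicit reduction by a constant unitary matrix depending only on the group\<close>
   \<and> unitary_mat n F
   \<and> (\<forall>t\<in>\<Gamma>. A t = mat_adjoint F * repeated_blocks s d (\<lambda>k. \<Lambda> k t) * F)
   \<and> (\<forall>Lm \<rho> Lp.
        (\<forall>k<s. wh_factorization \<Gamma> (d k) (\<Lambda> k) (Lm k) (\<rho> k) (Lp k)) \<longrightarrow>
        wh_factorization \<Gamma> n A
          (\<lambda>t. mat_adjoint F * repeated_blocks s d (\<lambda>k. Lm k t))
          (repeated_indices s d \<rho>)
          (\<lambda>t. repeated_blocks s d (\<lambda>k. Lp k t) * F))
     \<comment> \<open>the partial indices, whatever factorizations they are read off from\<close>
   \<and> (\<forall>\<sigma> \<rho>.
        partial_indices \<Gamma> n A \<sigma> \<longrightarrow>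
        (\<forall>k<s. partial_indices \<Gamma> (d k) (\<Lambda> k) (\<rho> k)) \<longrightarrow>
        (\<forall>r. count (mset \<sigma>) r = (\<Sum>k<s. d k * count (mset (\<rho> k)) r)))
     \<comment> \<open>the representations of degree one yield \<open>[G:G']\<close> explicit partial indices\<close>
   \<and> card {k. k < s \<and> d k = 1} = card (rcosets\<^bsub>G\<^esub> (derived G (carrier G)))
   \<and> (\<forall>\<sigma>. partial_indices \<Gamma> n A \<sigma> \<longrightarrow>
        image_mset (\<lambda>k. contour_index \<gamma> (\<lambda>t. \<Lambda> k t $$ (0, 0))) (mset_set {k. k < s \<and> d k = 1})
          \<subseteq># mset \<sigma>)"
proof -
  interpret group G by (rule grp(1))
  interpret irreducible_family G s d \<phi>
    using grp(2) reps by unfold_locales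
  have cp: "compact \<Gamma>" using smooth_contour_path[OF contour(1)] by (simp add: \<Gamma>_def)
  have nsum: "n = (\<Sum>k<s. (d k)\<^sup>2)" using grp(3) sum_degrees_squared by simp
  have unitary: "unitary_mat n F" unfolding F_def by (rule unitary_fourier_matrix[OF grp(3) enum(1)])
  note Fi = unitary_mat_invertible[OF unitary]
  have A: "A t = mat_adjoint F * repeated_blocks s d (\<lambda>k. \<Lambda> k t) * F" for t
    unfolding A_def F_def \<Lambda>_def by (rule group_matrix_block_diagonalization[OF grp(3) enum(1)])
  have carrier: "\<Lambda> k t \<in> carrier_mat (d k) (d k)" for k t by (simp add: \<Lambda>_def)
  have entries: "entries_in \<AA> (d k) (\<Lambda> k)" for k
    unfolding entries_in_def \<Lambda>_def symbol_def
    using wh_algebra_sum[OF algebra grp(2) coeffs] by simp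
  \<comment> \<open>\<open>det (A t)\<close> is the product of the three determinants, so the middle
    one cannot vanish.\<close>
  have "invertible_mat (repeated_blocks s d (\<lambda>k. \<Lambda> k t))" if t: "t \<in> \<Gamma>" for t
  proof -
    let ?R = "repeated_blocks s d (\<lambda>k. \<Lambda> k t)"
    have R: "?R \<in> carrier_mat n n" unfolding nsum by (rule repeated_blocks_carrier[OF carrier])
    have At: "A t \<in> carrier_mat n n" "invertible_mat (A t)"
      using inv t by (auto simp: invertible_on_def)
    have "Determinant.det (A t) =
        Determinant.det (mat_adjoint F) * Determinant.det ?R * Determinant.det F"
      unfolding A using Fi R by (simp add: det_mult[of _ n] mult_carrier_mat[of _ n n _ n])
    then show ?thesis
      using At invertible_mat_iff_det[OF At(1)] invertible_mat_iff_det[OF R] by auto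
  qed
  then have invk: "invertible_on \<Gamma> (d k) (\<Lambda> k)" if "k < s" for k
    using that invertible_repeated_blocks[of s "\<lambda>k. \<Lambda> k _" d, OF carrier degree_pos] carrier
    by (auto simp: invertible_on_def)
  have solvable: "\<exists>\<rho>. partial_indices \<Gamma> (d k) (\<Lambda> k) \<rho>" if "k < s" for k
    using algebra entries[of k] invk[OF that] degree_pos[OF that]
    unfolding wh_algebra_def \<Gamma>_def by blast
  have wh: "wh_factorization \<Gamma> n A
          (\<lambda>t. mat_adjoint F * repeated_blocks s d (\<lambda>k. Lm k t))
          (repeated_indices s d \<rho>)
          (\<lambda>t. repeated_blocks s d (\<lambda>k. Lp k t) * F)"
    if "\<forall>k<s. wh_factorization \<Gamma> (d k) (\<Lambda> k) (Lm k) (\<rho> k) (Lp k)" for Lm \<rho> Lp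
    using that A by (intro wh_factorization_repeated_blocks[OF cp contour(2) unitary nsum degree_pos]) auto
  \<comment> \<open>The given factorizations of the symbols assemble to one of \<open>A\<close> with
    the repeated indices; uniqueness carries the count over to an arbitrary
    \<open>\<sigma>\<close>.\<close>
  have count: "count (mset \<sigma>) r = (\<Sum>k<s. d k * count (mset (\<rho> k)) r)"
    if \<sigma>: "partial_indices \<Gamma> n A \<sigma>" and \<rho>: "\<forall>k<s. partial_indices \<Gamma> (d k) (\<Lambda> k) (\<rho> k)" for \<sigma> \<rho> r
  proof -
    have "\<forall>k. \<exists>Bm Bp. k < s \<longrightarrow> wh_factorization \<Gamma> (d k) (\<Lambda> k) Bm (\<rho> k) Bp"
      using \<rho> unfolding partial_indices_def by blast
    then obtain Lm Lp where "\<forall>k<s. wh_factorization \<Gamma> (d k) (\<Lambda> k) (Lm k) (\<rho> k) (Lp k)" by metis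
    from wh[OF this] have "partial_indices \<Gamma> n A (repeated_indices s d \<rho>)"
      unfolding partial_indices_def by blast
    then have "mset \<sigma> = mset (repeated_indices s d \<rho>)"
      using partial_indices_unique[OF contour(1)] contour(2) \<sigma> unfolding \<Gamma>_def by blast
    then show ?thesis by (simp add: count_repeated_indices)
  qed
  \<comment> \<open>Multiplicities are compared for each \<open>r\<close>: those of the degree-one
    indices are the summands with \<open>d k = 1\<close> in a sum of natural numbers.\<close>
  have explicit: "image_mset (\<lambda>k. contour_index \<gamma> (\<lambda>t. \<Lambda> k t $$ (0, 0))) (mset_set {k. k < s \<and> d k = 1})
          \<subseteq># mset \<sigma>" if \<sigma>: "partial_indices \<Gamma> n A \<sigma>" for \<sigma>
  proof (rule mset_subset_eqI)
    fix r
    let ?c = "\<lambda>k. contour_index \<gamma> (\<lambda>t. \<Lambda> k t $$ (0, 0))"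
    obtain \<rho> where \<rho>: "\<forall>k<s. partial_indices \<Gamma> (d k) (\<Lambda> k) (\<rho> k)" using solvable by metis
    have one: "\<rho> k = [?c k]" if k: "k < s" "d k = 1" for k
    proof -
      have pk: "partial_indices \<Gamma> 1 (\<Lambda> k) (\<rho> k)" using \<rho> k by metis
      then obtain x where x: "\<rho> k = [x]"
        by (auto simp: partial_indices_def wh_factorization_def length_Suc_conv)
      have "\<Lambda> k = (\<lambda>t. mat 1 1 (\<lambda>_. \<Lambda> k t $$ (0, 0)))"
        using carrier[of k] k(2) by (intro ext eq_matI) auto
      then have "partial_indices \<Gamma> 1 (\<lambda>t. mat 1 1 (\<lambda>_. \<Lambda> k t $$ (0, 0))) [x]"
        using pk x by simp
      then show ?thesis
        using scalar_partial_index[OF contour(1) \<Gamma>_def[THEN meta_eq_to_obj_eq] contour(2)] x by simp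
    qed
    have "count (image_mset ?c (mset_set {k. k < s \<and> d k = 1})) r =
        (\<Sum>k\<in>{k. k < s \<and> d k = 1}. count (mset (\<rho> k)) r)"
      by (subst count_image_mset_set) (auto simp: one intro!: sum.cong)
    also have "\<dots> = (\<Sum>k\<in>{k. k < s \<and> d k = 1}. d k * count (mset (\<rho> k)) r)"
      by (intro sum.cong) auto
    also have "\<dots> \<le> (\<Sum>k<s. d k * count (mset (\<rho> k)) r)"
      by (rule sum_mono2) auto
    also have "\<dots> = count (mset \<sigma>) r" by (rule count[OF \<sigma> \<rho>, symmetric])
    finally show "count (image_mset ?c (mset_set {k. k < s \<and> d k = 1})) r \<le> count (mset \<sigma>) r" .
  qed
  show ?thesis
    using entries invk solvable unitary A wh count card_degree_one explicit by blast
qed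

end
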